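(* Let $(F,\mu)\in\{(\mathcal{E},\sigma),(\mathcal{E}_p,\sigma_p)\}$, where in the second case the fixed directions satisfy $\mathrm{Span}(\theta_1,\dots,\theta_p)=\mathbb{R}^d$. Let $0<\alpha_0<1$, let $a>0$, let $\eta:=\mathcal{N}(0,I_{nd})$ on $\mathbb{R}^{n\times d}$, and let $\nu$ be a probability measure on $\mathbb{R}^{n\times d}$ absolutely continuous with respect to the Lebesgue measure. For each $\alpha\in(0,\alpha_0]$ consider the noised SGD scheme $$Y_\alpha^{(t+1)}=Y_\alpha^{(t)}-\alpha\,\varphi(Y_\alpha^{(t)},\theta^{(t+1)})+\alpha a\,\varepsilon^{(t+1)},\quad \big(Y_\alpha^{(0)},(\theta^{(t)})_t,(\varepsilon^{(t)})_t\big)\sim\nu\otimes\mu^{\otimes\mathbb{N}}\otimes\eta^{\otimes\mathbb{N}}.$$ Let $\mathcal{Z}:=\{Y\in\mathbb{R}^{n\times d}:0\in\partial_CF(Y)\}$ be the set of Clarke critical points of $F$. Then for every $\varepsilon>0$, $$\limsup_{t\to+\infty}\ \nu\otimes\mu^{\otimes\mathbb{N}}\otimes\eta^{\otimes\mathbb{N}}\big(d(Y_\alpha^{(t)},\mathcal{Z})>\varepsilon\big)\xrightarrow[\alpha\to0,\ \alpha\in(0,\alpha_0]]{}0,$$ where $d(\cdot,\mathcal{Z})$ is the Euclidean distance to the set $\mathcal{Z}$.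
   Context: Let $n,d\ge1$. A matrix $Y\in\mathbb{R}^{n\times d}$ is written $Y=(y_1,\dots,y_n)^T$ with rows $y_k\in\mathbb{R}^d$, $\gamma_Y:=\frac1n\sum_k\delta_{y_k}$. Fix $Z\in\mathbb{R}^{n\times d}$. $\sigma$ is the uniform probability measure on the unit sphere $\mathbb{S}^{d-1}$, and for fixed directions $\theta_1,\dots,\theta_p\in\mathbb{S}^{d-1}$, $\sigma_p:=\frac1p\sum_{i=1}^p\delta_{\theta_i}$. With $P_\theta(x)=\theta^Tx$, $\#$ the push-forward and $\mathrm{W}_2$ the 2-Wasserstein distance, set $w_\theta(Y):=\mathrm{W}_2^2(P_\theta\#\gamma_Y,P_\theta\#\gamma_Z)$, $\mathcal{E}(Y):=\int w_\theta(Y)\,d\sigma(\theta)$, $\mathcal{E}_p(Y):=\int w_\theta(Y)\,d\sigma_p(\theta)$; these are locally Lipschitz functions of $Y$. For $\theta\in\mathbb{S}^{d-1}$, $\tau_X^\theta$ is a permutation with $\theta^Tx_{\tau_X^\theta(1)}\le\dots\le\theta^Tx_{\tau_X^\theta(n)}$ (arbitrary measurable choice when ambiguous). The almost-everywhere gradient of $(Y,\theta)\mapsto w_\theta(Y)$ in $Y$ is $\varphi(Y,\theta)\in\mathbb{R}^{n\times d}$ whose $k$-th row is (the transpose of) $\frac2n\theta\theta^T\big(y_k-z_{\tau_Z^\theta\circ(\tau_Y^\theta)^{-1}(k)}\big)$. For $f:\mathbb{R}^D\to\mathbb{R}$ locally Lipschitz with differentiability set $\mathcal{D}_f$, the Clarke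 sub-differential is $\partial_Cf(x):=\mathrm{conv}\{v:\exists(x_i)\in\mathcal{D}_f^{\mathbb{N}},\ x_i\to x,\ \nabla f(x_i)\to v\}$. *)

theory Defs
  imports "HOL-Probability.Probability"
begin

text \<open>
  A matrix with rows \<open>y\<^sub>k\<close> in \<open>R\<^sup>d\<close> is an element of \<open>real ^ 'd ^ 'n\<close>, with \<open>Y $ k\<close> its
  \<open>k\<close>-th row; its norm is the Frobenius norm. Row indices range over a finite linearly ordered
  type (the indices \<open>1 < \<dots> < n\<close>), the order being used only to speak of sorted projections.
\<close>

definition coupling :: "'a measure \<Rightarrow> 'b measure \<Rightarrow> ('a \<times> 'b) measure \<Rightarrow> bool" where
  "coupling M N \<pi> \<longleftrightarrow>
     sets \<pi> = sets (M \<Otimes>\<^sub>M N) \<and> distr \<pi> M fst = M \<and> distr \<pi> N snd = N"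

text \<open>
  The infimum is taken in \<open>[0, \<infinity>]\<close>; it is finite for the finitely supported measures it is
  applied to (the product coupling has finite cost).
\<close>
definition wasserstein2 :: "'a::metric_space measure \<Rightarrow> 'a measure \<Rightarrow> real" where
  "wasserstein2 M N =
     sqrt (enn2real (INF \<pi>\<in>{\<pi>. coupling M N \<pi>}. \<integral>\<^sup>+ p. ennreal ((dist (fst p) (snd p))\<^sup>2) \<partial>\<pi>))"

definition row_measure :: "real ^ 'd ^ 'n \<Rightarrow> (real ^ 'd) measure" where
  "row_measure Y = distr (uniform_count_measure UNIV) borel (\<lambda>k. Y $ k)"

definition proj_w :: "real ^ 'd ^ 'n \<Rightarrow> real ^ 'd \<Rightarrow> real ^ 'd ^ 'n \<Rightarrow> real" where
  "proj_w Z \<theta> Y =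
     (wasserstein2 (distr (row_measure Y) borel (\<lambda>x. \<theta> \<bullet> x))
                   (distr (row_measure Z) borel (\<lambda>x. \<theta> \<bullet> x)))\<^sup>2"

abbreviation sphere_borel :: "'a::euclidean_space measure" where
  "sphere_borel \<equiv> restrict_space borel (sphere 0 1)"

text \<open>
  Uniform probability on the unit sphere: the law of \<open>x / |x|\<close> for \<open>x\<close> uniform in the unit ball,
  i.e. the normalised surface (cone) measure. In dimension 1 it is the uniform law on \<open>{-1, 1}\<close>.
  The push-forward also lives on the null point \<open>sgn 0 = 0\<close>, which the restriction removes.
  Probability measures on the sphere have the sphere itself as their space, so that samples are
  always unit vectors.
\<close>
definition uniform_sphere :: "'a::euclidean_space measure" where
  "uniform_sphere =
     restrict_space (distr (uniform_measure lborel (ball 0 1)) borel sgn) (sphere 0 1)"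

definition discrete_directions :: "nat \<Rightarrow> (nat \<Rightarrow> 'a) \<Rightarrow> 'a::euclidean_space measure" where
  "discrete_directions p \<theta>s = distr (uniform_count_measure {1..p}) sphere_borel \<theta>s"

definition sw_energy :: "real ^ 'd ^ 'n \<Rightarrow> real ^ 'd ^ 'n \<Rightarrow> real" where
  "sw_energy Z Y = (\<integral>\<theta>. proj_w Z \<theta> Y \<partial>uniform_sphere)"

definition sw_energy_p :: "nat \<Rightarrow> (nat \<Rightarrow> real ^ 'd) \<Rightarrow> real ^ 'd ^ 'n \<Rightarrow> real ^ 'd ^ 'n \<Rightarrow> real" where
  "sw_energy_p p \<theta>s Z Y = (\<integral>\<theta>. proj_w Z \<theta> Y \<partial>discrete_directions p \<theta>s)"

text \<open>\<open>\<tau> X \<theta>\<close> is the sorting permutation of the projections of the rows of \<open>X\<close> on \<open>\<theta>\<close>.\<close>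
definition sorting_selection ::
  "(real ^ 'd ^ 'n::{finite,linorder} \<Rightarrow> real ^ 'd \<Rightarrow> 'n \<Rightarrow> 'n) \<Rightarrow> bool" where
  "sorting_selection \<tau> \<longleftrightarrow>
     (\<forall>X. \<forall>\<theta>\<in>sphere 0 1. bij (\<tau> X \<theta>) \<and> mono (\<lambda>i. \<theta> \<bullet> X $ \<tau> X \<theta> i)) \<and>
     (\<lambda>(X, \<theta>). \<tau> X \<theta>) \<in> borel \<Otimes>\<^sub>M sphere_borel \<rightarrow>\<^sub>M count_space UNIV"

text \<open>The matrix product \<open>\<theta> \<theta>\<^sup>T v\<close> is written \<open>(\<theta> \<bullet> v) *\<^sub>R \<theta>\<close>.\<close>
definition sw_grad ::
  "(real ^ 'd ^ 'n \<Rightarrow> real ^ 'd \<Rightarrow> 'n \<Rightarrow> 'n) \<Rightarrow> real ^ 'd ^ 'n \<Rightarrow>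
     real ^ 'd ^ 'n \<Rightarrow> real ^ 'd \<Rightarrow> real ^ 'd ^ 'n" where
  "sw_grad \<tau> Z Y \<theta> =
     (\<chi> k. (2 / real CARD('n)) *\<^sub>R
             ((\<theta> \<bullet> (Y $ k - Z $ ((\<tau> Z \<theta> \<circ> inv (\<tau> Y \<theta>)) k))) *\<^sub>R \<theta>))"

definition clarke_subdiff :: "('a::euclidean_space \<Rightarrow> real) \<Rightarrow> 'a \<Rightarrow> 'a set" where
  "clarke_subdiff f x =
     convex hull {v. \<exists>X G. (\<forall>i::nat. GDERIV f (X i) :> G i) \<and> X \<longlonglongrightarrow> x \<and> G \<longlonglongrightarrow> v}"

definition clarke_critical :: "('a::euclidean_space \<Rightarrow> real) \<Rightarrow> 'a set" where
  "clarke_critical f = {x. 0 \<in> clarke_subdiff f x}"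

text \<open>
  Extended-valued, so that the distance to the empty set is \<open>\<infinity>\<close>, whereas \<open>infdist x {} = 0\<close>.
\<close>
definition set_distance :: "'a::metric_space \<Rightarrow> 'a set \<Rightarrow> ereal" where
  "set_distance x S = (INF s\<in>S. ereal (dist x s))"

lemma set_distance_eq_infdist:
  assumes "S \<noteq> {}"
  shows "set_distance x S = ereal (infdist x S)"
proof -
  have "bdd_below (dist x ` S)"
    by (rule bdd_belowI[where m = 0]) auto
  then have "ereal (Inf (dist x ` S)) = (INF s\<in>S. ereal (dist x s))"
    using assms ereal_Inf'[of "dist x ` S"] by (simp add: image_image)
  then show ?thesis
    using assms by (simp add: set_distance_def infdist_notempty)
qed

definition gaussian :: "'a::euclidean_space measure" where
  "gaussian = density lborel (\<lambda>x. \<Prod>b\<in>Basis. ennreal (std_normal_density (x \<bullet> b)))"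

text \<open>
  A sample consists of \<open>Y\<^sup>(\<^sup>0\<^sup>)\<close> and the two sequences \<open>\<theta>\<close>, \<open>\<epsilon>\<close>, whose entries
  with index 0 are not used.
\<close>
definition sample_measure ::
  "'a measure \<Rightarrow> 'b measure \<Rightarrow> 'c measure \<Rightarrow> ('a \<times> (nat \<Rightarrow> 'b) \<times> (nat \<Rightarrow> 'c)) measure" where
  "sample_measure \<nu> \<mu> \<eta> = \<nu> \<Otimes>\<^sub>M ((\<Pi>\<^sub>M t\<in>UNIV. \<mu>) \<Otimes>\<^sub>M (\<Pi>\<^sub>M t\<in>UNIV. \<eta>))"

primrec noised_sgd ::
  "('a::real_vector \<Rightarrow> 'b \<Rightarrow> 'a) \<Rightarrow> real \<Rightarrow> real \<Rightarrow> 'a \<times> (nat \<Rightarrow> 'b) \<times> (nat \<Rightarrow> 'a) \<Rightarrow> nat \<Rightarrow> 'a" where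
  "noised_sgd \<phi> a \<alpha> \<omega> 0 = fst \<omega>"
| "noised_sgd \<phi> a \<alpha> \<omega> (Suc t) =
     noised_sgd \<phi> a \<alpha> \<omega> t
       - \<alpha> *\<^sub>R \<phi> (noised_sgd \<phi> a \<alpha> \<omega> t) (fst (snd \<omega>) (Suc t))
       + (\<alpha> * a) *\<^sub>R snd (snd \<omega>) (Suc t)"

lemma prob_space_uniform_sphere: "prob_space (uniform_sphere :: 'a::euclidean_space measure)"
proof -
  let ?B = "ball 0 1 :: 'a set"
  let ?U = "uniform_measure lborel ?B"
  have fin: "emeasure lborel ?B < \<infinity>"
    by (rule emeasure_bounded_finite) auto
  have pos: "emeasure lborel ?B \<noteq> 0"
    using content_ball_pos[of 1 "0 :: 'a"] by (auto simp: measure_def)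
  have sgn: "(sgn :: 'a \<Rightarrow> 'a) \<in> measurable ?U borel"
    by (simp add: sgn_div_norm[abs_def] uniform_measure_def)
  interpret U: prob_space ?U
    using fin pos by (intro prob_space_uniform_measure) auto
  interpret D: prob_space "distr ?U borel sgn"
    by (rule U.prob_space_distr) (rule sgn)
  have ae: "AE x in distr ?U borel sgn. x \<in> sphere 0 1"
  proof (subst AE_distr_iff)
    have "AE x in lborel. x \<noteq> (0::'a)"
      by (rule AE_lborel_singleton)
    then show "AE x in ?U. sgn x \<in> (sphere 0 1 :: 'a set)"
      using fin pos by (subst AE_uniform_measure) (auto elim!: eventually_mono simp: norm_sgn)
  qed (use sgn in auto)
  have "emeasure (distr ?U borel sgn) (sphere 0 1) = 1"
    by (rule D.emeasure_eq_1_AE[OF _ ae]) auto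
  then show ?thesis
    unfolding uniform_sphere_def
    by (intro prob_spaceI) (simp add: emeasure_restrict_space space_restrict_space)
qed

end

theory Submission
  imports Defs
begin

text \<open>
  Sorting is optimal on the line (Kantorovich duality with explicit potentials), so \<open>w\<^sub>\<theta>\<close> is a
  minimum of quadratic functions of \<open>Y\<close>, one of which is tight at \<open>Y\<close> with gradient \<open>\<phi>(Y, \<theta>)\<close>.
  Hence \<open>F\<close> is semiconcave and \<open>\<Phi>(Y) = \<integral> \<phi>(Y, \<theta>) d\<mu>(\<theta>)\<close> is everywhere a supergradient; it is the
  gradient of \<open>F\<close> wherever \<open>\<Phi>\<close> is continuous, in particular almost everywhere. Semiconcavity gives
  \<open>E[F(Y\<^sup>(\<^sup>t\<^sup>+\<^sup>1\<^sup>)) | Y\<^sup>(\<^sup>t\<^sup>)] \<le> F(Y\<^sup>(\<^sup>t\<^sup>)) - \<alpha>/2 |\<Phi>(Y\<^sup>(\<^sup>t\<^sup>))|\<^sup>2 + D \<alpha>\<^sup>2\<close>, so the Cesaro means of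
  \<open>P(|\<Phi>(Y\<^sup>(\<^sup>t\<^sup>))| \<ge> \<delta>)\<close> are asymptotically at most \<open>2 D \<alpha> / \<delta>\<^sup>2\<close>. For fixed \<open>\<alpha>\<close> the Gaussian noise and
  the coercivity of \<open>F\<close> make the chain a contraction in the sense of Harris, so that
  \<open>P(Y\<^sup>(\<^sup>t\<^sup>) \<in> A)\<close> converges as \<open>t \<rightarrow> \<infinity>\<close> and its limit is its Cesaro limit. Finally, by compactness and
  coercivity of \<open>\<Phi>\<close>, \<open>|\<Phi>|\<close> is bounded below at the points of differentiability
  at distance more than \<open>\<epsilon>\<close> from the critical set.
\<close>

section \<open>One-dimensional optimal transport between empirical measures\<close>

text \<open>The expected decrease controls only time averages, while the claim concerns individual
  large times; Harris' theorem closes this gap. Only the existence of a limit for each fixed step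
  size is taken from it, so the contraction rate may degenerate as the step size tends to 0. The
  limit is bounded pointwise in the starting point, before integrating over the initial law, because
  \<open>F\<close> need not have a finite mean under that law. The step directions grow linearly
  with the state, so the second-order error of a step is unbounded. Coercivity of
  \<open>\<Phi>\<close> bounds it by a multiple of \<alpha>^2 (1 + |\<Phi>|^2), whose second part is
  absorbed by half of the first-order gain once \<alpha> is below an explicit threshold. The noise
  has a second task. Where \<open>\<Phi>\<close> is not the gradient, it is merely one choice of
  supergradient and says nothing about Clarke criticality. One noisy step has an absolutely
  continuous law, so from the first step on the chain almost surely avoids this null set.\<close>

lemma nn_integral_uniform_count_UNIV:
  "(\<integral>\<^sup>+k. f k \<partial>uniform_count_measure (UNIV :: 'n::finite set)) = (\<Sum>k\<in>UNIV. f k) / of_nat CARD('n)"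
proof -
  have "(\<integral>\<^sup>+k. f k \<partial>uniform_count_measure (UNIV :: 'n set)) = (\<Sum>k\<in>UNIV. ennreal (1 / real CARD('n)) * f k)"
    unfolding uniform_count_measure_def by (subst nn_integral_point_measure_finite) (auto simp: mult.commute)
  also have "\<dots> = (\<Sum>k\<in>UNIV. f k) / of_nat CARD('n)"
    by (simp add: sum_distrib_right[symmetric] divide_ennreal_def inverse_eq_divide[symmetric]
        inverse_ennreal ennreal_of_nat_eq_real_of_nat mult.commute)
  finally show ?thesis .
qed

lemma distr_uniform_count_bij:
  assumes "bij (s :: 'n::finite \<Rightarrow> 'n)"
  shows "distr (uniform_count_measure UNIV) (uniform_count_measure UNIV) s = uniform_count_measure UNIV"
proof (rule measure_eqI)
  fix A :: "'n set"
  have "card (s -` A) = card A"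
    using assms by (metis bij_def card_vimage_inj subset_UNIV)
  then show "emeasure (distr (uniform_count_measure UNIV) (uniform_count_measure UNIV) s) A =
      emeasure (uniform_count_measure UNIV) A"
    by (subst emeasure_distr) (auto simp: emeasure_uniform_count_measure)
qed simp

section \<open>Matchings as couplings, and duality for empirical measures on the line\<close>

context
  fixes x z :: "'n::finite \<Rightarrow> real"
begin

private abbreviation "U \<equiv> uniform_count_measure (UNIV :: 'n set)"
private abbreviation "M \<equiv> distr U borel x"
private abbreviation "N \<equiv> distr U borel z"

text \<open>The coupling is the image of the uniform law on the indices under
  \<open>\<lambda>k. (x k, z (s k))\<close>. The bound is kept in \<open>ennreal\<close> because it
  also certifies that the infimum is finite, which \<open>enn2real\<close> would conceal.\<close>

lemma INF_coupling_le_matching: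
  assumes s: "bij s"
  shows "(INF \<pi>\<in>{\<pi>. coupling M N \<pi>}. \<integral>\<^sup>+ p. ennreal ((dist (fst p) (snd p))\<^sup>2) \<partial>\<pi>)
    \<le> ennreal ((\<Sum>k\<in>UNIV. (x k - z (s k))\<^sup>2) / real CARD('n))"
proof -
  define \<pi> where "\<pi> = distr U (borel \<Otimes>\<^sub>M borel) (\<lambda>k. (x k, z (s k)))"
  have "coupling M N \<pi>"
    unfolding coupling_def
  proof (intro conjI)
    show "sets \<pi> = sets (M \<Otimes>\<^sub>M N)"
      unfolding \<pi>_def sets_distr by (rule sets_pair_measure_cong) auto
    have "distr \<pi> M fst = distr U M (fst \<circ> (\<lambda>k. (x k, z (s k))))"
      unfolding \<pi>_def by (rule distr_distr) auto
    also have "\<dots> = M"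
      by (rule distr_cong) auto
    finally show "distr \<pi> M fst = M" .
    have "distr \<pi> N snd = distr U N (snd \<circ> (\<lambda>k. (x k, z (s k))))"
      unfolding \<pi>_def by (rule distr_distr) auto
    also have "\<dots> = distr U borel (z \<circ> s)"
      by (rule distr_cong) auto
    also have "\<dots> = distr (distr U U s) borel z"
      by (rule distr_distr[symmetric]) auto
    finally show "distr \<pi> N snd = N"
      by (simp add: distr_uniform_count_bij[OF s])
  qed
  then have "(INF \<pi>\<in>{\<pi>. coupling M N \<pi>}. \<integral>\<^sup>+ p. ennreal ((dist (fst p) (snd p))\<^sup>2) \<partial>\<pi>)
      \<le> (\<integral>\<^sup>+ p. ennreal ((dist (fst p) (snd p))\<^sup>2) \<partial>\<pi>)"
    by (intro INF_lower) auto
  also have "\<dots> = (\<integral>\<^sup>+ k. ennreal ((x k - z (s k))\<^sup>2) \<partial>U)"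
    unfolding \<pi>_def by (subst nn_integral_distr) (auto simp: dist_real_def)
  also have "\<dots> = ennreal ((\<Sum>k\<in>UNIV. (x k - z (s k))\<^sup>2) / real CARD('n))"
    by (subst nn_integral_uniform_count_UNIV)
       (simp add: divide_ennreal ennreal_of_nat_eq_real_of_nat sum_nonneg)
  finally show ?thesis .
qed

lemma wasserstein2_le_matching:
  assumes "bij s"
  shows "(wasserstein2 M N)\<^sup>2 \<le> (\<Sum>k\<in>UNIV. (x k - z (s k))\<^sup>2) / real CARD('n)"
  using INF_coupling_le_matching[OF assms] unfolding wasserstein2_def
  by (simp add: enn2real_leI sum_nonneg)

lemma AE_uniform_count_distr: "AE t in distr U borel y. t \<in> range y" for y :: "'n \<Rightarrow> real"
  by (subst AE_distr_iff) (auto intro!: borel_closed finite_imp_closed)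

lemma integrable_uniform_count_distr:
  fixes f :: "real \<Rightarrow> real" and y :: "'n \<Rightarrow> real"
  assumes [measurable]: "f \<in> borel_measurable borel"
  shows "integrable (distr U borel y) f"
  by (subst integrable_distr_eq)
     (auto simp: uniform_count_measure_def intro!: integrable_point_measure_finite)

lemma integral_uniform_count_distr:
  fixes f :: "real \<Rightarrow> real" and y :: "'n \<Rightarrow> real"
  assumes [measurable]: "f \<in> borel_measurable borel"
  shows "(\<integral>t. f t \<partial>distr U borel y) = (\<Sum>k\<in>UNIV. f (y k)) / real CARD('n)"
  by (subst integral_distr)
     (auto simp: uniform_count_measure_def lebesgue_integral_point_measure_finite sum_divide_distrib)

text \<open>Weak duality: the integral of \<open>f (fst p) + g (snd p)\<close> depends only on the
  marginals. The constraint is asked at the atoms alone; these carry the marginals, so it holds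
  almost everywhere for each coupling.\<close>

lemma wasserstein2_ge_potentials:
  fixes f g :: "real \<Rightarrow> real"
  assumes [measurable]: "f \<in> borel_measurable borel" "g \<in> borel_measurable borel"
    and fg: "\<And>k l. f (x k) + g (z l) \<le> (x k - z l)\<^sup>2"
  shows "((\<Sum>k\<in>UNIV. f (x k)) + (\<Sum>l\<in>UNIV. g (z l))) / real CARD('n) \<le> (wasserstein2 M N)\<^sup>2"
    (is "?c \<le> _")
proof -
  let ?I = "\<lambda>\<pi>. \<integral>\<^sup>+ p. ennreal ((dist (fst p) (snd p))\<^sup>2) \<partial>\<pi>"
  have lower: "ennreal ?c \<le> ?I \<pi>" if \<pi>: "coupling M N \<pi>" for \<pi>
  proof (cases "?I \<pi> = \<infinity>")
    case False
    have S: "sets \<pi> = sets (borel \<Otimes>\<^sub>M borel)"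
      using \<pi> unfolding coupling_def by (metis sets_distr sets_pair_measure_cong)
    note S[measurable_cong]
    have fst: "distr \<pi> borel fst = M" and snd: "distr \<pi> borel snd = N"
      using \<pi> unfolding coupling_def by (metis distr_cong sets_distr)+
    have "AE p in \<pi>. fst p \<in> range x"
      using AE_uniform_count_distr[of x] unfolding fst[symmetric]
      by (subst (asm) AE_distr_iff) (auto intro!: borel_closed finite_imp_closed)
    moreover have "AE p in \<pi>. snd p \<in> range z"
      using AE_uniform_count_distr[of z] unfolding snd[symmetric]
      by (subst (asm) AE_distr_iff) (auto intro!: borel_closed finite_imp_closed)
    ultimately have ae: "AE p in \<pi>. f (fst p) + g (snd p) \<le> (dist (fst p) (snd p))\<^sup>2"
      by eventually_elim (auto simp: dist_real_def fg)
    have f: "integrable \<pi> (\<lambda>p. f (fst p))" "(\<integral>p. f (fst p) \<partial>\<pi>) = (\<Sum>k\<in>UNIV. f (x k)) / real CARD('n)"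
      using integrable_uniform_count_distr[of f x] integral_uniform_count_distr[of f x]
      unfolding fst[symmetric] by (simp_all add: integrable_distr_eq integral_distr)
    have g: "integrable \<pi> (\<lambda>p. g (snd p))" "(\<integral>p. g (snd p) \<partial>\<pi>) = (\<Sum>k\<in>UNIV. g (z k)) / real CARD('n)"
      using integrable_uniform_count_distr[of g z] integral_uniform_count_distr[of g z]
      unfolding snd[symmetric] by (simp_all add: integrable_distr_eq integral_distr)
    have d: "integrable \<pi> (\<lambda>p. (dist (fst p) (snd p))\<^sup>2)"
      using False by (intro integrableI_nonneg) (auto simp: top.not_eq_extremum)
    have "?c = (\<integral>p. f (fst p) + g (snd p) \<partial>\<pi>)"
      using f g by (simp add: add_divide_distrib)
    also have "\<dots> \<le> (\<integral>p. (dist (fst p) (snd p))\<^sup>2 \<partial>\<pi>)"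
      using f g d ae by (intro integral_mono_AE) auto
    finally have "ennreal ?c \<le> ennreal (\<integral>p. (dist (fst p) (snd p))\<^sup>2 \<partial>\<pi>)"
      by (rule ennreal_leI)
    then show ?thesis
      using nn_integral_eq_integral[OF d] by simp
  qed simp
  have "ennreal ?c \<le> (INF \<pi>\<in>{\<pi>. coupling M N \<pi>}. ?I \<pi>)"
    by (intro INF_greatest) (auto simp: lower)
  \<comment> \<open>\<open>enn2real\<close> sends infinity to 0, so the lower bound survives the
    conversion only for a finite infimum; the identity matching has finite cost.\<close>
  moreover have "(INF \<pi>\<in>{\<pi>. coupling M N \<pi>}. ?I \<pi>) < \<infinity>"
    using INF_coupling_le_matching[OF bij_id] by (simp add: order_le_less_trans)
  ultimately show ?thesis
    unfolding wasserstein2_def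
    by (cases "(INF \<pi>\<in>{\<pi>. coupling M N \<pi>}. ?I \<pi>)") (auto simp: ennreal_le_iff)
qed

text \<open>Complementary slackness. Potentials indexed by rows must become functions of the
  position, although rows may share a position. The c-transforms \<open>f\<close> and
  \<open>g\<close> below achieve this: tightness along \<open>s\<close> forces
  \<open>f (x k) = p k\<close> and \<open>g (z l) = q l\<close>.\<close>

lemma wasserstein2_eq_matching:
  fixes p q :: "'n \<Rightarrow> real"
  assumes s: "bij s" and pq: "\<And>k l. p k + q l \<le> (x k - z l)\<^sup>2" and eq: "\<And>k. p k + q (s k) = (x k - z (s k))\<^sup>2"
  shows "(wasserstein2 M N)\<^sup>2 = (\<Sum>k\<in>UNIV. (x k - z (s k))\<^sup>2) / real CARD('n)"
proof (rule antisym[OF wasserstein2_le_matching[OF s]])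
  define f where "f t = Min (range (\<lambda>l. (t - z l)\<^sup>2 - q l))" for t
  define g where "g t = Min (range (\<lambda>k. (x k - t)\<^sup>2 - p k))" for t
  have f: "f (x k) = p k" for k
    unfolding f_def
    by (rule Min_eqI)
       (use pq[of k] eq[of k] in \<open>auto simp: algebra_simps intro!: image_eqI[where x="s k"]\<close>)
  have g: "g (z l) = q l" for l
    unfolding g_def
    by (rule Min_eqI)
       (use pq[of _ l] eq[of "inv s l"] surj_f_inv_f[OF bij_is_surj[OF s], of l] in
         \<open>auto simp: algebra_simps intro!: image_eqI[where x="inv s l"]\<close>)
  have [measurable]: "f \<in> borel_measurable borel" "g \<in> borel_measurable borel"
    unfolding f_def g_def by (intro borel_measurable_Min; simp)+
  have "(\<Sum>k\<in>UNIV. (x k - z (s k))\<^sup>2) = (\<Sum>k\<in>UNIV. p k) + (\<Sum>k\<in>UNIV. q (s k))"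
    by (simp add: eq[symmetric] sum.distrib)
  also have "(\<Sum>k\<in>UNIV. q (s k)) = (\<Sum>l\<in>UNIV. q l)"
    by (rule sum.reindex_bij_betw[OF s])
  finally show "(\<Sum>k\<in>UNIV. (x k - z (s k))\<^sup>2) / real CARD('n) \<le> (wasserstein2 M N)\<^sup>2"
    using wasserstein2_ge_potentials[of f g] by (simp add: f g pq)
qed

end

text \<open>\<open>c\<close> is a discrete antiderivative of \<open>b\<close> with respect to
  \<open>a\<close>. As \<open>b\<close> increases along \<open>a\<close>, it is convex in
  \<open>a\<close>, with \<open>b\<close> as a subgradient.\<close>

lemma monotone_potentials_nat:
  fixes a b :: "nat \<Rightarrow> real"
  assumes a: "mono_on {..<n} a" and b: "mono_on {..<n} b"
  obtains c where "\<And>i j. i < n \<Longrightarrow> j < n \<Longrightarrow> c j + b j * (a i - a j) \<le> c i"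
proof
  define c where "c i = (\<Sum>l<i. b l * (a (Suc l) - a l))" for i
  \<comment> \<open>The increment of \<open>c\<close> is squeezed between the slopes at both ends;
    the lower bound serves \<open>j \<le> i\<close>, the upper one \<open>i < j\<close>.\<close>
  have up: "b j * (a (j + m) - a j) \<le> c (j + m) - c j \<and> c (j + m) - c j \<le> b (j + m) * (a (j + m) - a j)"
    if "j + m < n" for j m
    using that
  proof (induction m)
    case (Suc m)
    have ineq: "b j \<le> b (j + m)" "b (j + m) \<le> b (j + Suc m)" "a (j + m) \<le> a (j + Suc m)" "a j \<le> a (j + m)"
      using Suc.prems by (auto intro!: mono_onD[OF a] mono_onD[OF b])
    have "b j * (a (j + Suc m) - a (j + m)) \<le> b (j + m) * (a (j + Suc m) - a (j + m))"
      "b (j + m) * (a (j + Suc m) - a (j + m)) \<le> b (j + Suc m) * (a (j + Suc m) - a (j + m))"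
      "b (j + m) * (a (j + m) - a j) \<le> b (j + Suc m) * (a (j + m) - a j)"
      using ineq by (auto intro!: mult_right_mono)
    moreover have "c (j + Suc m) = c (j + m) + b (j + m) * (a (j + Suc m) - a (j + m))"
      by (simp add: c_def)
    ultimately show ?case
      using Suc by (simp add: algebra_simps)
  qed simp
  show "c j + b j * (a i - a j) \<le> c i" if "i < n" "j < n" for i j
  proof (cases "j \<le> i")
    case True
    then show ?thesis
      using up[of j "i - j"] that by simp
  next
    case False
    then show ?thesis
      using up[of i "j - i"] that by (simp add: algebra_simps)
  qed
qed

lemma monotone_potentials:
  fixes a b :: "'n::{finite,linorder} \<Rightarrow> real"
  assumes a: "mono a" and b: "mono b"
  obtains c where "\<And>i j. c j + b j * (a i - a j) \<le> c i"
proof -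
  define e where "e i = sorted_list_of_set (UNIV :: 'n set) ! i" for i
  define r where "r = the_inv_into {..<CARD('n)} e"
  have bij: "bij_betw e {..<CARD('n)} UNIV"
    using bij_betw_nth[of "sorted_list_of_set (UNIV :: 'n set)"] by (simp add: e_def[abs_def])
  have e: "mono_on {..<CARD('n)} e"
    unfolding e_def by (intro mono_onI sorted_nth_mono) auto
  obtain c where c: "\<And>i j. i < CARD('n) \<Longrightarrow> j < CARD('n) \<Longrightarrow> c j + b (e j) * (a (e i) - a (e j)) \<le> c i"
    using monotone_potentials_nat[of "CARD('n)" "a \<circ> e" "b \<circ> e"] e a b
    by (auto simp: mono_on_def mono_def)
  have r: "r i < CARD('n)" "e (r i) = i" for i
    using the_inv_into_into[of e "{..<CARD('n)}" i] f_the_inv_into_f_bij_betw[OF bij, of i] bij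
    by (auto simp: r_def bij_betw_def)
  have "c (r j) + b j * (a i - a j) \<le> c (r i)" for i j
    using c[of "r i" "r j"] r by simp
  then show thesis
    by (rule that)
qed

lemma wasserstein2_sorted:
  fixes x z :: "'n::{finite,linorder} \<Rightarrow> real" and \<sigma> \<rho> :: "'n \<Rightarrow> 'n"
  assumes \<sigma>: "bij \<sigma>" "mono (x \<circ> \<sigma>)" and \<rho>: "bij \<rho>" "mono (z \<circ> \<rho>)"
  shows "(wasserstein2 (distr (uniform_count_measure UNIV) borel x)
            (distr (uniform_count_measure UNIV) borel z))\<^sup>2
         = (\<Sum>k\<in>UNIV. (x k - z ((\<rho> \<circ> inv \<sigma>) k))\<^sup>2) / real CARD('n)"
proof -
  obtain c where c: "\<And>i j. c j + z (\<rho> j) * (x (\<sigma> i) - x (\<sigma> j)) \<le> c i"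
    using monotone_potentials[OF \<sigma>(2) \<rho>(2)] by auto
  have inv: "\<sigma> (inv \<sigma> k) = k" "\<rho> (inv \<rho> k) = k" "inv \<rho> (\<rho> k) = k" for k
    using \<sigma> \<rho> by (auto simp: bij_def surj_f_inv_f)
  \<comment> \<open>After expansion of the square, the dual constraint is a Fenchel-Young
    inequality: \<open>c\<close> is a convex potential on the sorted \<open>x\<close>, and its
    conjugate at a point of \<open>z\<close> is attained at the equally ranked point of
    \<open>x\<close>. This gives equality along the sorted matching.\<close>
  define p where "p k = (x k)\<^sup>2 - 2 * c (inv \<sigma> k)" for k
  define q where "q l = (z l)\<^sup>2 - 2 * (x (\<sigma> (inv \<rho> l)) * z l - c (inv \<rho> l))" for l
  show ?thesis
  proof (rule wasserstein2_eq_matching[where p = p and q = q])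
    show "bij (\<rho> \<circ> inv \<sigma>)"
      using \<sigma> \<rho> by (simp add: bij_comp bij_imp_bij_inv)
    show "p k + q l \<le> (x k - z l)\<^sup>2" for k l
      using c[of "inv \<rho> l" "inv \<sigma> k"]
      by (simp add: p_def q_def inv power2_eq_square algebra_simps)
    show "p k + q ((\<rho> \<circ> inv \<sigma>) k) = (x k - z ((\<rho> \<circ> inv \<sigma>) k))\<^sup>2" for k
      by (simp add: p_def q_def inv power2_eq_square algebra_simps)
  qed
qed

section \<open>Transport between projected matrices\<close>

lemma proj_w_alt:
  fixes Y Z :: "real ^ 'd ^ 'n::finite"
  shows "proj_w Z \<theta> Y = (wasserstein2 (distr (uniform_count_measure UNIV) borel (\<lambda>k. \<theta> \<bullet> Y $ k))
            (distr (uniform_count_measure UNIV) borel (\<lambda>k. \<theta> \<bullet> Z $ k)))\<^sup>2"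
proof -
  have "distr (row_measure X) borel (\<lambda>x. \<theta> \<bullet> x) = distr (uniform_count_measure UNIV) borel (\<lambda>k. \<theta> \<bullet> X $ k)"
    for X :: "real ^ 'd ^ 'n"
    unfolding row_measure_def by (subst distr_distr) (auto simp: comp_def)
  then show ?thesis
    by (simp add: proj_w_def)
qed

lemma proj_w_le_matching:
  fixes Y Z :: "real ^ 'd ^ 'n::finite"
  assumes "bij s"
  shows "proj_w Z \<theta> Y \<le> (\<Sum>k\<in>UNIV. (\<theta> \<bullet> (Y $ k - Z $ s k))\<^sup>2) / real CARD('n)"
  using wasserstein2_le_matching[OF assms, of "\<lambda>k. \<theta> \<bullet> Y $ k" "\<lambda>k. \<theta> \<bullet> Z $ k"]
  by (simp add: proj_w_alt inner_diff_right)

lemma proj_w_sorting: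
  fixes Y Z :: "real ^ 'd ^ 'n::{finite,linorder}"
  assumes \<tau>: "sorting_selection \<tau>" and \<theta>: "\<theta> \<in> sphere 0 1"
  shows "proj_w Z \<theta> Y = (\<Sum>k\<in>UNIV. (\<theta> \<bullet> (Y $ k - Z $ ((\<tau> Z \<theta> \<circ> inv (\<tau> Y \<theta>)) k)))\<^sup>2) / real CARD('n)"
  using wasserstein2_sorted[of "\<tau> Y \<theta>" "\<lambda>k. \<theta> \<bullet> Y $ k" "\<tau> Z \<theta>" "\<lambda>k. \<theta> \<bullet> Z $ k"] \<tau> \<theta>
  unfolding sorting_selection_def
  by (simp add: proj_w_alt inner_diff_right comp_def)

section \<open>The standard Gaussian measure\<close>

definition gaussian_density :: "'a::euclidean_space \<Rightarrow> real" where
  "gaussian_density x = (\<Prod>b\<in>Basis. std_normal_density (x \<bullet> b))"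

lemma gaussian_density_measurable [measurable]: "gaussian_density \<in> borel_measurable borel"
  unfolding gaussian_density_def by measurable

lemma gaussian_eq_density: "gaussian = density lborel (\<lambda>x. ennreal (gaussian_density x))"
  unfolding gaussian_def gaussian_density_def by (simp add: prod_ennreal)

lemma sets_gaussian [measurable_cong, simp]: "sets gaussian = sets borel"
  by (simp add: gaussian_def)

lemma space_gaussian [simp]: "space gaussian = UNIV"
  by (simp add: gaussian_def)

lemma nn_integral_std_normal_density: "(\<integral>\<^sup>+x. ennreal (std_normal_density x) \<partial>lborel) = 1"
  by (subst nn_integral_eq_integral) (auto intro: integrable_std_normal_moment[of 0, simplified])

lemma prob_space_gaussian: "prob_space (gaussian :: 'a::euclidean_space measure)"
proof (rule prob_spaceI)
  have "emeasure gaussian (space (gaussian :: 'a measure)) =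
      (\<integral>\<^sup>+x. (\<Prod>b\<in>Basis. ennreal (std_normal_density ((x::'a) \<bullet> b))) \<partial>lborel)"
    unfolding gaussian_def by (subst emeasure_density) auto
  also have "\<dots> = 1"
    by (subst nn_integral_lborel_prod) (auto simp: nn_integral_std_normal_density)
  finally show "emeasure gaussian (space (gaussian :: 'a measure)) = 1" .
qed

lemma nn_integral_gaussian_square_coord:
  assumes b: "b \<in> Basis"
  shows "(\<integral>\<^sup>+x. ennreal ((x \<bullet> b)\<^sup>2) \<partial>(gaussian :: 'a::euclidean_space measure)) < \<infinity>"
proof -
  \<comment> \<open>The weight \<open>t\<^sup>2\<close> is absorbed into the factor of the
    coordinate \<open>b\<close>, so that the integrand remains a product over coordinates and its
    integral factorizes.\<close>
  define h where "h c t = ennreal (std_normal_density t * (if c = b then t\<^sup>2 else 1))" for c :: 'a and t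
  have "(\<integral>\<^sup>+x. ennreal ((x \<bullet> b)\<^sup>2) \<partial>gaussian) =
      (\<integral>\<^sup>+x. (\<Prod>c\<in>Basis. ennreal (std_normal_density (x \<bullet> c))) * ennreal ((x \<bullet> b)\<^sup>2) \<partial>lborel)"
    unfolding gaussian_def by (subst nn_integral_density) auto
  also have "\<dots> = (\<integral>\<^sup>+x. (\<Prod>c\<in>Basis. h c (x \<bullet> c)) \<partial>lborel)"
  proof (intro nn_integral_cong)
    fix x :: 'a
    have "(\<Prod>c\<in>Basis. h c (x \<bullet> c)) =
      (\<Prod>c\<in>Basis. ennreal (std_normal_density (x \<bullet> c)) * (if c = b then ennreal ((x \<bullet> b)\<^sup>2) else 1))"
      by (rule prod.cong) (auto simp: h_def ennreal_mult)
    also have "\<dots> = (\<Prod>c\<in>Basis. ennreal (std_normal_density (x \<bullet> c))) * ennreal ((x \<bullet> b)\<^sup>2)"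
      using b by (simp add: prod.distrib prod.delta)
    finally show "(\<Prod>c\<in>Basis. ennreal (std_normal_density (x \<bullet> c))) * ennreal ((x \<bullet> b)\<^sup>2)
        = (\<Prod>c\<in>Basis. h c (x \<bullet> c))" ..
  qed
  also have "\<dots> = (\<Prod>c\<in>Basis. (\<integral>\<^sup>+t. h c t \<partial>lborel))"
    by (rule nn_integral_lborel_prod) (auto simp: h_def)
  also have "\<dots> < \<infinity>"
  proof -
    have "(\<integral>\<^sup>+t. h c t \<partial>lborel) < \<infinity>" for c
    proof -
      have "integrable lborel (\<lambda>t. std_normal_density t * (if c = b then t\<^sup>2 else 1))"
        using integrable_std_normal_moment[of "if c = b then 2 else 0"] by (cases "c = b") auto
      then have "(\<integral>\<^sup>+t. h c t \<partial>lborel) = ennreal (\<integral>t. std_normal_density t * (if c = b then t\<^sup>2 else 1) \<partial>lborel)"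
        unfolding h_def by (intro nn_integral_eq_integral) auto
      then show ?thesis by simp
    qed
    then show ?thesis
      unfolding infinity_ennreal_def less_top[symmetric] by (auto simp: ennreal_prod_eq_top)
  qed
  finally show ?thesis .
qed

lemma integrable_gaussian_norm_square: "integrable (gaussian :: 'a::euclidean_space measure) (\<lambda>x. (norm x)\<^sup>2)"
proof -
  have "(norm x)\<^sup>2 = (\<Sum>b\<in>Basis. (x \<bullet> b)\<^sup>2)" for x :: 'a
    unfolding power2_norm_eq_inner by (subst euclidean_inner) (simp add: power2_eq_square)
  moreover have "integrable (gaussian :: 'a measure) (\<lambda>x. \<Sum>b\<in>Basis. (x \<bullet> b)\<^sup>2)"
    by (intro Bochner_Integration.integrable_sum integrableI_nonneg)
       (auto intro: nn_integral_gaussian_square_coord[unfolded infinity_ennreal_def])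
  ultimately show ?thesis
    by simp
qed

lemma integrable_gaussian_id: "integrable (gaussian :: 'a::euclidean_space measure) (\<lambda>x. x)"
proof -
  interpret prob_space "gaussian :: 'a measure"
    by (rule prob_space_gaussian)
  have le: "norm x \<le> 1 + (norm x)\<^sup>2" for x :: 'a
    proof -
    have "2 * norm x \<le> 1 + (norm x)\<^sup>2"
      using zero_le_power2[of "norm x - 1"] by (simp add: power2_diff)
    with norm_ge_zero[of x] show ?thesis
      by linarith
  qed
  show ?thesis
    by (rule Bochner_Integration.integrable_bound[where f = "\<lambda>x::'a. 1 + (norm x)\<^sup>2"])
       (use integrable_gaussian_norm_square order_trans[OF le abs_ge_self] in auto)
qed

lemma nn_integral_lborel_affine:
  fixes f :: "'a::euclidean_space \<Rightarrow> ennreal"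
  assumes [measurable]: "f \<in> borel_measurable borel" and c: "c \<noteq> 0"
  shows "(\<integral>\<^sup>+x. f x \<partial>lborel) = ennreal (\<bar>c\<bar> ^ DIM('a)) * (\<integral>\<^sup>+x. f (t + c *\<^sub>R x) \<partial>lborel)"
  by (subst lborel_affine[OF c, of t])
     (simp add: nn_integral_density nn_integral_distr nn_integral_cmult)

lemma distr_gaussian_uminus: "distr gaussian borel uminus = (gaussian :: 'a::euclidean_space measure)"
proof (rule measure_eqI)
  fix A :: "'a set" assume "A \<in> sets (distr gaussian borel uminus)"
  then have [measurable]: "A \<in> sets borel" by simp
  have D: "gaussian_density (- x) = gaussian_density x" for x :: 'a
    by (simp add: gaussian_density_def std_normal_density_def)
  have "emeasure (distr gaussian borel uminus) A = (\<integral>\<^sup>+x. indicator A (- x) \<partial>(gaussian :: 'a measure))"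
    by (subst nn_integral_indicator[symmetric], simp, subst nn_integral_distr) auto
  also have "\<dots> = (\<integral>\<^sup>+x. ennreal (gaussian_density x) * indicator A (- x) \<partial>lborel)"
    unfolding gaussian_eq_density by (subst nn_integral_density) auto
  also have "\<dots> = (\<integral>\<^sup>+x. ennreal (gaussian_density x) * indicator A x \<partial>lborel)"
    using nn_integral_lborel_affine[of "\<lambda>x::'a. ennreal (gaussian_density x) * indicator A x" "-1" 0]
    by (simp add: D)
  also have "\<dots> = emeasure gaussian A"
    unfolding gaussian_eq_density by (subst emeasure_density) auto
  finally show "emeasure (distr gaussian borel uminus) A = emeasure gaussian A" .
qed simp

text \<open>By symmetry the mean equals its own negative.\<close>

lemma integral_gaussian_id: "(\<integral>x. x \<partial>(gaussian :: 'a::euclidean_space measure)) = 0"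
proof -
  define v where "v = (\<integral>x. x \<partial>(gaussian :: 'a measure))"
  have "v = (\<integral>x. x \<partial>(distr gaussian borel uminus :: 'a measure))"
    by (simp add: distr_gaussian_uminus v_def)
  also have "\<dots> = - v"
    unfolding v_def by (subst integral_distr) auto
  finally have "2 *\<^sub>R v = 0"
    unfolding scaleR_2 by (metis add.right_inverse)
  then show ?thesis
    by (simp add: v_def)
qed

text \<open>Up to the factor \<open>s ^ DIM('a)\<close>, the weight on the left is the density of
  \<open>c + s *\<^sub>R e\<close>. Both the minorization and the absolute continuity of a noisy
  step come from this formula.\<close>

lemma nn_integral_gaussian_affine:
  fixes g :: "'a::euclidean_space \<Rightarrow> ennreal"
  assumes [measurable]: "g \<in> borel_measurable borel" and s: "s > 0"
  shows "(\<integral>\<^sup>+y. ennreal (gaussian_density ((1 / s) *\<^sub>R (y - c))) * g y \<partial>lborel) =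
         ennreal (s ^ DIM('a)) * (\<integral>\<^sup>+e. g (c + s *\<^sub>R e) \<partial>gaussian)"
  using nn_integral_lborel_affine[of "\<lambda>y. ennreal (gaussian_density ((1 / s) *\<^sub>R (y - c))) * g y" s c] s
  unfolding gaussian_eq_density by (simp add: nn_integral_density)

lemma gaussian_density_lower_bound:
  fixes R :: real
  obtains \<kappa> where "\<kappa> > 0" "\<And>x::'a::euclidean_space. norm x \<le> R \<Longrightarrow> \<kappa> \<le> gaussian_density x"
proof
  show "(std_normal_density R) ^ DIM('a) > 0"
    by (simp add: std_normal_density_def)
  fix x :: 'a assume x: "norm x \<le> R"
  have "std_normal_density R \<le> std_normal_density (x \<bullet> b)" if b: "b \<in> Basis" for b
  proof -
    have "\<bar>x \<bullet> b\<bar> \<le> \<bar>R\<bar>"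
      using Basis_le_norm[OF b, of x] x by linarith
    then show ?thesis
      by (auto simp: std_normal_density_def abs_le_square_iff[symmetric] intro!: divide_right_mono mult_left_mono)
  qed
  then have "(\<Prod>b\<in>(Basis::'a set). std_normal_density R) \<le> gaussian_density x"
    unfolding gaussian_density_def by (intro prod_mono) (auto simp: std_normal_density_def)
  then show "(std_normal_density R) ^ DIM('a) \<le> gaussian_density x"
    by simp
qed

text \<open>This supplies the small-set condition of Harris' theorem: the density of
  \<open>c + s *\<^sub>R e\<close> has a positive lower bound on the unit ball, uniformly over
  bounded centres \<open>c\<close>.\<close>

lemma gaussian_affine_minorization:
  fixes R s :: real
  assumes s: "s > 0"
  obtains \<kappa> where "\<kappa> > 0"
    "\<And>c (g :: 'a::euclidean_space \<Rightarrow> ennreal). norm c \<le> R \<Longrightarrow> g \<in> borel_measurable borel \<Longrightarrow>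
       ennreal \<kappa> * (\<integral>\<^sup>+y. g y \<partial>uniform_measure lborel (ball 0 1)) \<le> (\<integral>\<^sup>+e. g (c + s *\<^sub>R e) \<partial>gaussian)"
proof -
  \<comment> \<open>For \<open>y\<close> in the unit ball, \<open>norm (y - c) \<le> 1 + R\<close>;
    rescaling by \<open>1 / s\<close> gives the radius used here.\<close>
  obtain \<kappa> where \<kappa>: "\<kappa> > 0" "\<And>x::'a. norm x \<le> (1 + R) / s \<Longrightarrow> \<kappa> \<le> gaussian_density x"
    using gaussian_density_lower_bound by blast
  define v where "v = measure lborel (ball (0::'a) 1)"
  have v: "v > 0" "emeasure lborel (ball (0::'a) 1) = ennreal v"
    using content_ball_pos[of 1 "0 :: 'a"] emeasure_bounded_finite[of "ball (0::'a) 1"]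
    by (auto simp: v_def emeasure_eq_ennreal_measure less_top)
  \<comment> \<open>The density of \<open>c + s *\<^sub>R e\<close> is at least
    \<open>\<kappa> / s ^ DIM('a)\<close> on the ball; the factor \<open>v\<close> appears because
    the uniform law there has density \<open>1 / v\<close>.\<close>
  show thesis
  proof (rule that[of "\<kappa> * v / s ^ DIM('a)"])
    show "\<kappa> * v / s ^ DIM('a) > 0"
      using \<kappa> v s by simp
    fix c :: 'a and g :: "'a \<Rightarrow> ennreal"
    assume c: "norm c \<le> R" and [measurable]: "g \<in> borel_measurable borel"
    have [measurable]: "ball (0::'a) 1 \<in> sets borel"
      by simp
    let ?I = "\<integral>\<^sup>+y. g y * indicator (ball 0 1) y \<partial>lborel"
    have "ennreal \<kappa> * ?I = (\<integral>\<^sup>+y. ennreal \<kappa> * (g y * indicator (ball 0 1) y) \<partial>lborel)"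
      by (rule nn_integral_cmult[symmetric]) measurable
    also have "\<dots> \<le> (\<integral>\<^sup>+y. ennreal (gaussian_density ((1 / s) *\<^sub>R (y - c))) * g y \<partial>lborel)"
    proof (intro nn_integral_mono)
      fix y :: 'a
      show "ennreal \<kappa> * (g y * indicator (ball 0 1) y) \<le> ennreal (gaussian_density ((1 / s) *\<^sub>R (y - c))) * g y"
      proof (cases "y \<in> ball 0 1")
        case True
        then have "norm (y - c) \<le> 1 + R"
          using norm_triangle_ineq4[of y c] c by simp
        then have "norm ((1 / s) *\<^sub>R (y - c)) \<le> (1 + R) / s"
          using s by (simp add: divide_right_mono)
        then show ?thesis
          using \<kappa>(2) True by (auto intro!: mult_right_mono ennreal_leI)
      qed simp
    qed
    also have "\<dots> = ennreal (s ^ DIM('a)) * (\<integral>\<^sup>+e. g (c + s *\<^sub>R e) \<partial>gaussian)"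
      by (rule nn_integral_gaussian_affine) (use s in auto)
    finally have *: "ennreal (1 / s ^ DIM('a)) * (ennreal \<kappa> * ?I) \<le>
        ennreal (1 / s ^ DIM('a)) * (ennreal (s ^ DIM('a)) * (\<integral>\<^sup>+e. g (c + s *\<^sub>R e) \<partial>gaussian))"
      by (rule mult_left_mono) simp
    have U: "(\<integral>\<^sup>+y. g y \<partial>uniform_measure lborel (ball 0 1)) = ?I / ennreal v"
      by (subst nn_integral_uniform_measure) (auto simp: v)
    have "ennreal (\<kappa> * v / s ^ DIM('a)) * ennreal (1 / v) = ennreal (1 / s ^ DIM('a)) * ennreal \<kappa>"
      using s v \<kappa> by (simp flip: ennreal_mult)
    moreover have "?I / ennreal v = ?I * ennreal (1 / v)"
      using v by (simp add: divide_ennreal_def inverse_ennreal inverse_eq_divide)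
    moreover have "ennreal (\<kappa> * v / s ^ DIM('a)) * (?I * ennreal (1 / v)) =
        (ennreal (\<kappa> * v / s ^ DIM('a)) * ennreal (1 / v)) * ?I"
      by (simp only: ac_simps)
    ultimately have "ennreal (\<kappa> * v / s ^ DIM('a)) * (?I / ennreal v) = ennreal (1 / s ^ DIM('a)) * (ennreal \<kappa> * ?I)"
      by (simp only: mult.assoc)
    moreover have "ennreal (1 / s ^ DIM('a)) * ennreal (s ^ DIM('a)) = 1"
      using s by (simp flip: ennreal_mult)
    ultimately show "ennreal (\<kappa> * v / s ^ DIM('a)) * (\<integral>\<^sup>+y. g y \<partial>uniform_measure lborel (ball 0 1))
        \<le> (\<integral>\<^sup>+e. g (c + s *\<^sub>R e) \<partial>gaussian)"
      using * by (simp add: U mult.assoc[symmetric])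
  qed
qed

lemma AE_gaussian_affine:
  fixes P :: "'a::euclidean_space \<Rightarrow> bool"
  assumes P: "AE y in lborel. P y" and s: "s > 0"
  shows "AE e in gaussian. P (c + s *\<^sub>R e)"
proof -
  obtain N where N: "{y. \<not> P y} \<subseteq> N" "N \<in> null_sets lborel"
    using P by (auto elim!: AE_E simp: null_sets_def)
  have [measurable]: "N \<in> sets borel"
    using N by auto
  have "ennreal (s ^ DIM('a)) * (\<integral>\<^sup>+e. indicator N (c + s *\<^sub>R e) \<partial>gaussian) =
      (\<integral>\<^sup>+y. ennreal (gaussian_density ((1 / s) *\<^sub>R (y - c))) * indicator N y \<partial>lborel)"
    by (rule nn_integral_gaussian_affine[symmetric]) (use s in auto)
  also have "\<dots> = 0"
    using AE_not_in[OF N(2)] by (subst nn_integral_0_iff_AE) (auto elim!: eventually_mono)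
  finally have "(\<integral>\<^sup>+e. indicator N (c + s *\<^sub>R e) \<partial>(gaussian :: 'a measure)) = 0"
    using zero_less_power[OF s, of "DIM('a)"] by (simp add: ennreal_eq_0_iff not_le)
  then have "AE e in gaussian. indicator N (c + s *\<^sub>R e) = (0::ennreal)"
    by (subst (asm) nn_integral_0_iff_AE) auto
  then show ?thesis
    by eventually_elim (use N(1) in \<open>auto simp: indicator_eq_0_iff\<close>)
qed

section \<open>Harris' theorem\<close>

text \<open>The iterated kernel acting on functions: the expectation of \<open>g\<close> after
  \<open>t\<close> steps from \<open>x\<close>. The recursion peels off the first step, which
  matches the removal of the first samples from the sequences later on.\<close>

primrec kernel_iter :: "('a \<Rightarrow> 'a measure) \<Rightarrow> nat \<Rightarrow> ('a \<Rightarrow> ennreal) \<Rightarrow> 'a \<Rightarrow> ennreal" where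
  "kernel_iter K 0 g x = g x"
| "kernel_iter K (Suc t) g x = (\<integral>\<^sup>+y. kernel_iter K t g y \<partial>K x)"

locale markov_kernel =
  fixes K :: "'a::topological_space \<Rightarrow> 'a measure"
  assumes K [measurable]: "K \<in> borel \<rightarrow>\<^sub>M prob_algebra borel"
begin

lemma prob_space_K: "prob_space (K x)" and sets_K [measurable_cong, simp]: "sets (K x) = sets borel"
  using measurable_space[OF K, of x] by (auto simp: space_prob_algebra)

lemma space_K [simp]: "space (K x) = UNIV"
  using sets_eq_imp_space_eq[OF sets_K[of x]] by simp

lemma K_subprob [measurable]: "K \<in> borel \<rightarrow>\<^sub>M subprob_algebra borel"
  using K by (rule measurable_prob_algebraD)

lemma kernel_iter_measurable [measurable]:
  assumes g [measurable]: "g \<in> borel_measurable borel"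
  shows "kernel_iter K t g \<in> borel_measurable borel"
proof (induction t)
  case (Suc t)
  have "(\<lambda>x. \<integral>\<^sup>+y. kernel_iter K t g y \<partial>K x) \<in> borel_measurable borel"
    by (rule measurable_compose[OF K_subprob nn_integral_measurable_subprob_algebra]) (use Suc in auto)
  then show ?case
    by simp
qed (use g in \<open>simp add: eta_contract_eq\<close>)

lemma kernel_iter_le_1:
  assumes "\<And>x. g x \<le> 1"
  shows "kernel_iter K t g x \<le> 1"
proof (induction t arbitrary: x)
  case (Suc t)
  interpret prob_space "K x" by (rule prob_space_K)
  have "kernel_iter K (Suc t) g x \<le> (\<integral>\<^sup>+y. 1 \<partial>K x)"
    by (simp del: nn_integral_const add: Suc nn_integral_mono)
  then show ?case
    using emeasure_space_1 by simp
qed (use assms in simp)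

text \<open>At time 0 the iterate is the value at a given point, about which an almost-everywhere
  inequality says nothing; hence the \<open>Suc\<close>.\<close>

lemma kernel_iter_Suc_mono:
  assumes "\<And>x. AE y in K x. f y \<le> g y"
  shows "kernel_iter K (Suc t) f x \<le> kernel_iter K (Suc t) g x"
proof (induction t arbitrary: x)
  case 0
  show ?case
    using assms[of x] by (auto intro!: nn_integral_mono_AE)
next
  case (Suc t)
  show ?case
    unfolding kernel_iter.simps(2)[of K "Suc t"] by (intro nn_integral_mono Suc)
qed

text \<open>The drift inequality telescopes: at each step the fall of \<open>V\<close> pays for
  \<open>h\<close>, up to the loss \<open>c\<close>.\<close>

lemma sum_kernel_iter_le:
  assumes [measurable]: "h \<in> borel_measurable borel" "V \<in> borel_measurable borel"
    and drift: "\<And>x. h x + (\<integral>\<^sup>+y. V y \<partial>K x) \<le> V x + c"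
  shows "(\<Sum>t<T. kernel_iter K t h x) + kernel_iter K T V x \<le> V x + of_nat T * c"
proof (induction T arbitrary: x)
  case (Suc T)
  interpret prob_space "K x" by (rule prob_space_K)
  have "(\<Sum>t<Suc T. kernel_iter K t h x) + kernel_iter K (Suc T) V x =
      h x + (\<integral>\<^sup>+y. (\<Sum>t<T. kernel_iter K t h y) + kernel_iter K T V y \<partial>K x)"
    by (subst sum.lessThan_Suc_shift) (simp add: nn_integral_add nn_integral_sum add.assoc)
  also have "\<dots> \<le> h x + (\<integral>\<^sup>+y. V y + of_nat T * c \<partial>K x)"
    by (intro add_left_mono nn_integral_mono Suc)
  also have "\<dots> = (h x + (\<integral>\<^sup>+y. V y \<partial>K x)) + of_nat T * c"
    by (simp add: nn_integral_add emeasure_space_1[simplified] add.assoc)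
  also have "\<dots> \<le> V x + c + of_nat T * c"
    by (intro add_right_mono drift)
  finally show ?case
    by (simp add: algebra_simps)
qed simp

end

text \<open>
  Hairer and Mattingly's form of Harris' theorem: a drift condition together with a minorization on
  the sublevel sets of \<open>V\<close> makes the kernel a contraction for a weighted oscillation seminorm.
\<close>
locale harris_kernel = markov_kernel K for K :: "'a::topological_space \<Rightarrow> 'a measure" +
  fixes V :: "'a \<Rightarrow> real" and \<gamma> C :: real
  assumes V [measurable]: "V \<in> borel_measurable borel" and V_nonneg: "0 \<le> V x"
    and \<gamma>: "0 \<le> \<gamma>" "\<gamma> < 1" and C: "0 \<le> C"
    and drift: "(\<integral>\<^sup>+y. ennreal (V y) \<partial>K x) \<le> ennreal (\<gamma> * V x + C)"
    and minorization: "\<exists>\<kappa> m. \<kappa> > 0 \<and> prob_space m \<and> sets m = sets borel \<and> (\<integral>\<^sup>+y. ennreal (V y) \<partial>m) < \<infinity> \<and>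
      (\<forall>x g. V x \<le> R \<longrightarrow> g \<in> borel_measurable borel \<longrightarrow> ennreal \<kappa> * (\<integral>\<^sup>+y. g y \<partial>m) \<le> (\<integral>\<^sup>+y. g y \<partial>K x))"
begin

lemma integrable_V: "integrable (K x) V"
  using drift[of x] by (intro integrableI_nonneg) (auto simp: V_nonneg intro: le_less_trans)

lemma integral_V_le: "(\<integral>y. V y \<partial>K x) \<le> \<gamma> * V x + C"
proof -
  have "ennreal (\<integral>y. V y \<partial>K x) \<le> ennreal (\<gamma> * V x + C)"
    using drift[of x] by (simp add: nn_integral_eq_integral[OF integrable_V] V_nonneg)
  then show ?thesis
    using \<gamma> C V_nonneg[of x] by (subst (asm) ennreal_le_iff) auto
qed

lemma minorization_integral:
  obtains \<kappa> :: real and m where "\<kappa> > 0" "prob_space m" "sets m = sets borel" "integrable m V"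
    "\<And>x (g :: 'a \<Rightarrow> real). V x \<le> R \<Longrightarrow> integrable m g \<Longrightarrow> integrable (K x) g \<Longrightarrow> (\<And>y. 0 \<le> g y) \<Longrightarrow>
       \<kappa> * (\<integral>y. g y \<partial>m) \<le> (\<integral>y. g y \<partial>K x)"
proof -
  obtain \<kappa> m where m: "\<kappa> > 0" "prob_space m" "sets m = sets borel" "(\<integral>\<^sup>+y. ennreal (V y) \<partial>m) < \<infinity>"
    and minor: "\<And>x g. V x \<le> R \<Longrightarrow> g \<in> borel_measurable borel \<Longrightarrow>
        ennreal \<kappa> * (\<integral>\<^sup>+y. g y \<partial>m) \<le> (\<integral>\<^sup>+y. g y \<partial>K x)"
    using minorization[of R] by blast
  note m(3)[measurable_cong]
  show thesis
  proof (rule that[OF m(1-3)])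
    show "integrable m V"
      using m by (intro integrableI_nonneg) (auto simp: V_nonneg)
    fix x and g :: "'a \<Rightarrow> real" assume x: "V x \<le> R" and g: "integrable m g" "integrable (K x) g" "\<And>y. 0 \<le> g y"
    have [measurable]: "g \<in> borel_measurable borel"
      using g(2) by auto
    have "ennreal (\<kappa> * (\<integral>y. g y \<partial>m)) = ennreal \<kappa> * (\<integral>\<^sup>+y. g y \<partial>m)"
      using m(1) g by (simp add: nn_integral_eq_integral ennreal_mult)
    also have "\<dots> \<le> (\<integral>\<^sup>+y. g y \<partial>K x)"
      using x by (intro minor) auto
    also have "\<dots> = ennreal (\<integral>y. g y \<partial>K x)"
      using g by (simp add: nn_integral_eq_integral)
    finally show "\<kappa> * (\<integral>y. g y \<partial>m) \<le> (\<integral>y. g y \<partial>K x)"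
      using g by (subst (asm) ennreal_le_iff) auto
  qed
qed

text \<open>Here \<open>c\<close> bounds the oscillation of \<open>f\<close> relative to the weight.
  If \<open>V x + V y\<close> exceeds a level \<open>R\<close>, the drift shrinks the weight itself.
  Otherwise \<open>K x\<close> and \<open>K y\<close> both dominate a multiple of one measure
  \<open>m\<close>, and this common mass does not contribute to the difference. Values in [0, 1]
  make \<open>f\<close> integrable and the supremum \<open>b\<close> finite.\<close>

lemma oscillation_contraction:
  obtains \<beta> \<rho> where "\<beta> > 0" "0 \<le> \<rho>" "\<rho> < 1"
    "\<And>(f :: 'a \<Rightarrow> real) c x y. f \<in> borel_measurable borel \<Longrightarrow> (\<And>u. 0 \<le> f u \<and> f u \<le> 1) \<Longrightarrow> 0 \<le> c \<Longrightarrow>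
       (\<And>u v. f u - f v \<le> c * (2 + \<beta> * V u + \<beta> * V v)) \<Longrightarrow>
       (\<integral>u. f u \<partial>K x) - (\<integral>u. f u \<partial>K y) \<le> \<rho> * c * (2 + \<beta> * V x + \<beta> * V y)"
proof -
  \<comment> \<open>Beyond \<open>R\<close>, \<open>2 * C + 2\<close> is at most
    \<open>(1 - \<gamma>) / 2\<close> times \<open>V x + V y\<close>: half of the gain from the
    drift pays for both constants \<open>C\<close> and still leaves \<open>2 * \<beta>\<close> to
    reduce the constant part of the weight.\<close>
  define R where "R = (4 * C + 4) / (1 - \<gamma>)"
  obtain \<kappa>' m where \<kappa>': "\<kappa>' > 0" and m: "prob_space m" "sets m = sets borel" "integrable m V"
    and minor: "\<And>x (g :: 'a \<Rightarrow> real). V x \<le> R \<Longrightarrow> integrable m g \<Longrightarrow> integrable (K x) g \<Longrightarrow> (\<And>y. 0 \<le> g y) \<Longrightarrow>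
       \<kappa>' * (\<integral>y. g y \<partial>m) \<le> (\<integral>y. g y \<partial>K x)"
    using minorization_integral[of R] by metis
  define \<kappa> where "\<kappa> = min \<kappa>' 1"
  \<comment> \<open>With this \<open>\<beta>\<close> the two drift constants cost at most
    \<open>\<kappa>\<close>, half of the \<open>2 * \<kappa>\<close> gained from the
    minorization.\<close>
  define \<beta> where "\<beta> = \<kappa> / (2 * C + 2)"
  \<comment> \<open>The first entry handles the \<open>V\<close> part of the weight;
    \<open>1 - \<beta>\<close> and \<open>1 - \<kappa> / 2\<close> handle its constant part, beyond
    and below the level \<open>R\<close> respectively.\<close>
  define \<rho> where "\<rho> = max ((1 + \<gamma>) / 2) (max (1 - \<beta>) (1 - \<kappa> / 2))"
  have \<kappa>: "0 < \<kappa>" "\<kappa> \<le> \<kappa>'"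
    using \<kappa>' by (auto simp: \<kappa>_def)
  have \<beta>: "\<beta> > 0" "2 * (\<beta> * C) \<le> \<kappa>"
    using \<kappa> C by (auto simp: \<beta>_def field_simps)
  have \<rho>: "0 \<le> \<rho>" "\<rho> < 1" "(1 + \<gamma>) / 2 \<le> \<rho>" "1 - \<beta> \<le> \<rho>" "1 - \<kappa> / 2 \<le> \<rho>"
    using \<gamma> \<beta> \<kappa> by (auto simp: \<rho>_def le_max_iff_disj)
  interpret m: prob_space m by fact
  note m(2)[measurable_cong]
  show thesis
  proof (rule that[OF \<beta>(1) \<rho>(1,2)])
    fix f :: "'a \<Rightarrow> real" and c x y
    assume f [measurable]: "f \<in> borel_measurable borel" and f01: "\<And>u. 0 \<le> f u \<and> f u \<le> 1" and c: "0 \<le> c"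
      and osc: "\<And>u v. f u - f v \<le> c * (2 + \<beta> * V u + \<beta> * V v)"
    interpret x: prob_space "K x" by (rule prob_space_K)
    interpret y: prob_space "K y" by (rule prob_space_K)
    txt \<open>A constant \<open>b\<close> turns the oscillation bound into a weighted sup-norm bound on \<open>f - b\<close>.\<close>
    define b where "b = (SUP u. f u - c * (1 + \<beta> * V u))"
    have bdd: "bdd_above (range (\<lambda>u. f u - c * (1 + \<beta> * V u)))"
      by (rule bdd_aboveI2[where M = 1]) (use f01 c \<beta> V_nonneg in \<open>smt (verit) mult_nonneg_nonneg\<close>)
    have up: "f u - b \<le> c * (1 + \<beta> * V u)" for u
      using cSUP_upper[OF UNIV_I bdd, of u] by (simp add: b_def)
    have low: "b - f v \<le> c * (1 + \<beta> * V v)" for v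
    proof -
      have "b \<le> f v + c * (1 + \<beta> * V v)"
        unfolding b_def
      proof (rule cSUP_least)
        show "f u - c * (1 + \<beta> * V u) \<le> f v + c * (1 + \<beta> * V v)" for u
          using osc[of u v] by (simp add: algebra_simps)
      qed simp
      then show ?thesis by simp
    qed
    \<comment> \<open>\<open>g1\<close> and \<open>g2\<close> are the gaps in the two one-sided
      bounds on \<open>f - b\<close>. They are nonnegative, so the minorization applies to them, and
      in the sum of their \<open>m\<close>-integrals \<open>f\<close> cancels.\<close>
    define g1 where "g1 u = c * (1 + \<beta> * V u) - (f u - b)" for u
    define g2 where "g2 u = c * (1 + \<beta> * V u) + (f u - b)" for u
    have fi: "integrable (K u) f" "integrable m f" for u
    proof -
      interpret u: prob_space "K u" by (rule prob_space_K)
      show "integrable (K u) f"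
        by (rule u.integrable_const_bound[where B = 1]) (use f01 in auto)
      show "integrable m f"
        by (rule m.integrable_const_bound[where B = 1]) (use f01 in auto)
    qed
    have gi: "integrable (K u) g1" "integrable m g1" "integrable (K u) g2" "integrable m g2" for u
    proof -
      interpret u: prob_space "K u" by (rule prob_space_K)
      show "integrable (K u) g1" "integrable m g1" "integrable (K u) g2" "integrable m g2"
        unfolding g1_def g2_def
        using fi integrable_V m(3)
        by (auto intro!: Bochner_Integration.integrable_add Bochner_Integration.integrable_diff
            integrable_mult_right)
    qed
    have g0: "0 \<le> g1 u" "0 \<le> g2 u" for u
      using up[of u] low[of u] by (auto simp: g1_def g2_def)
    define W where "W u = (\<integral>v. V v \<partial>K u)" for u
    have Kg: "(\<integral>u. g1 u \<partial>K x) = c * (1 + \<beta> * W x) - ((\<integral>u. f u \<partial>K x) - b)"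
      "(\<integral>u. g2 u \<partial>K y) = c * (1 + \<beta> * W y) + ((\<integral>u. f u \<partial>K y) - b)"
      unfolding g1_def g2_def W_def using fi integrable_V by (simp_all add: x.prob_space[unfolded space_K] y.prob_space[unfolded space_K] algebra_simps)
    have mg: "(\<integral>u. g1 u \<partial>m) = c * (1 + \<beta> * (\<integral>u. V u \<partial>m)) - ((\<integral>u. f u \<partial>m) - b)"
      "(\<integral>u. g2 u \<partial>m) = c * (1 + \<beta> * (\<integral>u. V u \<partial>m)) + ((\<integral>u. f u \<partial>m) - b)"
      unfolding g1_def g2_def using fi m(3) by (simp_all add: m.prob_space)
    have W: "\<beta> * W u \<le> \<beta> * (\<gamma> * V u + C)" for u
      using \<beta> integral_V_le[of u] by (auto simp: W_def intro!: mult_left_mono)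
    let ?S = "V x + V y"
    have S: "0 \<le> ?S" "0 \<le> V x" "0 \<le> V y"
      using V_nonneg[of x] V_nonneg[of y] by auto
    show "(\<integral>u. f u \<partial>K x) - (\<integral>u. f u \<partial>K y) \<le> \<rho> * c * (2 + \<beta> * V x + \<beta> * V y)"
    proof (cases "?S \<le> R")
      case True
      have "\<kappa> * (\<integral>u. g1 u \<partial>m) \<le> \<kappa>' * (\<integral>u. g1 u \<partial>m)" "\<kappa> * (\<integral>u. g2 u \<partial>m) \<le> \<kappa>' * (\<integral>u. g2 u \<partial>m)"
        using \<kappa> g0 by (auto intro!: mult_right_mono)
      moreover have "\<kappa>' * (\<integral>u. g1 u \<partial>m) \<le> (\<integral>u. g1 u \<partial>K x)" "\<kappa>' * (\<integral>u. g2 u \<partial>m) \<le> (\<integral>u. g2 u \<partial>K y)"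
        using True S gi g0 by (auto intro!: minor)
      ultimately have "\<kappa> * (\<integral>u. g1 u \<partial>m) + \<kappa> * (\<integral>u. g2 u \<partial>m) \<le> (\<integral>u. g1 u \<partial>K x) + (\<integral>u. g2 u \<partial>K y)"
        by simp
      then have "2 * \<kappa> * (c * (1 + \<beta> * (\<integral>u. V u \<partial>m))) + ((\<integral>u. f u \<partial>K x) - (\<integral>u. f u \<partial>K y))
          \<le> c * (2 + \<beta> * W x + \<beta> * W y)"
        unfolding Kg mg by (simp add: algebra_simps)
      moreover have "2 * \<kappa> * c \<le> 2 * \<kappa> * (c * (1 + \<beta> * (\<integral>u. V u \<partial>m)))"
        using \<kappa> \<beta> c V_nonneg by (simp add: mult_left_le mult_le_cancel_left1 mult_left_mono)
      ultimately have "(\<integral>u. f u \<partial>K x) - (\<integral>u. f u \<partial>K y) \<le> c * (2 - 2 * \<kappa> + \<beta> * W x + \<beta> * W y)"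
        by (simp add: algebra_simps)
      also have "\<dots> \<le> c * (\<rho> * (2 + \<beta> * V x + \<beta> * V y))"
      proof (rule mult_left_mono[OF _ c])
        have "\<gamma> * (\<beta> * ?S) \<le> \<rho> * (\<beta> * ?S)"
          using \<rho> \<gamma> \<beta> S by (intro mult_right_mono) auto
        then show "2 - 2 * \<kappa> + \<beta> * W x + \<beta> * W y \<le> \<rho> * (2 + \<beta> * V x + \<beta> * V y)"
          using W[of x] W[of y] \<beta>(2) \<rho>(5) by (simp add: algebra_simps)
      qed
      finally show ?thesis
        by (simp add: ac_simps)
    next
      case False
      have "0 \<le> (\<integral>u. g1 u \<partial>K x) + (\<integral>u. g2 u \<partial>K y)"
        using g0 by auto
      then have "(\<integral>u. f u \<partial>K x) - (\<integral>u. f u \<partial>K y) \<le> c * (2 + \<beta> * W x + \<beta> * W y)"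
        unfolding Kg by (simp add: algebra_simps)
      also have "\<dots> \<le> c * (\<rho> * (2 + \<beta> * V x + \<beta> * V y))"
      proof (rule mult_left_mono[OF _ c])
        have "2 * C + 2 \<le> (1 - \<gamma>) / 2 * ?S"
          using False \<gamma> by (simp add: R_def field_simps)
        then have "\<beta> * (2 * C + 2) \<le> \<beta> * ((1 - \<gamma>) / 2 * ?S)"
          using \<beta> by (intro mult_left_mono) auto
        moreover have "(1 + \<gamma>) / 2 * (\<beta> * ?S) \<le> \<rho> * (\<beta> * ?S)"
          using \<rho> \<beta> S by (intro mult_right_mono) auto
        ultimately show "2 + \<beta> * W x + \<beta> * W y \<le> \<rho> * (2 + \<beta> * V x + \<beta> * V y)"
          using W[of x] W[of y] \<rho>(4) by (simp add: field_simps)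
      qed
      finally show ?thesis
        by (simp add: ac_simps)
    qed
  qed
qed

text \<open>No invariant measure is constructed. The increment from time \<open>t\<close> to
  \<open>Suc t\<close> at \<open>x\<close> is an average over \<open>K x\<close> of differences
  between values at time \<open>t\<close>; the contraction bounds it by a geometric term, so the
  increments are summable.\<close>

lemma convergent_kernel_iter:
  assumes [measurable]: "g \<in> borel_measurable borel" and g: "\<And>x. g x \<le> 1"
  shows "convergent (\<lambda>t. enn2real (kernel_iter K t g x))"
proof -
  define u where "u t x = enn2real (kernel_iter K t g x)" for t x
  have [measurable]: "u t \<in> borel_measurable borel" for t
    unfolding u_def by measurable
  have u: "ennreal (u t x) = kernel_iter K t g x" for t x
    using kernel_iter_le_1[of g t x, OF g] unfolding u_def
    by (intro ennreal_enn2real) (auto intro: le_less_trans)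
  have u01: "0 \<le> u t x \<and> u t x \<le> 1" for t x
    using kernel_iter_le_1[of g t x, OF g] unfolding u[symmetric] by (auto simp: u_def)
  have ui: "integrable (K x) (u t)" for t x
  proof -
    interpret prob_space "K x" by (rule prob_space_K)
    show ?thesis
      by (rule integrable_const_bound[where B = 1]) (use u01 in auto)
  qed
  have u_Suc: "u (Suc t) x = (\<integral>y. u t y \<partial>K x)" for t x
  proof -
    have "ennreal (u (Suc t) x) = (\<integral>\<^sup>+y. ennreal (u t y) \<partial>K x)"
      by (simp add: u)
    also have "\<dots> = ennreal (\<integral>y. u t y \<partial>K x)"
      using ui u01 by (intro nn_integral_eq_integral) auto
    finally show ?thesis
      using u01 by (subst (asm) ennreal_inj) auto
  qed
  obtain \<beta> \<rho> where \<beta>: "\<beta> > 0" and \<rho>: "0 \<le> \<rho>" "\<rho> < 1"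
    and contr: "\<And>(f :: 'a \<Rightarrow> real) c x y. f \<in> borel_measurable borel \<Longrightarrow> (\<And>u. 0 \<le> f u \<and> f u \<le> 1) \<Longrightarrow> 0 \<le> c \<Longrightarrow>
       (\<And>u v. f u - f v \<le> c * (2 + \<beta> * V u + \<beta> * V v)) \<Longrightarrow>
       (\<integral>u. f u \<partial>K x) - (\<integral>u. f u \<partial>K y) \<le> \<rho> * c * (2 + \<beta> * V x + \<beta> * V y)"
    using oscillation_contraction by metis
  have osc: "u t x - u t y \<le> \<rho> ^ t * (2 + \<beta> * V x + \<beta> * V y)" for t x y
  proof (induction t arbitrary: x y)
    case 0
    show ?case
      using u01[of 0 x] u01[of 0 y] \<beta> V_nonneg[of x] V_nonneg[of y]
      by (simp add: add_nonneg_nonneg add_increasing2)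
  next
    case (Suc t)
    show ?case
      using contr[where f = "u t" and c = "\<rho> ^ t" and x = x and y = y] Suc u01 \<rho> by (simp add: u_Suc)
  qed
  define B where "B = 2 + \<beta> * V x + \<beta> * (\<integral>y. V y \<partial>K x)"
  have bound: "norm (u (Suc t) x - u t x) \<le> \<rho> ^ t * B" for t
  proof -
    interpret prob_space "K x" by (rule prob_space_K)
    have "u (Suc t) x - u t x = (\<integral>y. u t y - u t x \<partial>K x)"
      using ui by (simp add: u_Suc prob_space[unfolded space_K])
    also have "\<bar>\<dots>\<bar> \<le> (\<integral>y. \<bar>u t y - u t x\<bar> \<partial>K x)"
      by (rule integral_abs_bound)
    also have "\<dots> \<le> (\<integral>y. \<rho> ^ t * (2 + \<beta> * V x + \<beta> * V y) \<partial>K x)"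
    proof (rule integral_mono)
      show "integrable (K x) (\<lambda>y. \<rho> ^ t * (2 + \<beta> * V x + \<beta> * V y))"
        using integrable_V by auto
      show "\<bar>u t y - u t x\<bar> \<le> \<rho> ^ t * (2 + \<beta> * V x + \<beta> * V y)" for y
        using osc[of t x y] osc[of t y x] by (simp add: abs_le_iff algebra_simps)
    qed (use ui in auto)
    also have "\<dots> = \<rho> ^ t * B"
      using integrable_V by (simp add: B_def prob_space[unfolded space_K] algebra_simps)
    finally show ?thesis
      by simp
  qed
  have "summable (\<lambda>t. \<rho> ^ t * B)"
    using \<rho> by (intro summable_mult2 summable_geometric) simp
  then have "summable (\<lambda>t. u (Suc t) x - u t x)"
    by (rule summable_comparison_test') (rule bound)
  then have "convergent (\<lambda>n. \<Sum>t<n. u (Suc t) x - u t x)"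
    by (simp add: summable_iff_convergent)
  then have "convergent (\<lambda>n. u n x - u 0 x)"
    by (simp add: sum_lessThan_telescope[of "\<lambda>n. u n x"])
  then show ?thesis
    by (simp add: convergent_diff_const_right_iff u_def)
qed

end

text \<open>A convergent sequence has the same limit as its time averages, and averaging removes
  \<open>B\<close>.\<close>

lemma limit_le_of_sum_le:
  fixes u :: "nat \<Rightarrow> real"
  assumes u: "u \<longlonglongrightarrow> l" and sum: "\<And>T. (\<Sum>t<T. u t) \<le> B + real T * q"
  shows "l \<le> q"
proof (rule ccontr)
  assume "\<not> l \<le> q"
  define r where "r = (l + q) / 2"
  have r: "q < r" "r < l"
    using \<open>\<not> l \<le> q\<close> by (auto simp: r_def)
  obtain N where N: "\<And>t. t \<ge> N \<Longrightarrow> r < u t"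
    using order_tendstoD(1)[OF u r(2)] by (auto simp: eventually_sequentially)
  have low: "(\<Sum>t<N. u t) + real k * r \<le> (\<Sum>t<N + k. u t)" for k
    by (induction k) (use N in \<open>auto simp: algebra_simps less_imp_le add_mono intro: order_trans\<close>)
  obtain k where k: "B + real N * q - (\<Sum>t<N. u t) < real k * (r - q)"
    using reals_Archimedean3[of "r - q"] r by auto
  show False
    using low[of k] sum[of "N + k"] k by (simp add: algebra_simps)
qed

section \<open>The law of the noised scheme\<close>

context harris_kernel
begin

text \<open>Two facts meet here: the contraction shows that the limit exists, and summing
  \<open>decrease\<close> bounds the time averages. \<open>A_le\<close> is the pointwise form of
  Markov's inequality.\<close>

lemma limsup_kernel_iter_le:
  assumes A [measurable]: "A \<in> sets borel" and h [measurable]: "h \<in> borel_measurable borel"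
    and c: "0 \<le> c" and d: "0 \<le> d"
    and decrease: "\<And>x. h x + (\<integral>\<^sup>+y. ennreal (V y) \<partial>K x) \<le> ennreal (V x) + ennreal c"
    and A_le: "\<And>x. AE y in K x. indicator A y \<le> ennreal d * h y"
  shows "limsup (\<lambda>t. kernel_iter K t (indicator A) x) \<le> ennreal (d * c)"
proof -
  define u where "u t = enn2real (kernel_iter K t (indicator A) x)" for t
  have u: "ennreal (u t) = kernel_iter K t (indicator A) x" for t
    unfolding u_def
    by (intro ennreal_enn2real le_less_trans[OF kernel_iter_le_1]) (auto simp: indicator_def)
  have "convergent u"
    unfolding u_def[abs_def] by (rule convergent_kernel_iter) (auto simp: indicator_def)
  then obtain l where l: "u \<longlonglongrightarrow> l"
    by (auto simp: convergent_def)
  have cmult: "kernel_iter K t (\<lambda>y. ennreal d * h y) x = ennreal d * kernel_iter K t h x" for t x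
    by (induction t arbitrary: x) (simp_all add: nn_integral_cmult)
  \<comment> \<open>The sum starts at time 1 because \<open>A_le\<close> holds only almost
    everywhere under the kernel.\<close>
  have "(\<Sum>t<T. u (Suc t)) \<le> d * (V x + c) + real T * (d * c)" for T
  proof -
    have "ennreal (\<Sum>t<T. u (Suc t)) = (\<Sum>t<T. kernel_iter K (Suc t) (indicator A) x)"
      by (subst sum_ennreal[symmetric]) (simp_all only: u, simp add: u_def)
    also have "\<dots> \<le> (\<Sum>t<T. ennreal d * kernel_iter K (Suc t) h x)"
      unfolding cmult[symmetric] by (intro sum_mono kernel_iter_Suc_mono A_le)
    also have "\<dots> \<le> ennreal d * ((\<Sum>t<Suc T. kernel_iter K t h x) + kernel_iter K (Suc T) V x)"
      unfolding sum_distrib_left[symmetric] sum.lessThan_Suc_shift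
      by (intro mult_left_mono add_increasing2 add_increasing order_refl) simp_all
    also have "\<dots> \<le> ennreal d * (ennreal (V x) + of_nat (Suc T) * ennreal c)"
      by (intro mult_left_mono sum_kernel_iter_le decrease) auto
    also have "\<dots> = ennreal (d * (V x + real (Suc T) * c))"
      using c d V_nonneg[of x]
      by (simp add: ennreal_of_nat_eq_real_of_nat del: of_nat_Suc ennreal_plus flip: ennreal_mult ennreal_plus)
    finally show ?thesis
      using c d V_nonneg[of x] by (subst (asm) ennreal_le_iff) (auto simp: algebra_simps)
  qed
  then have "l \<le> d * c"
    by (rule limit_le_of_sum_le[OF LIMSEQ_Suc[OF l]])
  moreover have "(\<lambda>t. kernel_iter K t (indicator A) x) \<longlonglongrightarrow> ennreal l"
    unfolding u[symmetric] by (intro tendsto_ennrealI l)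
  ultimately show ?thesis
    by (simp add: lim_imp_Limsup ennreal_leI)
qed

text \<open>Reverse Fatou with majorant 1. The bounds at finite times involve \<open>V x\<close>,
  which need not be integrable for \<open>\<nu>\<close>, so the limit in time is taken pointwise
  first.\<close>

lemma limsup_integral_kernel_iter_le:
  assumes A [measurable]: "A \<in> sets borel" and h [measurable]: "h \<in> borel_measurable borel"
    and c: "0 \<le> c" and d: "0 \<le> d"
    and decrease: "\<And>x. h x + (\<integral>\<^sup>+y. ennreal (V y) \<partial>K x) \<le> ennreal (V x) + ennreal c"
    and A_le: "\<And>x. AE y in K x. indicator A y \<le> ennreal d * h y"
    and \<nu>: "prob_space \<nu>" "sets \<nu> = sets borel"
  shows "limsup (\<lambda>t. \<integral>\<^sup>+x. kernel_iter K t (indicator A) x \<partial>\<nu>) \<le> ennreal (d * c)"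
proof -
  interpret \<nu>: prob_space \<nu> by fact
  note \<nu>(2)[measurable_cong]
  have "limsup (\<lambda>t. \<integral>\<^sup>+x. kernel_iter K t (indicator A) x \<partial>\<nu>) \<le>
      (\<integral>\<^sup>+x. limsup (\<lambda>t. kernel_iter K t (indicator A) x) \<partial>\<nu>)"
    by (rule nn_integral_limsup[where w = "\<lambda>_. 1"])
       (auto simp: \<nu>.emeasure_space_1 indicator_def intro!: kernel_iter_le_1)
  also have "\<dots> \<le> (\<integral>\<^sup>+x. ennreal (d * c) \<partial>\<nu>)"
    by (intro nn_integral_mono limsup_kernel_iter_le[OF A h c d decrease A_le])
  finally show ?thesis
    by (simp add: \<nu>.emeasure_space_1)
qed

end

section \<open>From the sample sequences to the iterated kernel\<close>

context sequence_space
begin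

lemma nn_integral_case_nat:
  assumes [measurable]: "f \<in> borel_measurable S"
  shows "(\<integral>\<^sup>+\<omega>. f \<omega> \<partial>S) = (\<integral>\<^sup>+s. (\<integral>\<^sup>+\<omega>. f (case_nat s \<omega>) \<partial>S) \<partial>M)"
proof -
  interpret S: prob_space S
    by (rule prob_space_PiM) (rule prob_space)
  have "(\<integral>\<^sup>+\<omega>. f \<omega> \<partial>S) = (\<integral>\<^sup>+\<omega>. f \<omega> \<partial>distr (M \<Otimes>\<^sub>M S) S (\<lambda>(s, \<omega>). case_nat s \<omega>))"
    by (simp add: PiM_iter)
  also have "\<dots> = (\<integral>\<^sup>+p. f (case p of (s, \<omega>) \<Rightarrow> case_nat s \<omega>) \<partial>(M \<Otimes>\<^sub>M S))"
    by (rule nn_integral_distr) auto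
  also have "\<dots> = (\<integral>\<^sup>+s. (\<integral>\<^sup>+\<omega>. f (case_nat s \<omega>) \<partial>S) \<partial>M)"
    by (subst P.nn_integral_fst[symmetric]) auto
  finally show ?thesis .
qed

end

definition sgd_kernel ::
  "('a::euclidean_space \<Rightarrow> 'b \<Rightarrow> 'a) \<Rightarrow> real \<Rightarrow> 'b measure \<Rightarrow> real \<Rightarrow> 'a \<Rightarrow> 'a measure" where
  "sgd_kernel \<phi> a \<mu> \<alpha> x =
     distr (\<mu> \<Otimes>\<^sub>M gaussian) borel (\<lambda>(\<theta>, e). x - \<alpha> *\<^sub>R \<phi> x \<theta> + (\<alpha> * a) *\<^sub>R e)"

text \<open>The scheme recurses on its last step, the kernel iterates on their first; shifting the
  sequences reconciles the two.\<close>

lemma noised_sgd_Suc_shift: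
  "noised_sgd \<phi> a \<alpha> (x, \<theta>, e) (Suc t) =
   noised_sgd \<phi> a \<alpha> (x - \<alpha> *\<^sub>R \<phi> x (\<theta> 1) + (\<alpha> * a) *\<^sub>R e 1, \<lambda>i. \<theta> (Suc i), \<lambda>i. e (Suc i)) t"
  by (induction t) simp_all

text \<open>Every step reads entries with a positive index, so anything may stand at index
  0.\<close>

lemma noised_sgd_case_nat:
  "noised_sgd \<phi> a \<alpha> (x, case_nat s \<theta>, case_nat s' e) t =
   noised_sgd \<phi> a \<alpha> (x, case_nat r \<theta>, case_nat r' e) t"
  by (induction t) simp_all

locale sgd_measurable = prob_space \<mu> for \<mu> :: "'b measure" +
  fixes \<phi> :: "'a::euclidean_space \<Rightarrow> 'b \<Rightarrow> 'a"
  assumes \<phi>_measurable [measurable]: "case_prod \<phi> \<in> borel \<Otimes>\<^sub>M \<mu> \<rightarrow>\<^sub>M borel"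
begin

lemma noised_sgd_measurable [measurable]:
  "(\<lambda>\<omega>. noised_sgd \<phi> a \<alpha> \<omega> t) \<in>
     borel \<Otimes>\<^sub>M ((\<Pi>\<^sub>M t\<in>(UNIV::nat set). \<mu>) \<Otimes>\<^sub>M (\<Pi>\<^sub>M t\<in>(UNIV::nat set). gaussian)) \<rightarrow>\<^sub>M borel"
proof (induction t)
  case (Suc t)
  note [measurable] = Suc
  have [measurable]: "(\<lambda>\<omega>. \<phi> (noised_sgd \<phi> a \<alpha> \<omega> t) (fst (snd \<omega>) (Suc t))) \<in>
     borel \<Otimes>\<^sub>M ((\<Pi>\<^sub>M t\<in>(UNIV::nat set). \<mu>) \<Otimes>\<^sub>M (\<Pi>\<^sub>M t\<in>(UNIV::nat set). gaussian)) \<rightarrow>\<^sub>M borel"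
    by (rule measurable_compose[OF _ \<phi>_measurable, where f = "\<lambda>\<omega>. (noised_sgd \<phi> a \<alpha> \<omega> t, fst (snd \<omega>) (Suc t))", simplified])
       measurable
  show ?case
    by simp
qed simp

lemma prob_space_sequences:
  "prob_space (\<Pi>\<^sub>M t\<in>(UNIV::nat set). \<mu>)" "prob_space (\<Pi>\<^sub>M t\<in>(UNIV::nat set). (gaussian :: 'a measure))"
  by (auto intro!: prob_space_PiM prob_space_gaussian prob_space_axioms)

lemma sgd_step_measurable [measurable]:
  "(\<lambda>(x, \<theta>, e). x - \<alpha> *\<^sub>R \<phi> x \<theta> + (\<alpha> * a) *\<^sub>R e) \<in> borel \<Otimes>\<^sub>M (\<mu> \<Otimes>\<^sub>M gaussian) \<rightarrow>\<^sub>M borel"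
  by measurable

lemma prob_space_pair_gaussian: "prob_space (\<mu> \<Otimes>\<^sub>M (gaussian :: 'a measure))"
proof -
  interpret G: prob_space "gaussian :: 'a measure" by (rule prob_space_gaussian)
  interpret pair_prob_space \<mu> "gaussian :: 'a measure" ..
  show ?thesis by (rule prob_space_axioms)
qed

lemma markov_kernel_sgd: "markov_kernel (sgd_kernel \<phi> a \<mu> \<alpha>)"
proof
  have "sgd_kernel \<phi> a \<mu> \<alpha> \<in> borel \<rightarrow>\<^sub>M subprob_algebra borel"
    unfolding sgd_kernel_def
    by (rule measurable_distr2[where M = "\<mu> \<Otimes>\<^sub>M gaussian"])
       (use sgd_step_measurable[of \<alpha> a] prob_space_pair_gaussian in
         \<open>auto simp: split_beta' space_subprob_algebra prob_space_imp_subprob_space\<close>)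
  moreover have "prob_space (sgd_kernel \<phi> a \<mu> \<alpha> x)" for x
    unfolding sgd_kernel_def
    by (intro prob_space.prob_space_distr prob_space_pair_gaussian) measurable
  ultimately show "sgd_kernel \<phi> a \<mu> \<alpha> \<in> borel \<rightarrow>\<^sub>M prob_algebra borel"
    by (auto simp: measurable_restrict_space2_iff prob_algebra_def)
qed

lemma nn_integral_sgd_kernel:
  assumes [measurable]: "g \<in> borel_measurable borel"
  shows "(\<integral>\<^sup>+y. g y \<partial>sgd_kernel \<phi> a \<mu> \<alpha> x) =
    (\<integral>\<^sup>+\<theta>. (\<integral>\<^sup>+e. g (x - \<alpha> *\<^sub>R \<phi> x \<theta> + (\<alpha> * a) *\<^sub>R e) \<partial>gaussian) \<partial>\<mu>)"
proof -
  interpret G: prob_space "gaussian :: 'a measure" by (rule prob_space_gaussian)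
  have "(\<integral>\<^sup>+y. g y \<partial>sgd_kernel \<phi> a \<mu> \<alpha> x) =
      (\<integral>\<^sup>+p. g (case p of (\<theta>, e) \<Rightarrow> x - \<alpha> *\<^sub>R \<phi> x \<theta> + (\<alpha> * a) *\<^sub>R e) \<partial>(\<mu> \<Otimes>\<^sub>M gaussian))"
    unfolding sgd_kernel_def by (rule nn_integral_distr) measurable
  also have "\<dots> = (\<integral>\<^sup>+\<theta>. (\<integral>\<^sup>+e. g (x - \<alpha> *\<^sub>R \<phi> x \<theta> + (\<alpha> * a) *\<^sub>R e) \<partial>gaussian) \<partial>\<mu>)"
    by (subst G.nn_integral_fst[symmetric]) auto
  finally show ?thesis .
qed

text \<open>After \<open>noised_sgd_Suc_shift\<close>, the samples of the first step sit at index 0,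
  the position that the remaining steps ignore. The sequences are therefore split twice: once to
  drop the original unread entries, once to expose the samples of the first step.\<close>

lemma nn_integral_noised_sgd:
  assumes g [measurable]: "g \<in> borel_measurable borel"
  shows "(\<integral>\<^sup>+\<theta>. (\<integral>\<^sup>+e. g (noised_sgd \<phi> a \<alpha> (x, \<theta>, e) t) \<partial>(\<Pi>\<^sub>M t\<in>UNIV. gaussian)) \<partial>(\<Pi>\<^sub>M t\<in>UNIV. \<mu>)) =
    kernel_iter (sgd_kernel \<phi> a \<mu> \<alpha>) t g x"
proof (induction t arbitrary: x)
  let ?M = "\<Pi>\<^sub>M t\<in>(UNIV::nat set). \<mu>" and ?G = "\<Pi>\<^sub>M t\<in>(UNIV::nat set). (gaussian :: 'a measure)"
  interpret M: prob_space ?M by (rule prob_space_sequences)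
  interpret G: prob_space ?G by (rule prob_space_sequences)
  interpret G1: prob_space "gaussian :: 'a measure" by (rule prob_space_gaussian)
  interpret MS: sequence_space \<mu> ..
  interpret GS: sequence_space "gaussian :: 'a measure" ..
  interpret pair_sigma_finite ?M "gaussian :: 'a measure" ..
  interpret kernel: markov_kernel "sgd_kernel \<phi> a \<mu> \<alpha>" by (rule markov_kernel_sgd)
  {
    case 0
    show ?case
      by (simp add: G.emeasure_space_1 M.emeasure_space_1)
  next
    case (Suc t)
    let ?step = "\<lambda>s s'. x - \<alpha> *\<^sub>R \<phi> x s + (\<alpha> * a) *\<^sub>R s'"
    have split: "(\<integral>\<^sup>+\<theta>. (\<integral>\<^sup>+e. f \<theta> e \<partial>?G) \<partial>?M) =
        (\<integral>\<^sup>+s. (\<integral>\<^sup>+s'. (\<integral>\<^sup>+\<theta>. (\<integral>\<^sup>+e. f (case_nat s \<theta>) (case_nat s' e) \<partial>?G) \<partial>?M) \<partial>gaussian) \<partial>\<mu>)"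
      if [measurable]: "case_prod f \<in> borel_measurable (?M \<Otimes>\<^sub>M ?G)" for f
    proof -
      have "(\<integral>\<^sup>+\<theta>. (\<integral>\<^sup>+e. f \<theta> e \<partial>?G) \<partial>?M) = (\<integral>\<^sup>+s. (\<integral>\<^sup>+\<theta>. (\<integral>\<^sup>+e. f (case_nat s \<theta>) e \<partial>?G) \<partial>?M) \<partial>\<mu>)"
        by (rule MS.nn_integral_case_nat) measurable
      also have "\<dots> = (\<integral>\<^sup>+s. (\<integral>\<^sup>+\<theta>. (\<integral>\<^sup>+s'. (\<integral>\<^sup>+e. f (case_nat s \<theta>) (case_nat s' e) \<partial>?G) \<partial>gaussian) \<partial>?M) \<partial>\<mu>)"
        by (intro nn_integral_cong GS.nn_integral_case_nat) measurable
      also have "\<dots> = (\<integral>\<^sup>+s. (\<integral>\<^sup>+s'. (\<integral>\<^sup>+\<theta>. (\<integral>\<^sup>+e. f (case_nat s \<theta>) (case_nat s' e) \<partial>?G) \<partial>?M) \<partial>gaussian) \<partial>\<mu>)"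
        by (intro nn_integral_cong Fubini'[symmetric]) measurable
      finally show ?thesis .
    qed
    \<comment> \<open>The induction hypothesis averages over the unread entries as well; as the
      value does not depend on them, it also holds with these entries fixed.\<close>
    have const: "(\<integral>\<^sup>+\<theta>. (\<integral>\<^sup>+e. g (noised_sgd \<phi> a \<alpha> (y, case_nat s \<theta>, case_nat s' e) t) \<partial>?G) \<partial>?M) =
        kernel_iter (sgd_kernel \<phi> a \<mu> \<alpha>) t g y" for y s s'
    proof -
      have "kernel_iter (sgd_kernel \<phi> a \<mu> \<alpha>) t g y =
        (\<integral>\<^sup>+r. (\<integral>\<^sup>+r'. (\<integral>\<^sup>+\<theta>. (\<integral>\<^sup>+e. g (noised_sgd \<phi> a \<alpha> (y, case_nat r \<theta>, case_nat r' e) t) \<partial>?G) \<partial>?M) \<partial>gaussian) \<partial>\<mu>)"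
        unfolding Suc[symmetric] by (rule split) measurable
      also have "\<dots> = (\<integral>\<^sup>+r. (\<integral>\<^sup>+r'. (\<integral>\<^sup>+\<theta>. (\<integral>\<^sup>+e. g (noised_sgd \<phi> a \<alpha> (y, case_nat s \<theta>, case_nat s' e) t) \<partial>?G) \<partial>?M) \<partial>(gaussian :: 'a measure)) \<partial>\<mu>)"
        by (subst noised_sgd_case_nat) (rule refl)
      finally show ?thesis
        by (simp add: G1.emeasure_space_1[simplified] emeasure_space_1)
    qed
    have "(\<integral>\<^sup>+\<theta>. (\<integral>\<^sup>+e. g (noised_sgd \<phi> a \<alpha> (x, \<theta>, e) (Suc t)) \<partial>?G) \<partial>?M) =
        (\<integral>\<^sup>+s. (\<integral>\<^sup>+s'. (\<integral>\<^sup>+\<theta>. (\<integral>\<^sup>+e. g (noised_sgd \<phi> a \<alpha> (x, case_nat s \<theta>, case_nat s' e) (Suc t)) \<partial>?G) \<partial>?M) \<partial>gaussian) \<partial>\<mu>)"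
    proof (rule split)
      have "(\<lambda>p. g (noised_sgd \<phi> a \<alpha> (x, p) (Suc t))) \<in> borel_measurable (?M \<Otimes>\<^sub>M ?G)"
        by (rule measurable_compose[OF measurable_compose[OF measurable_Pair1' noised_sgd_measurable] g]) simp
      then show "(\<lambda>(\<theta>, e). g (noised_sgd \<phi> a \<alpha> (x, \<theta>, e) (Suc t))) \<in> borel_measurable (?M \<Otimes>\<^sub>M ?G)"
        by (simp add: case_prod_beta del: noised_sgd.simps)
    qed
    also have "\<dots> = (\<integral>\<^sup>+\<theta>. (\<integral>\<^sup>+e. g (noised_sgd \<phi> a \<alpha> (?step (\<theta> 0) (e 0), \<theta>, e) t) \<partial>?G) \<partial>?M)"
      unfolding noised_sgd_Suc_shift
      by (simp add: G1.emeasure_space_1[simplified] emeasure_space_1)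
    \<comment> \<open>In this second split \<open>s\<close> and \<open>s'\<close> are the samples of
      the first step, whereas in the previous one they were the unread entries and integrated
      out.\<close>
    also have "\<dots> = (\<integral>\<^sup>+s. (\<integral>\<^sup>+s'. (\<integral>\<^sup>+\<theta>. (\<integral>\<^sup>+e. g (noised_sgd \<phi> a \<alpha>
        (?step s s', case_nat s \<theta>, case_nat s' e) t) \<partial>?G) \<partial>?M) \<partial>gaussian) \<partial>\<mu>)"
    proof (subst split)
      have [measurable]: "\<phi> x \<in> \<mu> \<rightarrow>\<^sub>M borel"
        using measurable_compose[OF measurable_Pair1' \<phi>_measurable, of x] by simp
      have "(\<lambda>p. g (noised_sgd \<phi> a \<alpha> (?step (fst p 0) (snd p 0), p) t)) \<in> borel_measurable (?M \<Otimes>\<^sub>M ?G)"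
        by (rule measurable_compose[OF measurable_compose[OF _ noised_sgd_measurable] g]) measurable
      then show "(\<lambda>(\<theta>, e). g (noised_sgd \<phi> a \<alpha> (?step (\<theta> 0) (e 0), \<theta>, e) t)) \<in> borel_measurable (?M \<Otimes>\<^sub>M ?G)"
        by (simp add: case_prod_beta)
    qed simp
    also have "\<dots> = (\<integral>\<^sup>+s. (\<integral>\<^sup>+s'. kernel_iter (sgd_kernel \<phi> a \<mu> \<alpha>) t g (?step s s') \<partial>gaussian) \<partial>\<mu>)"
      unfolding const ..
    also have "\<dots> = kernel_iter (sgd_kernel \<phi> a \<mu> \<alpha>) (Suc t) g x"
      unfolding kernel_iter.simps(2) by (rule nn_integral_sgd_kernel[symmetric]) measurable
    finally show ?case .
  }
qed

lemma emeasure_noised_sgd: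
  fixes \<nu> :: "'a measure"
  assumes \<nu>: "sets \<nu> = sets borel" and A [measurable]: "A \<in> sets borel"
  shows "emeasure (sample_measure \<nu> \<mu> gaussian)
      {\<omega> \<in> space (sample_measure \<nu> \<mu> gaussian). noised_sgd \<phi> a \<alpha> \<omega> t \<in> A} =
    (\<integral>\<^sup>+x. kernel_iter (sgd_kernel \<phi> a \<mu> \<alpha>) t (indicator A) x \<partial>\<nu>)"
proof -
  let ?M = "\<Pi>\<^sub>M t\<in>(UNIV::nat set). \<mu>" and ?G = "\<Pi>\<^sub>M t\<in>(UNIV::nat set). (gaussian :: 'a measure)"
  let ?S = "sample_measure \<nu> \<mu> (gaussian :: 'a measure)"
  interpret M: prob_space ?M by (rule prob_space_sequences)
  interpret G: prob_space ?G by (rule prob_space_sequences)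
  interpret pair_prob_space ?M ?G ..
  note \<nu>[measurable_cong]
  have [measurable_cong]: "sets ?S = sets (borel \<Otimes>\<^sub>M (?M \<Otimes>\<^sub>M ?G))"
    unfolding sample_measure_def by (intro sets_pair_measure_cong \<nu> refl)
  have "emeasure ?S {\<omega> \<in> space ?S. noised_sgd \<phi> a \<alpha> \<omega> t \<in> A} =
      (\<integral>\<^sup>+\<omega>. indicator A (noised_sgd \<phi> a \<alpha> \<omega> t) \<partial>?S)"
    by (subst nn_integral_indicator[symmetric]) (measurable, intro nn_integral_cong, simp add: indicator_def)
  also have "\<dots> = (\<integral>\<^sup>+x. (\<integral>\<^sup>+p. indicator A (noised_sgd \<phi> a \<alpha> (x, p) t) \<partial>(?M \<Otimes>\<^sub>M ?G)) \<partial>\<nu>)"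
    unfolding sample_measure_def by (subst nn_integral_fst[symmetric]) auto
  also have "\<dots> = (\<integral>\<^sup>+x. (\<integral>\<^sup>+\<theta>. (\<integral>\<^sup>+e. indicator A (noised_sgd \<phi> a \<alpha> (x, \<theta>, e) t) \<partial>?G) \<partial>?M) \<partial>\<nu>)"
    by (intro nn_integral_cong G.nn_integral_fst[symmetric]) measurable
  finally show ?thesis
    by (simp add: nn_integral_noised_sgd)
qed

end

section \<open>Noised descent for semiconcave functions\<close>

lemma set_distance_superlevel_measurable:
  "{x :: 'a::euclidean_space. ereal \<epsilon> < set_distance x S} \<in> sets borel"
proof (cases "S = {}")
  case True
  then show ?thesis
    by (simp add: set_distance_def top_ereal_def)
next
  case False
  have "open {x :: 'a. \<epsilon> < infdist x S}"
    by (intro open_Collect_less continuous_intros)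
  then show ?thesis
    using False by (simp add: set_distance_eq_infdist)
qed

lemma clarke_criticalI:
  assumes "\<And>i::nat. GDERIV f (X i) :> G i" "X \<longlonglongrightarrow> x" "G \<longlonglongrightarrow> 0"
  shows "x \<in> clarke_critical f"
  unfolding clarke_critical_def clarke_subdiff_def
  using assms by (auto intro!: hull_inc)

lemma set_distance_le:
  assumes "y \<in> S"
  shows "set_distance x S \<le> ereal (dist x y)"
  unfolding set_distance_def using assms by (rule INF_lower)

text \<open>What the probabilistic argument retains of the sliced energies. \<open>\<Phi>\<close> is
  a supergradient everywhere but a gradient only almost everywhere. The same \<open>m\<close> and
  \<open>c\<close> serve both coercivity bounds, and the same \<open>B\<close> both growth
  bounds.\<close>

locale semiconcave_sgd = sgd_measurable \<mu> \<phi>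
  for \<mu> :: "'b measure" and \<phi> :: "'a::euclidean_space \<Rightarrow> 'b \<Rightarrow> 'a" +
  fixes F :: "'a \<Rightarrow> real" and \<Phi> :: "'a \<Rightarrow> 'a" and L B c m :: real
  assumes mean: "\<Phi> x = (\<integral>\<theta>. \<phi> x \<theta> \<partial>\<mu>)"
    and growth: "\<theta> \<in> space \<mu> \<Longrightarrow> norm (\<phi> x \<theta>) \<le> B * (1 + norm x)"
    and semiconcave: "F y \<le> F x + \<Phi> x \<bullet> (y - x) + L * (norm (y - x))\<^sup>2"
    and pos: "0 \<le> L" "0 < B" "0 \<le> c" "0 < m"
    and F_nonneg: "0 \<le> F x" and F_le: "F x \<le> B * (1 + (norm x)\<^sup>2)"
    and F_coercive: "m * (norm x)\<^sup>2 \<le> F x + c"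
    and \<Phi>_coercive: "m * (norm x)\<^sup>2 \<le> (norm (\<Phi> x))\<^sup>2 + c"
    and AE_gradient: "AE x in lborel. GDERIV F x :> \<Phi> x"
begin

lemma \<phi>_section_measurable [measurable]: "\<phi> x \<in> \<mu> \<rightarrow>\<^sub>M borel"
  using measurable_compose[OF measurable_Pair1' \<phi>_measurable, of x] by simp

lemma \<phi>_integrable: "integrable \<mu> (\<phi> x)"
  by (rule integrable_const_bound[where B = "B * (1 + norm x)"]) (auto intro!: AE_I2 growth)

lemma \<Phi>_measurable [measurable]: "\<Phi> \<in> borel \<rightarrow>\<^sub>M borel"
  unfolding mean[abs_def] by measurable

lemma norm_\<Phi>_le: "norm (\<Phi> x) \<le> B * (1 + norm x)"
proof -
  have "norm (\<Phi> x) \<le> (\<integral>\<theta>. norm (\<phi> x \<theta>) \<partial>\<mu>)"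
    unfolding mean by (rule integral_norm_bound)
  also have "\<dots> \<le> (\<integral>\<theta>. B * (1 + norm x) \<partial>\<mu>)"
    by (intro integral_mono integrable_norm \<phi>_integrable integrable_const growth)
  finally show ?thesis
    by (simp add: prob_space)
qed

text \<open>Semiconcavity applied at either of two points gives a local Lipschitz bound. Within
  distance 1 of \<open>x\<close>, \<open>B * (2 + norm x)\<close> bounds \<open>\<Phi>\<close> and
  the quadratic term is at most \<open>L\<close> times the distance, whence
  \<open>D\<close>.\<close>

lemma continuous_F: "continuous_on UNIV F"
proof (rule continuous_at_imp_continuous_on, intro ballI)
  fix x :: 'a
  define D where "D = B * (2 + norm x) + L"
  have bound: "\<bar>F y - F x\<bar> \<le> D * norm (y - x)" if "norm (y - x) \<le> 1" for y
  proof -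
    have half: "F v - F u \<le> D * norm (v - u)" if uv: "norm (v - u) \<le> 1" "norm u \<le> 1 + norm x" for u v
    proof -
      have "\<Phi> u \<bullet> (v - u) \<le> norm (\<Phi> u) * norm (v - u)"
        by (rule norm_cauchy_schwarz)
      also have "\<dots> \<le> (B * (2 + norm x)) * norm (v - u)"
        using norm_\<Phi>_le[of u] pos uv
        by (intro mult_right_mono order_trans[OF norm_\<Phi>_le] mult_left_mono) auto
      finally have "\<Phi> u \<bullet> (v - u) \<le> (B * (2 + norm x)) * norm (v - u)" .
      moreover have "L * (norm (v - u))\<^sup>2 \<le> L * norm (v - u)"
        using pos uv by (intro mult_left_mono) (auto simp: power2_eq_square mult_left_le)
      ultimately show ?thesis
        using semiconcave[of v u] by (simp add: D_def algebra_simps)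
    qed
    have "norm y \<le> 1 + norm x"
      using that norm_triangle_ineq2[of y x] by linarith
    then show ?thesis
      using half[of y x] half[of x y] that by (simp add: abs_le_iff norm_minus_commute)
  qed
  have "(\<lambda>y. F y - F x) \<midarrow>x\<rightarrow> 0"
  proof (rule tendsto_rabs_zero_cancel, rule tendsto_sandwich[OF _ _ tendsto_const])
    show "\<forall>\<^sub>F y in at x. \<bar>F y - F x\<bar> \<le> D * norm (y - x)"
      unfolding eventually_at by (rule exI[of _ 1]) (auto simp: dist_norm intro!: bound)
    show "(\<lambda>y. D * norm (y - x)) \<midarrow>x\<rightarrow> 0"
      by (rule tendsto_eq_intros refl)+ simp
  qed auto
  then show "isCont F x"
    by (simp add: isCont_def LIM_zero_iff)
qed

lemma F_measurable [measurable]: "F \<in> borel_measurable borel"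
  by (rule borel_measurable_continuous_onI[OF continuous_F])

text \<open>Points with \<open>GDERIV\<close> are singled out because there the values of
  \<open>\<Phi>\<close> are gradients, whose limits belong to the Clarke sub-differential at a limit
  point by construction.\<close>

lemma gradient_bounded_below_far_from_critical:
  assumes \<epsilon>: "\<epsilon> > 0"
  obtains \<delta> where "\<delta> > 0"
    "\<And>x. GDERIV F x :> \<Phi> x \<Longrightarrow> ereal \<epsilon> < set_distance x (clarke_critical F) \<Longrightarrow> \<delta> \<le> norm (\<Phi> x)"
proof (rule ccontr)
  assume "\<not> thesis"
  then have "\<exists>x. GDERIV F x :> \<Phi> x \<and> ereal \<epsilon> < set_distance x (clarke_critical F) \<and> norm (\<Phi> x) < 1 / real (Suc i)" for i
    using \<open>\<not> thesis\<close> that[of "1 / real (Suc i)"]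
    by (metis divide_pos_pos zero_less_one of_nat_0_less_iff zero_less_Suc not_le)
  then obtain X where X: "GDERIV F (X i) :> \<Phi> (X i)" "ereal \<epsilon> < set_distance (X i) (clarke_critical F)"
    "norm (\<Phi> (X i)) < 1 / real (Suc i)" for i
    by metis
  \<comment> \<open>Once \<open>\<Phi>\<close> has norm at most 1, \<open>\<Phi>_coercive\<close>
    confines the point to this ball.\<close>
  have "X i \<in> cball 0 (sqrt ((1 + c) / m))" for i
  proof -
    have "1 / real (Suc i) \<le> 1"
      by simp
    then have "norm (\<Phi> (X i)) \<le> 1"
      using X(3)[of i] by linarith
    then have "(norm (\<Phi> (X i)))\<^sup>2 \<le> 1"
      by (simp add: power_le_one)
    then have "m * (norm (X i))\<^sup>2 \<le> 1 + c"
      using \<Phi>_coercive[of "X i"] by simp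
    then have "(norm (X i))\<^sup>2 \<le> (1 + c) / m"
      using pos by (simp add: field_simps)
    then show ?thesis
      using real_le_rsqrt by auto
  qed
  then obtain x r where r: "strict_mono r" "(X \<circ> r) \<longlonglongrightarrow> x"
    using compact_cball[of "0::'a" "sqrt ((1 + c) / m)"] unfolding compact_def by metis
  have "(\<lambda>i. \<Phi> (X i)) \<longlonglongrightarrow> 0"
    by (rule tendsto_norm_zero_cancel, rule tendsto_sandwich[OF _ _ tendsto_const lim_1_over_n[THEN LIMSEQ_Suc]])
       (use X(3) in \<open>auto simp: less_imp_le\<close>)
  then have "(\<lambda>i. \<Phi> ((X \<circ> r) i)) \<longlonglongrightarrow> 0"
    using LIMSEQ_subseq_LIMSEQ[OF _ r(1)] by (simp add: comp_def)
  then have crit: "x \<in> clarke_critical F"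
    using X(1) r(2) by (intro clarke_criticalI[where X = "X \<circ> r" and G = "\<lambda>i. \<Phi> ((X \<circ> r) i)"]) auto
  have "\<epsilon> < dist ((X \<circ> r) i) x" for i
    using less_le_trans[OF X(2)[of "r i"] set_distance_le[OF crit]] by simp
  moreover have "\<forall>\<^sub>F i in sequentially. dist ((X \<circ> r) i) x < \<epsilon>"
    using tendstoD[OF r(2) \<epsilon>] .
  ultimately show False
    by (auto simp: eventually_sequentially dest: less_asym)
qed

text \<open>The coefficient of \<alpha>^2 a^2 which the second moment of the noise contributes to
  the bound on the mean of \<open>F\<close> after a step.\<close>

definition \<beta> :: real where
  "\<beta> = 2 * L * (\<integral>e. (norm e)\<^sup>2 \<partial>(gaussian :: 'a measure))"

text \<open>Up to this step size, the part of the second-order error proportional to |\<Phi>|^2 is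
  at most half of the first-order gain. The summand 1 keeps the quotient positive when
  \<open>L = 0\<close>.\<close>

definition \<alpha>\<^sub>1 :: real where
  "\<alpha>\<^sub>1 = 1 / (1 + 8 * L * B\<^sup>2 / m)"

text \<open>The second-order terms free of the state: the noise, and the constants left when the
  norm of \<open>x\<close> is traded for that of \<open>\<Phi> x\<close> by
  \<open>\<Phi>_coercive\<close>.\<close>

definition D :: "real \<Rightarrow> real" where
  "D a = a\<^sup>2 * \<beta> + 4 * L * B\<^sup>2 * (1 + c / m)"

lemma constants: "0 \<le> \<beta>" "0 < \<alpha>\<^sub>1" "0 \<le> D a"
proof -
  show \<beta>: "0 \<le> \<beta>"
    using pos by (simp add: \<beta>_def)
  show "0 < \<alpha>\<^sub>1"
    using pos by (auto simp: \<alpha>\<^sub>1_def intro!: divide_pos_pos add_pos_nonneg)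
  show "0 \<le> D a"
    using pos \<beta> by (auto simp: D_def intro!: add_nonneg_nonneg mult_nonneg_nonneg)
qed

text \<open>Averaging the semiconcavity bound removes the linear term in the centred noise and turns
  \<open>\<phi>\<close> into \<open>\<Phi>\<close>, which yields -\<alpha> |\<Phi>|^2. The error
  \<alpha>^2 |\<phi>|^2 grows with the state; \<open>\<Phi>_coercive\<close> bounds it in terms of
  |\<Phi>|^2, and half of the gain absorbs it.\<close>

lemma expected_decrease:
  assumes \<alpha>: "0 < \<alpha>" "\<alpha> \<le> \<alpha>\<^sub>1"
  shows "ennreal (\<alpha> / 2 * (norm (\<Phi> x))\<^sup>2) + (\<integral>\<^sup>+y. ennreal (F y) \<partial>sgd_kernel \<phi> a \<mu> \<alpha> x)
    \<le> ennreal (F x) + ennreal (D a * \<alpha>\<^sup>2)"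
proof -
  interpret G: prob_space "gaussian :: 'a measure" by (rule prob_space_gaussian)
  note Gid = integrable_gaussian_id[where 'a='a] and Gsq = integrable_gaussian_norm_square[where 'a='a]
  \<comment> \<open>\<open>S\<close> bounds the squared norm of \<open>\<phi> x \<theta>\<close>;
    \<open>q\<close> is the bound for a given direction and noise, \<open>q'\<close> its mean over
    the noise. The factor 2 in \<open>q\<close> comes from separating direction and noise in the
    squared increment.\<close>
  define S where "S = B\<^sup>2 * (2 + 2 * (norm x)\<^sup>2)"
  define q where "q \<theta> e = F x + \<Phi> x \<bullet> ((\<alpha> * a) *\<^sub>R e - \<alpha> *\<^sub>R \<phi> x \<theta>) + 2 * L * \<alpha>\<^sup>2 * (a\<^sup>2 * (norm e)\<^sup>2 + S)"
    for \<theta> and e :: 'a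
  define q' where "q' \<theta> = F x - \<alpha> * (\<Phi> x \<bullet> \<phi> x \<theta>) + (a\<^sup>2 * \<beta> + 2 * L * S) * \<alpha>\<^sup>2" for \<theta>
  have F_le_q: "F (x - \<alpha> *\<^sub>R \<phi> x \<theta> + (\<alpha> * a) *\<^sub>R e) \<le> q \<theta> e" if \<theta>: "\<theta> \<in> space \<mu>" for \<theta> e
  proof -
    let ?h = "(\<alpha> * a) *\<^sub>R e - \<alpha> *\<^sub>R \<phi> x \<theta>"
    have sq: "(norm (u - v))\<^sup>2 \<le> 2 * (norm u)\<^sup>2 + 2 * (norm v)\<^sup>2" for u v :: 'a
    proof -
      have "(norm (u - v))\<^sup>2 + (norm (u + v))\<^sup>2 = 2 * (norm u)\<^sup>2 + 2 * (norm v)\<^sup>2"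
        by (simp add: power2_norm_eq_inner inner_diff inner_add algebra_simps inner_commute)
      then show ?thesis
        using zero_le_power2[of "norm (u + v)"] by linarith
    qed
    have "(norm (\<phi> x \<theta>))\<^sup>2 \<le> (B * (1 + norm x))\<^sup>2"
      using growth[OF \<theta>] by (intro power_mono) auto
    also have "\<dots> \<le> S"
      using sum_squares_bound[of 1 "norm x"] unfolding S_def power_mult_distrib
      by (intro mult_left_mono) (auto simp: power2_sum)
    finally have "(norm (\<phi> x \<theta>))\<^sup>2 \<le> S" .
    then have "(norm (\<alpha> *\<^sub>R \<phi> x \<theta>))\<^sup>2 \<le> \<alpha>\<^sup>2 * S"
      by (simp add: power_mult_distrib mult_left_mono)
    then have "(norm ?h)\<^sup>2 \<le> 2 * \<alpha>\<^sup>2 * (a\<^sup>2 * (norm e)\<^sup>2 + S)"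
      using sq[of "(\<alpha> * a) *\<^sub>R e" "\<alpha> *\<^sub>R \<phi> x \<theta>"] by (simp add: power_mult_distrib algebra_simps)
    then have "L * (norm ?h)\<^sup>2 \<le> L * (2 * \<alpha>\<^sup>2 * (a\<^sup>2 * (norm e)\<^sup>2 + S))"
      using pos by (intro mult_left_mono) auto
    then show ?thesis
      using semiconcave[of "x - \<alpha> *\<^sub>R \<phi> x \<theta> + (\<alpha> * a) *\<^sub>R e" x] by (simp add: q_def algebra_simps)
  qed
  have inner: "(\<integral>\<^sup>+e. ennreal (F (x - \<alpha> *\<^sub>R \<phi> x \<theta> + (\<alpha> * a) *\<^sub>R e)) \<partial>gaussian) \<le> ennreal (q' \<theta>) \<and> 0 \<le> q' \<theta>"
    if \<theta>: "\<theta> \<in> space \<mu>" for \<theta>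
  proof -
    have qi: "integrable gaussian (q \<theta>)"
      unfolding q_def using Gid Gsq by (auto intro!: integrable_inner_right)
    have q0: "0 \<le> q \<theta> e" for e
      using F_le_q[OF \<theta>, of e] F_nonneg order_trans by blast
    have "(\<integral>e. q \<theta> e \<partial>gaussian) = q' \<theta>"
    proof -
      have "(\<integral>e. q \<theta> e \<partial>gaussian) = (\<integral>e. F x - \<alpha> * (\<Phi> x \<bullet> \<phi> x \<theta>) + 2 * L * S * \<alpha>\<^sup>2
          + (\<alpha> * a) * (\<Phi> x \<bullet> e) + 2 * L * \<alpha>\<^sup>2 * a\<^sup>2 * (norm e)\<^sup>2 \<partial>gaussian)"
        by (intro Bochner_Integration.integral_cong) (auto simp: q_def inner_diff_right algebra_simps)
      also have "\<dots> = F x - \<alpha> * (\<Phi> x \<bullet> \<phi> x \<theta>) + 2 * L * S * \<alpha>\<^sup>2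
          + (\<alpha> * a) * (\<Phi> x \<bullet> (\<integral>e. e \<partial>gaussian)) + 2 * L * \<alpha>\<^sup>2 * a\<^sup>2 * (\<integral>e. (norm e)\<^sup>2 \<partial>(gaussian :: 'a measure))"
        using Gid Gsq by (simp add: G.prob_space[unfolded space_gaussian])
      also have "\<dots> = q' \<theta>"
        by (simp add: integral_gaussian_id q'_def \<beta>_def algebra_simps)
      finally show ?thesis .
    qed
    moreover have "(\<integral>\<^sup>+e. ennreal (F (x - \<alpha> *\<^sub>R \<phi> x \<theta> + (\<alpha> * a) *\<^sub>R e)) \<partial>gaussian) \<le> (\<integral>\<^sup>+e. ennreal (q \<theta> e) \<partial>gaussian)"
      using F_le_q[OF \<theta>] by (intro nn_integral_mono ennreal_leI)
    ultimately show ?thesis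
      using q0 by (simp add: nn_integral_eq_integral[OF qi])
        (metis Bochner_Integration.integral_nonneg)
  qed
  have q'_int: "integrable \<mu> q'"
    unfolding q'_def using \<phi>_integrable[of x] by (auto intro!: integrable_inner_right)
  define s where "s = (norm (\<Phi> x))\<^sup>2"
  have q'_mean: "(\<integral>\<theta>. q' \<theta> \<partial>\<mu>) = F x - \<alpha> * s + (a\<^sup>2 * \<beta> + 2 * L * S) * \<alpha>\<^sup>2"
    unfolding q'_def s_def using \<phi>_integrable[of x]
    by (simp add: prob_space mean[symmetric] power2_norm_eq_inner)
  have "(norm x)\<^sup>2 \<le> (s + c) / m"
    using \<Phi>_coercive[of x] pos by (simp add: s_def field_simps)
  then have "S \<le> B\<^sup>2 * (2 + 2 * ((s + c) / m))"
    unfolding S_def by (intro mult_left_mono add_left_mono) auto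
  then have "2 * L * S \<le> 2 * L * (B\<^sup>2 * (2 + 2 * ((s + c) / m)))"
    using pos by (intro mult_left_mono) auto
  also have "\<dots> = 4 * L * B\<^sup>2 * (1 + c / m) + 4 * L * B\<^sup>2 / m * s"
    using pos by (simp add: field_simps)
  finally have "(a\<^sup>2 * \<beta> + 2 * L * S) * \<alpha>\<^sup>2 \<le> (D a + 4 * L * B\<^sup>2 / m * s) * \<alpha>\<^sup>2"
    by (intro mult_right_mono) (auto simp: D_def)
  moreover have "(4 * L * B\<^sup>2 / m * s) * \<alpha>\<^sup>2 \<le> \<alpha> / 2 * s"
  proof -
    have "8 * L * B\<^sup>2 / m * \<alpha> \<le> 1"
    proof -
      have "\<alpha> * (1 + 8 * L * B\<^sup>2 / m) \<le> 1"
        using \<alpha> pos unfolding \<alpha>\<^sub>1_def by (subst (asm) pos_le_divide_eq) (auto intro!: add_pos_nonneg)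
      then show ?thesis
        using \<alpha> by (simp add: algebra_simps)
    qed
    then have "(8 * L * B\<^sup>2 / m * \<alpha>) * (\<alpha> / 2 * s) \<le> 1 * (\<alpha> / 2 * s)"
      using \<alpha> by (intro mult_right_mono) (auto simp: s_def)
    then show ?thesis
      by (simp add: power2_eq_square algebra_simps)
  qed
  ultimately have "(a\<^sup>2 * \<beta> + 2 * L * S) * \<alpha>\<^sup>2 \<le> D a * \<alpha>\<^sup>2 + \<alpha> / 2 * s"
    unfolding distrib_right[of "D a"] by linarith
  then have mean_le: "\<alpha> / 2 * s + (\<integral>\<theta>. q' \<theta> \<partial>\<mu>) \<le> F x + D a * \<alpha>\<^sup>2"
    unfolding q'_mean by (simp add: algebra_simps)
  have "(\<integral>\<^sup>+y. ennreal (F y) \<partial>sgd_kernel \<phi> a \<mu> \<alpha> x) \<le> (\<integral>\<^sup>+\<theta>. ennreal (q' \<theta>) \<partial>\<mu>)"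
    by (subst nn_integral_sgd_kernel) (use inner in \<open>auto intro!: nn_integral_mono\<close>)
  also have "\<dots> = ennreal (\<integral>\<theta>. q' \<theta> \<partial>\<mu>)"
    using inner by (intro nn_integral_eq_integral q'_int AE_I2) auto
  finally have "ennreal (\<alpha> / 2 * s) + (\<integral>\<^sup>+y. ennreal (F y) \<partial>sgd_kernel \<phi> a \<mu> \<alpha> x)
      \<le> ennreal (\<alpha> / 2 * s) + ennreal (\<integral>\<theta>. q' \<theta> \<partial>\<mu>)"
    by (rule add_left_mono)
  also have "\<dots> = ennreal (\<alpha> / 2 * s + (\<integral>\<theta>. q' \<theta> \<partial>\<mu>))"
    using \<alpha> inner by (intro ennreal_plus[symmetric] integral_nonneg_AE AE_I2) (auto simp: s_def)
  also have "\<dots> \<le> ennreal (F x + D a * \<alpha>\<^sup>2)"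
    by (rule ennreal_leI[OF mean_le])
  finally show ?thesis
    using constants F_nonneg by (simp add: s_def)
qed

text \<open>For each fixed direction the Gaussian part alone makes the law of the step absolutely
  continuous; here \<open>a > 0\<close> is used.\<close>

lemma AE_sgd_kernel:
  assumes P: "AE y in lborel. P y" and a: "a > 0" and \<alpha>: "\<alpha> > 0"
  shows "AE y in sgd_kernel \<phi> a \<mu> \<alpha> x. P y"
proof -
  obtain N where N: "{y. \<not> P y} \<subseteq> N" "N \<in> null_sets lborel"
    using P by (auto elim!: AE_E simp: null_sets_def)
  have [measurable]: "N \<in> sets borel"
    using N by auto
  interpret markov_kernel "sgd_kernel \<phi> a \<mu> \<alpha>" by (rule markov_kernel_sgd)
  have "AE e in gaussian. x - \<alpha> *\<^sub>R \<phi> x \<theta> + (\<alpha> * a) *\<^sub>R e \<notin> N" for \<theta>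
    using a \<alpha> by (intro AE_gaussian_affine AE_not_in N) auto
  then have "(\<integral>\<^sup>+e. indicator N (x - \<alpha> *\<^sub>R \<phi> x \<theta> + (\<alpha> * a) *\<^sub>R e) \<partial>(gaussian :: 'a measure)) = (0::ennreal)" for \<theta>
    by (subst nn_integral_0_iff_AE) (measurable, simp add: indicator_eq_0_iff)
  then have "(\<integral>\<^sup>+y. indicator N y \<partial>sgd_kernel \<phi> a \<mu> \<alpha> x) = 0"
    by (subst nn_integral_sgd_kernel) auto
  then have "N \<in> null_sets (sgd_kernel \<phi> a \<mu> \<alpha> x)"
    by (auto simp: null_sets_def)
  then show ?thesis
    by (rule AE_I') (use N in auto)
qed

text \<open>The drift rate compares \<open>F\<close> with |\<Phi>|^2 through |x|^2:
  \<open>F_le\<close> and \<open>\<Phi>_coercive\<close> give |\<Phi>|^2 at least m F / B - (m + c).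
  The maximum with 0 covers a negative rate. By \<open>F_coercive\<close> the sublevel sets of
  \<open>F\<close> are bounded, so the Gaussian minorization is uniform on them.\<close>

lemma harris_kernel_sgd:
  assumes a: "a > 0" and \<alpha>: "0 < \<alpha>" "\<alpha> \<le> \<alpha>\<^sub>1"
  shows "harris_kernel (sgd_kernel \<phi> a \<mu> \<alpha>) F (max 0 (1 - \<alpha> * m / (2 * B))) (\<alpha> / 2 * (m + c) + D a * \<alpha>\<^sup>2)"
proof (intro harris_kernel.intro harris_kernel_axioms.intro markov_kernel_sgd)
  fix x :: 'a and R :: real
  let ?P = "\<integral>\<^sup>+y. ennreal (F y) \<partial>sgd_kernel \<phi> a \<mu> \<alpha> x"
  have "F x / B \<le> 1 + (norm x)\<^sup>2"
    using F_le[of x] pos by (simp add: field_simps)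
  then have "m * (F x / B) \<le> m * (1 + (norm x)\<^sup>2)"
    using pos by (intro mult_left_mono) auto
  then have "m * (F x / B) - (m + c) \<le> (norm (\<Phi> x))\<^sup>2"
    using \<Phi>_coercive[of x] by (simp add: algebra_simps)
  then have low: "\<alpha> / 2 * (m * (F x / B) - (m + c)) \<le> \<alpha> / 2 * (norm (\<Phi> x))\<^sup>2"
    using \<alpha> by (intro mult_left_mono) auto
  have dec: "ennreal (\<alpha> / 2 * (norm (\<Phi> x))\<^sup>2) + ?P \<le> ennreal (F x + D a * \<alpha>\<^sup>2)"
    using expected_decrease[OF \<alpha>, of x a] constants F_nonneg by simp
  then have "?P \<le> ennreal (F x + D a * \<alpha>\<^sup>2)"
    by (rule order_trans[rotated]) (simp add: add_increasing)
  then obtain r where r: "?P = ennreal r" "0 \<le> r"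
    by (cases ?P) (auto simp: top_unique)
  have "\<alpha> / 2 * (norm (\<Phi> x))\<^sup>2 + r \<le> F x + D a * \<alpha>\<^sup>2"
    using dec r \<alpha> constants F_nonneg[of x] by (simp flip: ennreal_plus)
  have "r \<le> (1 - \<alpha> * m / (2 * B)) * F x + (\<alpha> / 2 * (m + c) + D a * \<alpha>\<^sup>2)"
  proof -
    have "\<alpha> / 2 * (m * (F x / B) - (m + c)) = \<alpha> * m / (2 * B) * F x - \<alpha> / 2 * (m + c)"
      by (simp add: algebra_simps)
    then show ?thesis
      using low \<open>\<alpha> / 2 * (norm (\<Phi> x))\<^sup>2 + r \<le> F x + D a * \<alpha>\<^sup>2\<close>
      unfolding left_diff_distrib mult_1_left by linarith
  qed
  also have "\<dots> \<le> max 0 (1 - \<alpha> * m / (2 * B)) * F x + (\<alpha> / 2 * (m + c) + D a * \<alpha>\<^sup>2)"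
    using F_nonneg by (intro add_right_mono mult_right_mono) auto
  finally show "?P \<le> ennreal (max 0 (1 - \<alpha> * m / (2 * B)) * F x + (\<alpha> / 2 * (m + c) + D a * \<alpha>\<^sup>2))"
    unfolding r by (rule ennreal_leI)
  \<comment> \<open>A radius for the sublevel set at level \<open>R\<close>; the absolute value
    admits levels below \<open>- c\<close>, where that set is empty. The radius required of
    \<open>\<kappa>\<close> next bounds a noiseless step from this set.\<close>
  define \<rho> where "\<rho> = sqrt (\<bar>R + c\<bar> / m)"
  obtain \<kappa> where \<kappa>: "\<kappa> > 0"
    "\<And>b (g :: 'a \<Rightarrow> ennreal). norm b \<le> \<rho> + \<alpha> * (B * (1 + \<rho>)) \<Longrightarrow> g \<in> borel_measurable borel \<Longrightarrow>
       ennreal \<kappa> * (\<integral>\<^sup>+y. g y \<partial>uniform_measure lborel (ball 0 1)) \<le> (\<integral>\<^sup>+e. g (b + (\<alpha> * a) *\<^sub>R e) \<partial>gaussian)"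
    using gaussian_affine_minorization[where 'a='a and s="\<alpha> * a"] a \<alpha> by (metis mult_pos_pos)
  have ball: "emeasure lborel (ball (0::'a) 1) \<noteq> 0" "emeasure lborel (ball (0::'a) 1) < \<infinity>"
    using content_ball_pos[of 1 "0 :: 'a"] emeasure_bounded_finite[of "ball (0::'a) 1"]
    by (auto simp: measure_def)
  let ?U = "uniform_measure lborel (ball (0::'a) 1)"
  interpret U: prob_space ?U
    using ball by (intro prob_space_uniform_measure) auto
  show "\<exists>\<kappa> M. \<kappa> > 0 \<and> prob_space M \<and> sets M = sets borel \<and> (\<integral>\<^sup>+y. ennreal (F y) \<partial>M) < \<infinity> \<and>
      (\<forall>x g. F x \<le> R \<longrightarrow> g \<in> borel_measurable borel \<longrightarrow>
        ennreal \<kappa> * (\<integral>\<^sup>+y. g y \<partial>M) \<le> (\<integral>\<^sup>+y. g y \<partial>sgd_kernel \<phi> a \<mu> \<alpha> x))"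
  proof (intro exI[of _ \<kappa>] exI[of _ ?U] conjI allI impI \<kappa>(1))
    show "prob_space ?U" by (rule U.prob_space_axioms)
    have "AE y in ?U. y \<in> ball 0 1"
      using ball by (intro AE_uniform_measureI) auto
    then have "(\<integral>\<^sup>+y. ennreal (F y) \<partial>?U) \<le> (\<integral>\<^sup>+y. ennreal (B * 2) \<partial>?U)"
    proof (intro nn_integral_mono_AE, eventually_elim)
      fix y :: 'a assume "y \<in> ball 0 1"
      then have "(norm y)\<^sup>2 \<le> 1"
        by (simp add: power_le_one)
      then have "B * (1 + (norm y)\<^sup>2) \<le> B * 2"
        using pos by (intro mult_left_mono) auto
      then show "ennreal (F y) \<le> ennreal (B * 2)"
        using F_le[of y] by (intro ennreal_leI) simp
    qed
    also have "\<dots> < \<infinity>"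
      using U.emeasure_space_1 by (simp add: ennreal_mult_less_top)
    finally show "(\<integral>\<^sup>+y. ennreal (F y) \<partial>?U) < \<infinity>" .
    fix x :: 'a and g :: "'a \<Rightarrow> ennreal"
    assume x: "F x \<le> R" and g [measurable]: "g \<in> borel_measurable borel"
    have "m * (norm x)\<^sup>2 \<le> \<bar>R + c\<bar>"
      using F_coercive[of x] x by simp
    then have "(norm x)\<^sup>2 \<le> \<bar>R + c\<bar> / m"
      using pos by (simp add: field_simps)
    then have "norm x \<le> \<rho>"
      unfolding \<rho>_def by (rule real_le_rsqrt)
    have "norm (x - \<alpha> *\<^sub>R \<phi> x \<theta>) \<le> \<rho> + \<alpha> * (B * (1 + \<rho>))" if \<theta>: "\<theta> \<in> space \<mu>" for \<theta>
    proof -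
      have "norm (x - \<alpha> *\<^sub>R \<phi> x \<theta>) \<le> norm x + \<alpha> * norm (\<phi> x \<theta>)"
        using norm_triangle_ineq4[of x "\<alpha> *\<^sub>R \<phi> x \<theta>"] \<alpha> by simp
      also have "\<dots> \<le> norm x + \<alpha> * (B * (1 + norm x))"
        using \<alpha> growth[OF \<theta>, of x] by (intro add_left_mono mult_left_mono) auto
      also have "\<dots> \<le> \<rho> + \<alpha> * (B * (1 + \<rho>))"
        using \<alpha> pos \<open>norm x \<le> \<rho>\<close> by (intro add_mono mult_left_mono) auto
      finally show ?thesis .
    qed
    then have "(\<integral>\<^sup>+\<theta>. ennreal \<kappa> * (\<integral>\<^sup>+y. g y \<partial>?U) \<partial>\<mu>) \<le> (\<integral>\<^sup>+y. g y \<partial>sgd_kernel \<phi> a \<mu> \<alpha> x)"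
      unfolding nn_integral_sgd_kernel[OF g] by (intro nn_integral_mono \<kappa>(2)[OF _ g])
    then show "ennreal \<kappa> * (\<integral>\<^sup>+y. g y \<partial>?U) \<le> (\<integral>\<^sup>+y. g y \<partial>sgd_kernel \<phi> a \<mu> \<alpha> x)"
      by (simp add: emeasure_space_1)
  qed auto
qed (use constants pos \<alpha> F_nonneg in \<open>auto simp: less_max_iff_disj\<close>)

theorem noised_sgd_near_critical:
  fixes \<nu> :: "'a measure"
  assumes a: "a > 0" and \<epsilon>: "\<epsilon> > 0" and \<nu>: "prob_space \<nu>" "sets \<nu> = sets borel"
  shows "((\<lambda>\<alpha>. limsup (\<lambda>t. emeasure (sample_measure \<nu> \<mu> gaussian)
            {\<omega> \<in> space (sample_measure \<nu> \<mu> gaussian).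
               set_distance (noised_sgd \<phi> a \<alpha> \<omega> t) (clarke_critical F) > ereal \<epsilon>}))
          \<longlongrightarrow> 0) (at 0 within {0<..\<alpha>\<^sub>0})"
proof -
  obtain \<delta> where \<delta>: "\<delta> > 0" and far: "\<And>x. GDERIV F x :> \<Phi> x \<Longrightarrow>
      ereal \<epsilon> < set_distance x (clarke_critical F) \<Longrightarrow> \<delta> \<le> norm (\<Phi> x)"
    using gradient_bounded_below_far_from_critical[OF \<epsilon>] by metis
  define A where "A = {x. ereal \<epsilon> < set_distance x (clarke_critical F)}"
  have A [measurable]: "A \<in> sets borel"
    unfolding A_def by (rule set_distance_superlevel_measurable)
  have bound: "limsup (\<lambda>t. emeasure (sample_measure \<nu> \<mu> gaussian)
      {\<omega> \<in> space (sample_measure \<nu> \<mu> gaussian).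
         set_distance (noised_sgd \<phi> a \<alpha> \<omega> t) (clarke_critical F) > ereal \<epsilon>})
      \<le> ennreal (2 * D a / \<delta>\<^sup>2 * \<alpha>)" if \<alpha>: "0 < \<alpha>" "\<alpha> \<le> \<alpha>\<^sub>1" for \<alpha>
  proof -
    interpret harris_kernel "sgd_kernel \<phi> a \<mu> \<alpha>" F "max 0 (1 - \<alpha> * m / (2 * B))" "\<alpha> / 2 * (m + c) + D a * \<alpha>\<^sup>2"
      by (rule harris_kernel_sgd[OF a \<alpha>])
    \<comment> \<open>As \<open>far\<close> speaks of points of differentiability only, the
      inequality is available after one noisy step, through \<open>AE_sgd_kernel\<close>.\<close>
    have "AE y in sgd_kernel \<phi> a \<mu> \<alpha> x. indicator A y \<le> ennreal (2 / (\<alpha> * \<delta>\<^sup>2)) * ennreal (\<alpha> / 2 * (norm (\<Phi> y))\<^sup>2)" for x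
      using AE_sgd_kernel[OF AE_gradient a \<alpha>(1)]
    proof eventually_elim
      case (elim y)
      show ?case
      proof (cases "y \<in> A")
        case True
        then have "\<delta>\<^sup>2 \<le> (norm (\<Phi> y))\<^sup>2"
          using far[OF elim] \<delta> by (intro power_mono) (auto simp: A_def)
        then have "1 \<le> 2 / (\<alpha> * \<delta>\<^sup>2) * (\<alpha> / 2 * (norm (\<Phi> y))\<^sup>2)"
          using \<alpha> \<delta> by (simp add: field_simps)
        then have "ennreal 1 \<le> ennreal (2 / (\<alpha> * \<delta>\<^sup>2) * (\<alpha> / 2 * (norm (\<Phi> y))\<^sup>2))"
          by (rule ennreal_leI)
        then show ?thesis
          using True \<alpha> \<delta> by (subst (asm) ennreal_mult) auto
      qed simp
    qed
    then have "limsup (\<lambda>t. \<integral>\<^sup>+x. kernel_iter (sgd_kernel \<phi> a \<mu> \<alpha>) t (indicator A) x \<partial>\<nu>)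
        \<le> ennreal (2 / (\<alpha> * \<delta>\<^sup>2) * (D a * \<alpha>\<^sup>2))"
      using \<alpha> \<delta> constants expected_decrease[OF \<alpha>] \<nu>
      by (intro limsup_integral_kernel_iter_le[where h = "\<lambda>y. ennreal (\<alpha> / 2 * (norm (\<Phi> y))\<^sup>2)"]) auto
    also have "2 / (\<alpha> * \<delta>\<^sup>2) * (D a * \<alpha>\<^sup>2) = 2 * D a / \<delta>\<^sup>2 * \<alpha>"
      using \<alpha> by (simp add: power2_eq_square)
    finally show ?thesis
      using emeasure_noised_sgd[OF \<nu>(2) A, of a \<alpha>] by (simp add: A_def)
  qed
  have lim: "((\<lambda>\<alpha>. ennreal (2 * D a / \<delta>\<^sup>2 * \<alpha>)) \<longlongrightarrow> 0) (at 0 within {0<..\<alpha>\<^sub>0})"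
    by (rule tendsto_ennrealI[where x = 0, simplified]) (rule tendsto_eq_intros refl | simp)+
  show ?thesis
  proof (rule tendsto_sandwich[OF _ _ tendsto_const lim])
    show "\<forall>\<^sub>F \<alpha> in at 0 within {0<..\<alpha>\<^sub>0}. limsup (\<lambda>t. emeasure (sample_measure \<nu> \<mu> gaussian)
        {\<omega> \<in> space (sample_measure \<nu> \<mu> gaussian).
           set_distance (noised_sgd \<phi> a \<alpha> \<omega> t) (clarke_critical F) > ereal \<epsilon>})
        \<le> ennreal (2 * D a / \<delta>\<^sup>2 * \<alpha>)"
      unfolding eventually_at using constants(2)
      by (intro exI[of _ \<alpha>\<^sub>1] conjI ballI impI bound) (auto simp: dist_real_def)
  qed auto
qed

end

section \<open>Uniqueness of sorting and nondegenerate directions\<close>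

text \<open>Semiconcavity at \<open>x\<close> gives the upper estimate, semiconcavity at
  \<open>x + h\<close> the lower one. They differ by the increment of \<open>\<Phi>\<close> times
  |h|, up to a quadratic term, and continuity makes this o(|h|).\<close>

lemma semiconcave_imp_gradient:
  fixes F :: "'a::real_inner \<Rightarrow> real"
  assumes semi: "\<And>x y. F y \<le> F x + \<Phi> x \<bullet> (y - x) + L * (norm (y - x))\<^sup>2"
    and L: "0 \<le> L" and cont: "isCont \<Phi> x"
  shows "GDERIV F x :> \<Phi> x"
  unfolding gderiv_def has_derivative_at
proof
  show "bounded_linear (\<lambda>h. h \<bullet> \<Phi> x)"
    by (rule bounded_linear_inner_left)
  have bound: "norm (F (x + h) - F x - h \<bullet> \<Phi> x) / norm h \<le> norm (\<Phi> (x + h) - \<Phi> x) + L * norm h" for h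
  proof (cases "h = 0")
    case False
    have up: "F (x + h) - F x - h \<bullet> \<Phi> x \<le> L * (norm h)\<^sup>2"
      using semi[of "x + h" x] by (simp add: inner_commute)
    have "F x - F (x + h) + h \<bullet> \<Phi> x \<le> (\<Phi> x - \<Phi> (x + h)) \<bullet> h + L * (norm h)\<^sup>2"
      using semi[of x "x + h"] by (simp add: inner_commute inner_diff_left algebra_simps)
    also have "(\<Phi> x - \<Phi> (x + h)) \<bullet> h \<le> norm (\<Phi> (x + h) - \<Phi> x) * norm h"
      using norm_cauchy_schwarz[of "\<Phi> x - \<Phi> (x + h)" h] by (simp add: norm_minus_commute)
    finally have "\<bar>F (x + h) - F x - h \<bullet> \<Phi> x\<bar> \<le> norm (\<Phi> (x + h) - \<Phi> x) * norm h + L * (norm h)\<^sup>2"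
      using up by (simp add: abs_le_iff add_increasing)
    also have "\<dots> = (norm (\<Phi> (x + h) - \<Phi> x) + L * norm h) * norm h"
      by (simp add: power2_eq_square algebra_simps)
    finally show ?thesis
      using False by (simp add: pos_divide_le_eq)
  qed (use L in simp)
  show "(\<lambda>h. norm (F (x + h) - F x - h \<bullet> \<Phi> x) / norm h) \<midarrow>0\<rightarrow> 0"
  proof (rule tendsto_sandwich[OF _ _ tendsto_const])
    have "(\<lambda>h. \<Phi> (x + h)) \<midarrow>0\<rightarrow> \<Phi> x"
      using cont by (simp add: isCont_iff)
    then show "(\<lambda>h. norm (\<Phi> (x + h) - \<Phi> x) + L * norm h) \<midarrow>0\<rightarrow> 0"
      by (auto intro!: tendsto_eq_intros)
  qed (use bound in auto)
qed

text \<open>An element is determined by the number of smaller elements, and \<open>\<pi>\<close>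
  preserves this number.\<close>

lemma strict_mono_bij_finite_id:
  fixes \<pi> :: "'n::{finite,linorder} \<Rightarrow> 'n"
  assumes mono: "strict_mono \<pi>" and bij: "bij \<pi>"
  shows "\<pi> i = i"
proof -
  have "\<pi> ` {..<i} = {..<\<pi> i}"
  proof (intro equalityI subsetI)
    fix x assume "x \<in> {..<\<pi> i}"
    moreover obtain y where "x = \<pi> y"
      using bij by (auto simp: bij_def elim: surjE)
    ultimately show "x \<in> \<pi> ` {..<i}"
      using strict_mono_less[OF mono] by auto
  qed (auto simp: strict_mono_less[OF mono])
  then have "card {..<\<pi> i} = card {..<i}"
    using card_image[of \<pi> "{..<i}"] inj_on_subset[OF bij_is_inj[OF bij]] by simp
  moreover have "card {..<j} < card {..<k}" if "j < k" for j k :: 'n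
    using that by (intro psubset_card_mono) auto
  ultimately show ?thesis
    using less_irrefl linorder_cases[of "\<pi> i" i] by metis
qed

text \<open>As there are no ties, \<open>inv \<sigma> \<circ> \<rho>\<close> is strictly increasing,
  hence the identity.\<close>

lemma sorting_permutation_unique:
  fixes y :: "'n::{finite,linorder} \<Rightarrow> real" and \<sigma> \<rho> :: "'n \<Rightarrow> 'n"
  assumes y: "inj y" and \<sigma>: "bij \<sigma>" "mono (\<lambda>i. y (\<sigma> i))" and \<rho>: "bij \<rho>" "mono (\<lambda>i. y (\<rho> i))"
  shows "\<rho> = \<sigma>"
proof
  fix i :: 'n
  define \<pi> where "\<pi> = inv \<sigma> \<circ> \<rho>"
  have \<rho>\<pi>: "\<rho> i = \<sigma> (\<pi> i)" for i
    using \<sigma> by (simp add: \<pi>_def bij_def surj_f_inv_f)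
  have bij: "bij \<pi>"
    using \<sigma> \<rho> by (simp add: \<pi>_def bij_comp bij_imp_bij_inv)
  have "strict_mono \<pi>"
  proof (rule strict_monoI)
    fix i j :: 'n assume "i < j"
    then have "y (\<sigma> (\<pi> i)) \<le> y (\<sigma> (\<pi> j))" "\<pi> i \<noteq> \<pi> j"
      using monoD[OF \<rho>(2), of i j] bij by (auto simp: \<rho>\<pi> bij_def inj_eq)
    moreover have "y (\<sigma> (\<pi> j)) \<noteq> y (\<sigma> (\<pi> i))"
      using calculation(2) y \<sigma> by (auto simp: bij_def inj_eq)
    ultimately show "\<pi> i < \<pi> j"
      using monoD[OF \<sigma>(2), of "\<pi> j" "\<pi> i"] by (meson antisym not_le)
  qed
  then show "\<rho> i = \<sigma> i"
    using strict_mono_bij_finite_id[OF _ bij] by (simp add: \<rho>\<pi>)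
qed

text \<open>The finitely many strict inequalities between projected rows persist near
  \<open>Y\<close>, so a permutation sorting \<open>X i\<close> also sorts \<open>Y\<close>; without
  ties there is only one.\<close>

lemma eventually_sorting_eq:
  fixes Y :: "real ^ 'd ^ 'n::{finite,linorder}"
  assumes \<tau>: "sorting_selection \<tau>" and \<theta>: "\<theta> \<in> sphere 0 1"
    and inj: "inj (\<lambda>k. \<theta> \<bullet> Y $ k)" and X: "X \<longlonglongrightarrow> Y"
  shows "\<forall>\<^sub>F i in sequentially. \<tau> (X i) \<theta> = \<tau> Y \<theta>"
proof -
  have sort: "bij (\<tau> X \<theta>)" "mono (\<lambda>i. \<theta> \<bullet> X $ \<tau> X \<theta> i)" for X
    using \<tau> \<theta> by (auto simp: sorting_selection_def)
  have "\<forall>\<^sub>F i in sequentially. \<theta> \<bullet> Y $ k < \<theta> \<bullet> Y $ l \<longrightarrow> \<theta> \<bullet> X i $ k < \<theta> \<bullet> X i $ l" for k l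
  proof (cases "\<theta> \<bullet> Y $ k < \<theta> \<bullet> Y $ l")
    case True
    have "(\<lambda>i. \<theta> \<bullet> X i $ l - \<theta> \<bullet> X i $ k) \<longlonglongrightarrow> \<theta> \<bullet> Y $ l - \<theta> \<bullet> Y $ k"
      by (intro tendsto_intros X)
    then have "\<forall>\<^sub>F i in sequentially. 0 < \<theta> \<bullet> X i $ l - \<theta> \<bullet> X i $ k"
      by (rule order_tendstoD) (use True in simp)
    then show ?thesis
      by eventually_elim simp
  qed simp
  then have "\<forall>\<^sub>F i in sequentially. \<forall>k l. \<theta> \<bullet> Y $ k < \<theta> \<bullet> Y $ l \<longrightarrow> \<theta> \<bullet> X i $ k < \<theta> \<bullet> X i $ l"
    by (intro eventually_all_finite)
  then show ?thesis
  proof eventually_elim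
    case (elim i)
    show ?case
    proof (rule sorting_permutation_unique[OF inj])
      show "mono (\<lambda>j. \<theta> \<bullet> Y $ \<tau> (X i) \<theta> j)"
      proof (rule monoI, rule ccontr)
        fix j k :: 'n assume "j \<le> k" "\<not> \<theta> \<bullet> Y $ \<tau> (X i) \<theta> j \<le> \<theta> \<bullet> Y $ \<tau> (X i) \<theta> k"
        then show False
          using elim monoD[OF sort(2)[of "X i"] \<open>j \<le> k\<close>] by (simp add: not_le) (meson leD)
      qed
    qed (rule sort)+
  qed
qed

section \<open>Row norms, and nondegeneracy of the two laws of directions\<close>

lemma norm_vec_le_sum: "norm (x :: 'a::real_normed_vector ^ 'n) \<le> (\<Sum>k\<in>UNIV. norm (x $ k))"
  unfolding norm_vec_def by (rule L2_set_le_sum) simp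

lemma norm_vec_power2: "(norm (x :: 'a::real_normed_vector ^ 'n))\<^sup>2 = (\<Sum>k\<in>UNIV. (norm (x $ k))\<^sup>2)"
  unfolding norm_vec_def L2_set_def by (simp add: sum_nonneg)

lemma inner_sphere_le: "\<theta> \<in> sphere 0 1 \<Longrightarrow> \<bar>\<theta> \<bullet> v\<bar> \<le> norm v"
  using Cauchy_Schwarz_ineq2[of \<theta> v] by simp

lemma AE_lborel_hyperplane:
  fixes v :: "'a::euclidean_space"
  assumes "v \<noteq> 0"
  shows "AE x in lborel. v \<bullet> x \<noteq> 0"
proof -
  have "AE x in lebesgue. v \<bullet> x \<noteq> 0"
    unfolding eventually_ae_filter_negligible
    using negligible_hyperplane[of v 0] assms by auto
  then show ?thesis
    by (simp add: AE_completion_iff)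
qed

lemma sets_uniform_sphere: "sets uniform_sphere = sets sphere_borel"
  unfolding uniform_sphere_def by (rule sets_restrict_space_cong) simp

text \<open>Pulled back to the ball, the event is contained in a hyperplane, which is Lebesgue null;
  so is the origin, the only point that \<open>sgn\<close> sends off the sphere.\<close>

lemma uniform_sphere_nondegenerate:
  fixes v :: "'a::euclidean_space"
  assumes "v \<noteq> 0"
  shows "\<not> (AE \<theta> in uniform_sphere. \<theta> \<bullet> v = 0)"
proof
  let ?U = "uniform_measure lborel (ball (0::'a) 1)"
  have ball: "emeasure lborel (ball (0::'a) 1) \<noteq> 0" "emeasure lborel (ball (0::'a) 1) < \<infinity>"
    using content_ball_pos[of 1 "0 :: 'a"] emeasure_bounded_finite[of "ball (0::'a) 1"]
    by (auto simp: measure_def)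
  interpret U: prob_space ?U
    using ball by (intro prob_space_uniform_measure) auto
  have sgn: "(sgn :: 'a \<Rightarrow> 'a) \<in> measurable ?U borel"
    by (simp add: sgn_div_norm[abs_def] uniform_measure_def)
  have abs: "AE x in ?U. P x" if "AE x in lborel. P x" for P
    using that ball by (subst AE_uniform_measure) (auto elim!: eventually_mono)
  assume "AE \<theta> in uniform_sphere. \<theta> \<bullet> v = 0"
  then have "AE x in ?U. sgn x \<in> sphere 0 1 \<longrightarrow> sgn x \<bullet> v = 0"
    unfolding uniform_sphere_def
    by (subst (asm) AE_restrict_space_iff, simp, subst (asm) AE_distr_iff[OF sgn]) auto
  moreover have "AE x in ?U. v \<bullet> x \<noteq> 0"
    by (intro abs AE_lborel_hyperplane assms)
  ultimately have "AE x in ?U. False"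
  proof eventually_elim
    case (elim x)
    then have "x \<noteq> 0"
      by auto
    then have "sgn x \<bullet> v = 0"
      using elim by (simp add: norm_sgn)
    then show ?case
      using elim \<open>x \<noteq> 0\<close> by (simp add: sgn_div_norm inner_commute)
  qed
  then show False
    by simp
qed

lemma discrete_directions_measurable:
  assumes "\<theta>s ` {1..p} \<subseteq> sphere 0 1"
  shows "\<theta>s \<in> uniform_count_measure {1..p} \<rightarrow>\<^sub>M sphere_borel"
  using assms by (auto simp: measurable_def space_restrict_space sets_uniform_count_measure space_uniform_count_measure)

lemma prob_space_discrete_directions:
  assumes "p \<ge> 1" "\<theta>s ` {1..p} \<subseteq> sphere 0 1"
  shows "prob_space (discrete_directions p \<theta>s)"
  unfolding discrete_directions_def using assms
  by (intro prob_space.prob_space_distr prob_space_uniform_count_measure discrete_directions_measurable) auto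

text \<open>Each direction has positive mass, so \<open>v\<close> would be orthogonal to their span
  and hence to itself.\<close>

lemma discrete_directions_nondegenerate:
  fixes v :: "'a::euclidean_space"
  assumes p: "p \<ge> 1" "\<theta>s ` {1..p} \<subseteq> sphere 0 1" "span (\<theta>s ` {1..p}) = UNIV" and v: "v \<noteq> 0"
  shows "\<not> (AE \<theta> in discrete_directions p \<theta>s. \<theta> \<bullet> v = 0)"
proof
  assume "AE \<theta> in discrete_directions p \<theta>s. \<theta> \<bullet> v = 0"
  then have "AE i in uniform_count_measure {1..p}. \<theta>s i \<bullet> v = 0"
    unfolding discrete_directions_def by (rule AE_distrD[OF discrete_directions_measurable[OF p(2)]])
  then have "\<forall>i\<in>{1..p}. \<theta>s i \<bullet> v = 0"
    using p(1) unfolding uniform_count_measure_def AE_point_measure by simp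
  then have "orthogonal v x" if "x \<in> span (\<theta>s ` {1..p})" for x
    by (intro orthogonal_to_span[OF that]) (auto simp: orthogonal_def inner_commute)
  from this[of v] show False
    using v p(3) by (simp add: orthogonal_def)
qed

section \<open>The sliced Wasserstein energies\<close>

text \<open>Only the nondegeneracy of the law of the directions matters, so both cases are treated at once.\<close>
locale sliced_wasserstein_sgd = prob_space \<mu>
  for \<mu> :: "(real ^ 'd) measure" +
  fixes \<tau> :: "real ^ 'd ^ 'n::{finite,linorder} \<Rightarrow> real ^ 'd \<Rightarrow> 'n \<Rightarrow> 'n" and Z :: "real ^ 'd ^ 'n::{finite,linorder}"
  assumes sets_\<mu> [measurable_cong]: "sets \<mu> = sets sphere_borel"
    and \<tau>: "sorting_selection \<tau>"
    and nondegenerate: "v \<noteq> 0 \<Longrightarrow> \<not> (AE \<theta> in \<mu>. \<theta> \<bullet> v = 0)"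
begin

lemma space_\<mu> [simp]: "space \<mu> = sphere 0 1"
  using sets_eq_imp_space_eq[OF sets_\<mu>] by (simp add: space_restrict_space)

lemma prob_sphere [simp]: "prob (sphere 0 1) = 1"
  using prob_space by simp

lemma measurable_id_\<mu> [measurable]: "(\<lambda>\<theta>. \<theta>) \<in> \<mu> \<rightarrow>\<^sub>M borel"
  by (simp add: measurable_cong_sets[OF sets_\<mu> refl] measurable_restrict_space1)

text \<open>The second-moment form of \<open>\<mu>\<close> is continuous, and positive off 0 by
  nondegeneracy, so it has a positive minimum on the compact unit sphere; homogeneity does the
  rest.\<close>

lemma exists_coercivity_constant:
  obtains \<kappa> where "\<kappa> > 0" "\<And>v. \<kappa> * (norm v)\<^sup>2 \<le> (\<integral>\<theta>. (\<theta> \<bullet> v)\<^sup>2 \<partial>\<mu>)"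
proof -
  define M where "M v = (\<integral>\<theta>. (\<theta> \<bullet> v)\<^sup>2 \<partial>\<mu>)" for v
  have sq: "(\<theta> \<bullet> v)\<^sup>2 \<le> (norm v)\<^sup>2" if "\<theta> \<in> sphere 0 1" for \<theta> v :: "real ^ 'd"
    using inner_sphere_le[OF that, of v] by (simp add: abs_le_square_iff[symmetric])
  have int: "integrable \<mu> (\<lambda>\<theta>. (\<theta> \<bullet> v)\<^sup>2)" for v
    by (rule integrable_const_bound[where B = "(norm v)\<^sup>2"]) (auto intro!: AE_I2 sq)
  have M_pos: "0 < M v" if "v \<noteq> 0" for v
  proof -
    have "M v \<noteq> 0"
      using nondegenerate[OF that] by (simp add: M_def integral_nonneg_eq_0_iff_AE[OF int])
    then show ?thesis
      by (simp add: M_def less_le)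
  qed
  have M_diff: "\<bar>M v - M w\<bar> \<le> norm (v - w) * norm (v + w)" for v w
  proof -
    have "M v - M w = (\<integral>\<theta>. (\<theta> \<bullet> v)\<^sup>2 - (\<theta> \<bullet> w)\<^sup>2 \<partial>\<mu>)"
      by (simp add: M_def int)
    also have "\<dots> = (\<integral>\<theta>. (\<theta> \<bullet> (v - w)) * (\<theta> \<bullet> (v + w)) \<partial>\<mu>)"
      by (simp add: power2_eq_square inner_add_right inner_diff_right algebra_simps)
    also have "norm \<dots> \<le> (\<integral>\<theta>. norm (v - w) * norm (v + w) \<partial>\<mu>)"
    proof (rule Bochner_Integration.integral_norm_bound_integral)
      show "norm ((\<theta> \<bullet> (v - w)) * (\<theta> \<bullet> (v + w))) \<le> norm (v - w) * norm (v + w)" if "\<theta> \<in> space \<mu>" for \<theta>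
        using that unfolding real_norm_def abs_mult by (intro mult_mono inner_sphere_le) auto
      then show "integrable \<mu> (\<lambda>\<theta>. (\<theta> \<bullet> (v - w)) * (\<theta> \<bullet> (v + w)))"
        by (intro integrable_const_bound[where B = "norm (v - w) * norm (v + w)"] AE_I2) auto
    qed simp
    finally show ?thesis
      by (simp add: prob_space)
  qed
  have "continuous_on (sphere 0 1) M"
  proof (rule continuous_at_imp_continuous_on, intro ballI)
    fix v :: "real ^ 'd"
    have "(\<lambda>w. M w - M v) \<midarrow>v\<rightarrow> 0"
    proof (rule tendsto_rabs_zero_cancel, rule tendsto_sandwich[OF _ _ tendsto_const])
      show "(\<lambda>w. norm (w - v) * norm (w + v)) \<midarrow>v\<rightarrow> 0"
        by (rule tendsto_eq_intros refl)+ simp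
    qed (auto simp: M_diff)
    then show "isCont M v"
      by (simp add: isCont_def LIM_zero_iff)
  qed
  then obtain u where u: "u \<in> sphere 0 1" "\<And>v. v \<in> sphere 0 1 \<Longrightarrow> M u \<le> M v"
    using continuous_attains_inf[of "sphere 0 1" M] by auto
  show thesis
  proof (rule that)
    show "M u > 0"
      using u(1) by (intro M_pos) auto
    show "M u * (norm v)\<^sup>2 \<le> (\<integral>\<theta>. (\<theta> \<bullet> v)\<^sup>2 \<partial>\<mu>)" for v
    proof (cases "v = 0")
      case False
      then have "M u \<le> M (sgn v)"
        by (intro u(2)) (simp add: norm_sgn)
      moreover have "M v = (norm v)\<^sup>2 * M (sgn v)"
        using False by (simp add: M_def sgn_div_norm power_mult_distrib power_inverse flip: integral_mult_right_zero)
          (simp flip: mult.assoc)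
      ultimately show ?thesis
        unfolding M_def[symmetric] by (simp add: mult.commute mult_right_mono)
    qed simp
  qed
qed

abbreviation "\<phi> \<equiv> sw_grad \<tau> Z"
abbreviation "\<Phi> Y \<equiv> \<integral>\<theta>. \<phi> Y \<theta> \<partial>\<mu>"
abbreviation "F Y \<equiv> \<integral>\<theta>. proj_w Z \<theta> Y \<partial>\<mu>"
abbreviation "match Y \<theta> \<equiv> \<tau> Z \<theta> \<circ> inv (\<tau> Y \<theta>)"

lemma bij_match: "\<theta> \<in> sphere 0 1 \<Longrightarrow> bij (match Y \<theta>)"
  using \<tau> by (auto simp: sorting_selection_def intro!: bij_comp bij_imp_bij_inv)

text \<open>There are finitely many values of \<open>\<tau>\<close>, so measurability can be checked
  with the permutation frozen.\<close>

lemma match_measurable: "(\<lambda>(Y, \<theta>). match Y \<theta>) \<in> borel \<Otimes>\<^sub>M \<mu> \<rightarrow>\<^sub>M count_space UNIV"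
proof -
  have \<tau>_meas: "case_prod \<tau> \<in> borel \<Otimes>\<^sub>M \<mu> \<rightarrow>\<^sub>M count_space UNIV"
    using \<tau> by (simp add: sorting_selection_def measurable_cong_sets[OF sets_pair_measure_cong[OF refl sets_\<mu>] refl])
  have [measurable]: "(\<lambda>p. \<tau> (fst p) (snd p)) \<in> borel \<Otimes>\<^sub>M \<mu> \<rightarrow>\<^sub>M count_space UNIV"
    using \<tau>_meas by (simp add: case_prod_beta')
  have [measurable]: "(\<lambda>p. \<tau> Z (snd p)) \<in> (borel :: (real ^ 'd ^ 'n::{finite,linorder}) measure) \<Otimes>\<^sub>M \<mu> \<rightarrow>\<^sub>M count_space UNIV"
    by (rule measurable_compose[OF _ \<tau>_meas, where f = "\<lambda>p. (Z, snd p)", simplified]) measurable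
  have "(\<lambda>p. \<tau> Z (snd p) \<circ> inv (\<tau> (fst p) (snd p))) \<in> borel \<Otimes>\<^sub>M \<mu> \<rightarrow>\<^sub>M count_space UNIV"
    by (rule measurable_compose_countable[where f = "\<lambda>\<rho> p. \<tau> Z (snd p) \<circ> inv \<rho>" and g = "\<lambda>p. \<tau> (fst p) (snd p)"])
       measurable
  then show ?thesis
    by (simp add: case_prod_beta')
qed

lemma residual_measurable [measurable]:
  "(\<lambda>(Y, \<theta>). \<theta> \<bullet> (Y $ k - Z $ match Y \<theta> k)) \<in> borel_measurable (borel \<Otimes>\<^sub>M \<mu>)"
proof -
  have [measurable]: "(\<lambda>x :: real ^ 'd ^ 'n::{finite,linorder}. x $ k) \<in> borel \<rightarrow>\<^sub>M borel"
    by (intro borel_measurable_continuous_onI continuous_intros)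
  have [measurable]: "(\<lambda>p :: (real ^ 'd ^ 'n::{finite,linorder}) \<times> _. fst p $ k) \<in> borel \<Otimes>\<^sub>M \<mu> \<rightarrow>\<^sub>M borel"
    by measurable
  have [measurable]: "(\<lambda>p. snd p) \<in> (borel :: (real ^ 'd ^ 'n::{finite,linorder}) measure) \<Otimes>\<^sub>M \<mu> \<rightarrow>\<^sub>M borel"
    by (rule measurable_compose[OF measurable_snd measurable_id_\<mu>])
  have "(\<lambda>p. snd p \<bullet> (fst p $ k - Z $ \<rho> k)) \<in> borel_measurable (borel \<Otimes>\<^sub>M \<mu>)" for \<rho> :: "'n \<Rightarrow> 'n"
    by measurable
  moreover have "(\<lambda>p. match (fst p) (snd p)) \<in> borel \<Otimes>\<^sub>M \<mu> \<rightarrow>\<^sub>M count_space UNIV"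
    using match_measurable by (simp add: case_prod_beta')
  ultimately have "(\<lambda>p. snd p \<bullet> (fst p $ k - Z $ match (fst p) (snd p) k)) \<in> borel_measurable (borel \<Otimes>\<^sub>M \<mu>)"
    by (rule measurable_compose_countable)
  then show ?thesis
    by (simp add: case_prod_beta')
qed

lemma \<phi>_nth: "\<phi> Y \<theta> $ k = (2 / real CARD('n) * (\<theta> \<bullet> (Y $ k - Z $ match Y \<theta> k))) *\<^sub>R \<theta>"
  by (simp add: sw_grad_def)

lemma \<phi>_measurable: "case_prod \<phi> \<in> borel \<Otimes>\<^sub>M \<mu> \<rightarrow>\<^sub>M borel"
proof (subst borel_measurable_euclidean_space, intro ballI)
  fix b :: "real ^ 'd ^ 'n::{finite,linorder}" assume "b \<in> Basis"
  then obtain k u where b: "b = axis k u"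
    by (auto simp: Basis_vec_def)
  note [measurable] = residual_measurable[of k, unfolded case_prod_beta']
  have "(\<lambda>p. (2 / real CARD('n) * (snd p \<bullet> (fst p $ k - Z $ match (fst p) (snd p) k))) *\<^sub>R snd p \<bullet> u)
      \<in> borel_measurable (borel \<Otimes>\<^sub>M \<mu>)"
    by measurable
  then show "(\<lambda>p. case_prod \<phi> p \<bullet> b) \<in> borel_measurable (borel \<Otimes>\<^sub>M \<mu>)"
    by (simp add: case_prod_beta' b inner_axis \<phi>_nth)
qed

lemma proj_w_eq:
  "\<theta> \<in> sphere 0 1 \<Longrightarrow> proj_w Z \<theta> Y = (\<Sum>k\<in>UNIV. (\<theta> \<bullet> (Y $ k - Z $ match Y \<theta> k))\<^sup>2) / real CARD('n)"
  by (rule proj_w_sorting[OF \<tau>])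

lemma proj_w_measurable [measurable]: "(\<lambda>\<theta>. proj_w Z \<theta> Y) \<in> borel_measurable \<mu>"
proof -
  have [measurable]: "(\<lambda>\<theta>. \<theta> \<bullet> (Y $ k - Z $ match Y \<theta> k)) \<in> borel_measurable \<mu>" for k
    using measurable_compose[OF measurable_Pair1' residual_measurable, of Y] by simp
  have "(\<lambda>\<theta>. (\<Sum>k\<in>UNIV. (\<theta> \<bullet> (Y $ k - Z $ match Y \<theta> k))\<^sup>2) / real CARD('n)) \<in> borel_measurable \<mu>"
    by measurable
  then show ?thesis
    by (subst measurable_cong) (auto simp: proj_w_eq)
qed

section \<open>Growth and semiconcavity of the energy\<close>

lemma residual_le:
  assumes "\<theta> \<in> sphere 0 1"
  shows "\<bar>\<theta> \<bullet> (Y $ k - Z $ l)\<bar> \<le> norm Y + norm Z"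
proof -
  have "\<bar>\<theta> \<bullet> (Y $ k - Z $ l)\<bar> \<le> norm (Y $ k - Z $ l)"
    by (rule inner_sphere_le[OF assms])
  also have "\<dots> \<le> norm (Y $ k) + norm (Z $ l)"
    by (rule norm_triangle_ineq4)
  finally show ?thesis
    using Finite_Cartesian_Product.norm_nth_le[of Y k] Finite_Cartesian_Product.norm_nth_le[of Z l] by linarith
qed

lemma mean_over_rows_le:
  assumes "\<And>k. f k \<le> (b :: real)"
  shows "(\<Sum>k\<in>(UNIV :: 'n set). f k) / real CARD('n) \<le> b"
  using sum_bounded_above[of UNIV f b] assms by (simp add: divide_le_eq mult.commute)

lemma norm_\<phi>_le:
  assumes \<theta>: "\<theta> \<in> sphere 0 1"
  shows "norm (\<phi> Y \<theta>) \<le> 2 * (norm Y + norm Z)"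
proof -
  have "norm (\<phi> Y \<theta>) \<le> (\<Sum>k\<in>UNIV. 2 * \<bar>\<theta> \<bullet> (Y $ k - Z $ match Y \<theta> k)\<bar>) / real CARD('n)"
    using norm_vec_le_sum[of "\<phi> Y \<theta>"] \<theta> by (simp add: \<phi>_nth abs_mult sum_divide_distrib)
  also have "\<dots> \<le> 2 * (norm Y + norm Z)"
    by (intro mean_over_rows_le mult_left_mono residual_le \<theta>) simp
  finally show ?thesis .
qed

lemma proj_w_le:
  assumes \<theta>: "\<theta> \<in> sphere 0 1"
  shows "proj_w Z \<theta> Y \<le> (norm Y + norm Z)\<^sup>2"
  unfolding proj_w_eq[OF \<theta>] using residual_le[OF \<theta>, of Y]
  by (intro mean_over_rows_le) (metis abs_ge_zero power2_abs power_mono)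

lemma proj_w_nonneg: "0 \<le> proj_w Z \<theta> Y"
  by (simp add: proj_w_def)

lemma proj_w_integrable: "integrable \<mu> (\<lambda>\<theta>. proj_w Z \<theta> Y)"
  by (rule integrable_const_bound[where B = "(norm Y + norm Z)\<^sup>2"]) (auto intro!: AE_I2 proj_w_le simp: proj_w_nonneg)

lemma \<phi>_section_measurable [measurable]: "\<phi> Y \<in> \<mu> \<rightarrow>\<^sub>M borel"
  using measurable_compose[OF measurable_Pair1' \<phi>_measurable, of Y] by simp

lemma \<phi>_integrable: "integrable \<mu> (\<phi> Y)"
proof (rule integrable_const_bound[where B = "2 * (norm Y + norm Z)"])
  show "AE \<theta> in \<mu>. norm (\<phi> Y \<theta>) \<le> 2 * (norm Y + norm Z)"
    by (rule AE_I2, rule norm_\<phi>_le) simp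
qed simp

lemma inner_\<phi>:
  "\<phi> Y \<theta> \<bullet> V = (\<Sum>k\<in>UNIV. 2 * (\<theta> \<bullet> (Y $ k - Z $ match Y \<theta> k)) * (\<theta> \<bullet> V $ k)) / real CARD('n)"
  unfolding inner_vec_def[of "\<phi> Y \<theta>" V] \<phi>_nth inner_scaleR_left by (simp add: sum_divide_distrib)

text \<open>The matching of \<open>Y\<close> is admissible, if perhaps suboptimal, for
  \<open>X\<close>. Expanding its cost around \<open>Y\<close> gives
  \<open>\<phi> Y \<theta>\<close> as the linear part; the quadratic part is a mean over rows of
  terms bounded by the squared norm of \<open>X - Y\<close>.\<close>

lemma proj_w_semiconcave:
  assumes \<theta>: "\<theta> \<in> sphere 0 1"
  shows "proj_w Z \<theta> X \<le> proj_w Z \<theta> Y + \<phi> Y \<theta> \<bullet> (X - Y) + 1 * (norm (X - Y))\<^sup>2"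
proof -
  let ?r = "\<lambda>k. \<theta> \<bullet> (Y $ k - Z $ match Y \<theta> k)"
  have "proj_w Z \<theta> X \<le> (\<Sum>k\<in>UNIV. (\<theta> \<bullet> (X $ k - Z $ match Y \<theta> k))\<^sup>2) / real CARD('n)"
    by (rule proj_w_le_matching[OF bij_match[OF \<theta>]])
  also have "\<dots> = (\<Sum>k\<in>UNIV. (?r k)\<^sup>2 + 2 * ?r k * (\<theta> \<bullet> (X - Y) $ k) + (\<theta> \<bullet> (X - Y) $ k)\<^sup>2) / real CARD('n)"
    by (rule arg_cong[where f = "\<lambda>x. x / _"], rule sum.cong)
       (auto simp: power2_eq_square inner_diff_right algebra_simps)
  also have "\<dots> = proj_w Z \<theta> Y + \<phi> Y \<theta> \<bullet> (X - Y) + (\<Sum>k\<in>UNIV. (\<theta> \<bullet> (X - Y) $ k)\<^sup>2) / real CARD('n)"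
    unfolding proj_w_eq[OF \<theta>] inner_\<phi> by (simp add: sum.distrib add_divide_distrib)
  also have "(\<Sum>k\<in>UNIV. (\<theta> \<bullet> (X - Y) $ k)\<^sup>2) / real CARD('n) \<le> 1 * (norm (X - Y))\<^sup>2"
  proof -
    have "\<bar>\<theta> \<bullet> (X - Y) $ k\<bar> \<le> norm (X - Y)" for k
      using inner_sphere_le[OF \<theta>] Finite_Cartesian_Product.norm_nth_le order_trans by blast
    then show ?thesis
      by (intro mean_over_rows_le) (metis abs_ge_zero mult_1 power2_abs power_mono)
  qed
  finally show ?thesis
    by simp
qed

lemma semiconcave: "F X \<le> F Y + \<Phi> Y \<bullet> (X - Y) + 1 * (norm (X - Y))\<^sup>2"
proof -
  have "F X \<le> (\<integral>\<theta>. proj_w Z \<theta> Y + \<phi> Y \<theta> \<bullet> (X - Y) + 1 * (norm (X - Y))\<^sup>2 \<partial>\<mu>)"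
    by (intro integral_mono proj_w_integrable Bochner_Integration.integrable_add integrable_inner_left
        \<phi>_integrable integrable_const proj_w_semiconcave) auto
  also have "\<dots> = F Y + \<Phi> Y \<bullet> (X - Y) + 1 * (norm (X - Y))\<^sup>2"
    using proj_w_integrable \<phi>_integrable by (simp add: prob_space)
  finally show ?thesis .
qed

text \<open>For a fixed direction, a tie between two rows confines \<open>Y\<close> to the
  hyperplane orthogonal to \<open>axis k \<theta> - axis l \<theta>\<close>. Fubini then exchanges
  the quantifiers, whatever the law of the directions, discrete ones included.\<close>

lemma AE_distinct_projections: "AE Y in lborel. AE \<theta> in \<mu>. inj (\<lambda>k. \<theta> \<bullet> (Y :: real ^ 'd ^ 'n::{finite,linorder}) $ k)"
proof -
  interpret pair_sigma_finite \<mu> "lborel :: (real ^ 'd ^ 'n::{finite,linorder}) measure" ..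
  have [measurable]: "(\<lambda>x :: real ^ 'd ^ 'n::{finite,linorder}. x $ k) \<in> borel \<rightarrow>\<^sub>M borel" for k
    by (intro borel_measurable_continuous_onI continuous_intros)
  have "AE Y in lborel. inj (\<lambda>k. \<theta> \<bullet> (Y :: real ^ 'd ^ 'n::{finite,linorder}) $ k)" if \<theta>: "\<theta> \<in> sphere 0 1" for \<theta>
  proof -
    have "AE Y in lborel. k \<noteq> l \<longrightarrow> \<theta> \<bullet> Y $ k \<noteq> \<theta> \<bullet> (Y :: real ^ 'd ^ 'n::{finite,linorder}) $ l" for k l :: 'n
    proof (cases "k = l")
      case False
      then have "(axis k \<theta> - axis l \<theta>) $ k \<noteq> 0"
        using \<theta> by (auto simp: axis_def)
      then have "axis k \<theta> - axis l \<theta> \<noteq> (0 :: real ^ 'd ^ 'n::{finite,linorder})"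
        by (metis zero_index)
      then have "AE Y in lborel. (axis k \<theta> - axis l \<theta>) \<bullet> (Y :: real ^ 'd ^ 'n::{finite,linorder}) \<noteq> 0"
        by (rule AE_lborel_hyperplane)
      then show ?thesis
        by eventually_elim (simp add: inner_diff_left inner_axis inner_commute[of "axis _ _"] inner_commute[of \<theta>])
    qed simp
    then have "AE Y in lborel. \<forall>k l. k \<noteq> l \<longrightarrow> \<theta> \<bullet> Y $ k \<noteq> \<theta> \<bullet> (Y :: real ^ 'd ^ 'n::{finite,linorder}) $ l"
      by (intro eventually_all_finite)
    then show ?thesis
      by eventually_elim (auto simp: inj_def)
  qed
  then have "AE \<theta> in \<mu>. AE Y in lborel. inj (\<lambda>k. \<theta> \<bullet> (Y :: real ^ 'd ^ 'n::{finite,linorder}) $ k)"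
    by (rule AE_I2) simp
  moreover have "{p \<in> space (\<mu> \<Otimes>\<^sub>M lborel). inj (\<lambda>k. fst p \<bullet> (snd p :: real ^ 'd ^ 'n::{finite,linorder}) $ k)}
      \<in> sets (\<mu> \<Otimes>\<^sub>M lborel)"
  proof -
    have [measurable]: "(\<lambda>p. fst p) \<in> \<mu> \<Otimes>\<^sub>M (lborel :: (real ^ 'd ^ 'n::{finite,linorder}) measure) \<rightarrow>\<^sub>M borel"
      by (rule measurable_compose[OF measurable_fst measurable_id_\<mu>])
    have [measurable]: "(\<lambda>p. snd p $ k) \<in> \<mu> \<Otimes>\<^sub>M (lborel :: (real ^ 'd ^ 'n::{finite,linorder}) measure) \<rightarrow>\<^sub>M borel" for k
      by measurable
    show ?thesis
      unfolding inj_def by measurable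
  qed
  ultimately show ?thesis
    by (subst (asm) AE_commute) simp_all
qed

text \<open>Jumps of \<open>\<phi>\<close> in \<open>Y\<close> come from changes of the matching,
  and for almost every direction the matching is eventually constant along a sequence tending to
  \<open>Y\<close>; dominated convergence concludes.\<close>

lemma isCont_\<Phi>:
  assumes Y: "AE \<theta> in \<mu>. inj (\<lambda>k. \<theta> \<bullet> Y $ k)"
  shows "isCont \<Phi> Y"
  unfolding continuous_at_sequentially
proof (intro allI impI)
  fix X assume X: "X \<longlonglongrightarrow> Y"
  then obtain b where b: "\<And>i. norm (X i) \<le> b"
    using Bseq_def convergentI convergent_imp_Bseq by blast
  have "(\<lambda>i. \<Phi> (X i)) \<longlonglongrightarrow> \<Phi> Y"
  proof (rule integral_dominated_convergence[where w = "\<lambda>_. 2 * (b + norm Z)"])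
    show "AE \<theta> in \<mu>. (\<lambda>i. \<phi> (X i) \<theta>) \<longlonglongrightarrow> \<phi> Y \<theta>"
      using Y AE_space
    proof eventually_elim
      case (elim \<theta>)
      have "\<forall>\<^sub>F i in sequentially. \<tau> (X i) \<theta> = \<tau> Y \<theta>"
        using elim by (intro eventually_sorting_eq[OF \<tau> _ _ X]) auto
      then have ev: "\<forall>\<^sub>F i in sequentially. \<phi> (X i) \<theta> =
          (\<chi> k. (2 / real CARD('n) * (\<theta> \<bullet> (X i $ k - Z $ match Y \<theta> k))) *\<^sub>R \<theta>)"
        by eventually_elim (simp add: vec_eq_iff \<phi>_nth)
      have "(\<lambda>i. (\<chi> k. (2 / real CARD('n) * (\<theta> \<bullet> (X i $ k - Z $ match Y \<theta> k))) *\<^sub>R \<theta>)) \<longlonglongrightarrow>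
          (\<chi> k. (2 / real CARD('n) * (\<theta> \<bullet> (Y $ k - Z $ match Y \<theta> k))) *\<^sub>R \<theta>)"
        by (intro tendsto_intros X)
      also have "(\<chi> k. (2 / real CARD('n) * (\<theta> \<bullet> (Y $ k - Z $ match Y \<theta> k))) *\<^sub>R \<theta>) = \<phi> Y \<theta>"
        by (simp add: vec_eq_iff \<phi>_nth)
      finally show ?case
        using tendsto_cong[OF ev] by simp
    qed
    show "AE \<theta> in \<mu>. norm (\<phi> (X i) \<theta>) \<le> 2 * (b + norm Z)" for i
      using b[of i] by (intro AE_I2 order_trans[OF norm_\<phi>_le]) auto
  qed auto
  then show "(\<Phi> \<circ> X) \<longlonglongrightarrow> \<Phi> Y"
    by (simp add: comp_def)
qed

section \<open>Coercivity of the energy and of its mean gradient\<close>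

lemma sum_second_moments:
  assumes \<kappa>: "\<And>v. \<kappa> * (norm v)\<^sup>2 \<le> (\<integral>\<theta>. (\<theta> \<bullet> v)\<^sup>2 \<partial>\<mu>)"
  shows "\<kappa> * (norm Y)\<^sup>2 \<le> (\<integral>\<theta>. (\<Sum>k\<in>UNIV. (\<theta> \<bullet> Y $ k)\<^sup>2) \<partial>\<mu>)"
    and "integrable \<mu> (\<lambda>\<theta>. \<Sum>k\<in>UNIV. (\<theta> \<bullet> Y $ k)\<^sup>2)"
proof -
  have int: "integrable \<mu> (\<lambda>\<theta>. (\<theta> \<bullet> v)\<^sup>2)" for v
  proof (rule integrable_const_bound[where B = "(norm v)\<^sup>2"])
    show "AE \<theta> in \<mu>. norm ((\<theta> \<bullet> v)\<^sup>2) \<le> (norm v)\<^sup>2"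
      using inner_sphere_le[of _ v] by (intro AE_I2) (simp add: abs_le_square_iff[symmetric])
  qed simp
  show "integrable \<mu> (\<lambda>\<theta>. \<Sum>k\<in>UNIV. (\<theta> \<bullet> Y $ k)\<^sup>2)"
    by (intro Bochner_Integration.integrable_sum int)
  show "\<kappa> * (norm Y)\<^sup>2 \<le> (\<integral>\<theta>. (\<Sum>k\<in>UNIV. (\<theta> \<bullet> Y $ k)\<^sup>2) \<partial>\<mu>)"
    unfolding norm_vec_power2[of Y] using int
    by (simp add: sum_distrib_left Bochner_Integration.integral_sum) (intro sum_mono \<kappa>)
qed

text \<open>With y and z the two projections, these are the nonnegativity of (y - 2 z)^2 and of (y -
  z)^2. The first serves the coercivity of \<open>F\<close>, the second that of
  \<open>\<Phi>\<close>.\<close>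

lemma square_residual_ge:
  assumes \<theta>: "\<theta> \<in> sphere 0 1"
  shows "(\<theta> \<bullet> Y $ k)\<^sup>2 / 2 - (norm Z)\<^sup>2 \<le> (\<theta> \<bullet> (Y $ k - Z $ l))\<^sup>2"
    and "(\<theta> \<bullet> Y $ k)\<^sup>2 - (norm Z)\<^sup>2 \<le> 2 * (\<theta> \<bullet> (Y $ k - Z $ l)) * (\<theta> \<bullet> Y $ k)"
proof -
  have "\<bar>\<theta> \<bullet> Z $ l\<bar> \<le> norm Z"
    using inner_sphere_le[OF \<theta>] Finite_Cartesian_Product.norm_nth_le order_trans by blast
  then have Z: "(\<theta> \<bullet> Z $ l)\<^sup>2 \<le> (norm Z)\<^sup>2"
    by (metis abs_ge_zero power2_abs power_mono)
  show "(\<theta> \<bullet> Y $ k)\<^sup>2 / 2 - (norm Z)\<^sup>2 \<le> (\<theta> \<bullet> (Y $ k - Z $ l))\<^sup>2"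
    using Z zero_le_power2[of "\<theta> \<bullet> Y $ k - 2 * (\<theta> \<bullet> Z $ l)"]
    by (simp add: inner_diff_right power2_eq_square algebra_simps)
  show "(\<theta> \<bullet> Y $ k)\<^sup>2 - (norm Z)\<^sup>2 \<le> 2 * (\<theta> \<bullet> (Y $ k - Z $ l)) * (\<theta> \<bullet> Y $ k)"
    using Z zero_le_power2[of "\<theta> \<bullet> Y $ k - \<theta> \<bullet> Z $ l"]
    by (simp add: inner_diff_right power2_eq_square algebra_simps)
qed

lemma F_coercive:
  assumes \<kappa>: "\<And>v. \<kappa> * (norm v)\<^sup>2 \<le> (\<integral>\<theta>. (\<theta> \<bullet> v)\<^sup>2 \<partial>\<mu>)"
  shows "\<kappa> / (2 * real CARD('n)) * (norm Y)\<^sup>2 \<le> F Y + (norm Z)\<^sup>2"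
proof -
  let ?s = "\<lambda>\<theta>. \<Sum>k\<in>UNIV. (\<theta> \<bullet> Y $ k)\<^sup>2"
  have "\<kappa> / (2 * real CARD('n)) * (norm Y)\<^sup>2 - (norm Z)\<^sup>2 \<le> (\<integral>\<theta>. ?s \<theta> \<partial>\<mu>) / (2 * real CARD('n)) - (norm Z)\<^sup>2"
    using sum_second_moments(1)[OF \<kappa>, of Y] by (simp add: divide_right_mono)
  also have "\<dots> = (\<integral>\<theta>. ?s \<theta> / (2 * real CARD('n)) - (norm Z)\<^sup>2 \<partial>\<mu>)"
    using sum_second_moments(2)[OF \<kappa>, of Y] by (simp add: prob_space)
  also have "\<dots> \<le> F Y"
  proof (intro integral_mono proj_w_integrable)
    show "integrable \<mu> (\<lambda>\<theta>. ?s \<theta> / (2 * real CARD('n)) - (norm Z)\<^sup>2)"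
      using sum_second_moments(2)[OF \<kappa>, of Y] by simp
    fix \<theta> assume "\<theta> \<in> space \<mu>"
    then have \<theta>: "\<theta> \<in> sphere 0 1"
      by simp
    have "?s \<theta> / (2 * real CARD('n)) - (norm Z)\<^sup>2 = (\<Sum>k\<in>UNIV. (\<theta> \<bullet> Y $ k)\<^sup>2 / 2 - (norm Z)\<^sup>2) / real CARD('n)"
      by (simp add: sum_subtractf diff_divide_distrib sum_divide_distrib)
    also have "\<dots> \<le> proj_w Z \<theta> Y"
      unfolding proj_w_eq[OF \<theta>] by (intro divide_right_mono sum_mono square_residual_ge \<theta>) simp
    finally show "?s \<theta> / (2 * real CARD('n)) - (norm Z)\<^sup>2 \<le> proj_w Z \<theta> Y" .
  qed
  finally show ?thesis
    by simp
qed

text \<open>\<open>\<Phi> Y\<close> is tested against \<open>Y\<close> itself. Multiplying by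
  \<open>2 * l\<close> and applying 2 u v \<le> u^2 + v^2 to \<open>norm (\<Phi> Y)\<close> and
  \<open>l * norm Y\<close> leaves half of the quadratic term.\<close>

lemma \<Phi>_coercive:
  assumes \<kappa>_pos: "\<kappa> > 0" and \<kappa>: "\<And>v. \<kappa> * (norm v)\<^sup>2 \<le> (\<integral>\<theta>. (\<theta> \<bullet> v)\<^sup>2 \<partial>\<mu>)"
  shows "(\<kappa> / real CARD('n))\<^sup>2 * (norm Y)\<^sup>2 \<le> (norm (\<Phi> Y))\<^sup>2 + 2 * (\<kappa> / real CARD('n)) * (norm Z)\<^sup>2"
proof -
  let ?s = "\<lambda>\<theta>. \<Sum>k\<in>UNIV. (\<theta> \<bullet> Y $ k)\<^sup>2"
  define l where "l = \<kappa> / real CARD('n)"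
  have l: "l > 0"
    using \<kappa>_pos by (simp add: l_def)
  have "l * (norm Y)\<^sup>2 - (norm Z)\<^sup>2 \<le> (\<integral>\<theta>. ?s \<theta> \<partial>\<mu>) / real CARD('n) - (norm Z)\<^sup>2"
    using sum_second_moments(1)[OF \<kappa>, of Y] by (simp add: divide_right_mono l_def)
  also have "\<dots> = (\<integral>\<theta>. ?s \<theta> / real CARD('n) - (norm Z)\<^sup>2 \<partial>\<mu>)"
    using sum_second_moments(2)[OF \<kappa>, of Y] by (simp add: prob_space)
  also have "\<dots> \<le> (\<integral>\<theta>. \<phi> Y \<theta> \<bullet> Y \<partial>\<mu>)"
  proof (intro integral_mono integrable_inner_left \<phi>_integrable)
    show "integrable \<mu> (\<lambda>\<theta>. ?s \<theta> / real CARD('n) - (norm Z)\<^sup>2)"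
      using sum_second_moments(2)[OF \<kappa>, of Y] by simp
    fix \<theta> assume "\<theta> \<in> space \<mu>"
    then have \<theta>: "\<theta> \<in> sphere 0 1"
      by simp
    have "?s \<theta> / real CARD('n) - (norm Z)\<^sup>2 = (\<Sum>k\<in>UNIV. (\<theta> \<bullet> Y $ k)\<^sup>2 - (norm Z)\<^sup>2) / real CARD('n)"
      by (simp add: sum_subtractf diff_divide_distrib)
    also have "\<dots> \<le> \<phi> Y \<theta> \<bullet> Y"
      unfolding inner_\<phi> by (intro divide_right_mono sum_mono square_residual_ge \<theta>) simp
    finally show "?s \<theta> / real CARD('n) - (norm Z)\<^sup>2 \<le> \<phi> Y \<theta> \<bullet> Y" .
  qed
  also have "\<dots> = \<Phi> Y \<bullet> Y"
    using \<phi>_integrable by simp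
  also have "\<dots> \<le> norm (\<Phi> Y) * norm Y"
    by (rule norm_cauchy_schwarz)
  finally have "l * (norm Y)\<^sup>2 - (norm Z)\<^sup>2 \<le> norm (\<Phi> Y) * norm Y" .
  then have "2 * l * (l * (norm Y)\<^sup>2 - (norm Z)\<^sup>2) \<le> 2 * l * (norm (\<Phi> Y) * norm Y)"
    using l by (intro mult_left_mono) auto
  also have "\<dots> \<le> (norm (\<Phi> Y))\<^sup>2 + l\<^sup>2 * (norm Y)\<^sup>2"
    using zero_le_power2[of "norm (\<Phi> Y) - l * norm Y"] by (simp add: power2_eq_square algebra_simps)
  finally show ?thesis
    unfolding l_def[symmetric] by (simp add: power2_eq_square algebra_simps)
qed

lemma noised_sgd_near_critical:
  assumes "a > 0" "\<epsilon> > 0" "prob_space \<nu>" "sets \<nu> = sets borel"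
  shows "((\<lambda>\<alpha>. limsup (\<lambda>t. emeasure (sample_measure \<nu> \<mu> gaussian)
            {\<omega> \<in> space (sample_measure \<nu> \<mu> gaussian).
               set_distance (noised_sgd \<phi> a \<alpha> \<omega> t) (clarke_critical F) > ereal \<epsilon>}))
          \<longlongrightarrow> 0) (at 0 within {0<..\<alpha>\<^sub>0})"
proof -
  obtain \<kappa> where \<kappa>: "\<kappa> > 0" "\<And>v. \<kappa> * (norm v)\<^sup>2 \<le> (\<integral>\<theta>. (\<theta> \<bullet> v)\<^sup>2 \<partial>\<mu>)"
    using exists_coercivity_constant by blast
  define l where "l = \<kappa> / real CARD('n)"
  have l: "l > 0"
    using \<kappa>(1) by (simp add: l_def)
  \<comment> \<open>\<open>m\<close> and \<open>c\<close> merge the constants of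
    \<open>F_coercive\<close> and \<open>\<Phi>_coercive\<close>; \<open>B\<close> merges the linear
    bound on \<open>\<phi>\<close> with the quadratic bound on \<open>F\<close>.\<close>
  define m where "m = min (l / 2) (l\<^sup>2)"
  define c where "c = max ((norm Z)\<^sup>2) (2 * l * (norm Z)\<^sup>2)"
  define B where "B = max (2 * (1 + norm Z)) (2 + 2 * (norm Z)\<^sup>2)"
  interpret semiconcave_sgd \<mu> \<phi> F \<Phi> 1 B c m
  proof
    show "case_prod \<phi> \<in> borel \<Otimes>\<^sub>M \<mu> \<rightarrow>\<^sub>M borel"
      by (rule \<phi>_measurable)
    show "norm (\<phi> Y \<theta>) \<le> B * (1 + norm Y)" if "\<theta> \<in> space \<mu>" for Y \<theta>
    proof -
      have "norm (\<phi> Y \<theta>) \<le> 2 * (norm Y + norm Z)"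
        using that by (intro norm_\<phi>_le) simp
      also have "\<dots> \<le> 2 * (1 + norm Z) * (1 + norm Y)"
        by (simp add: algebra_simps)
      also have "\<dots> \<le> B * (1 + norm Y)"
        by (intro mult_right_mono) (auto simp: B_def)
      finally show ?thesis .
    qed
    show "F X \<le> F Y + \<Phi> Y \<bullet> (X - Y) + 1 * (norm (X - Y))\<^sup>2" for X Y
      by (rule semiconcave)
    show "0 < B"
      by (auto simp: B_def less_max_iff_disj intro!: disjI1 add_pos_nonneg)
    show "0 \<le> c"
      by (simp add: c_def le_max_iff_disj)
    show "0 < m"
      using l by (simp add: m_def)
    show "0 \<le> F Y" for Y
      by (simp add: proj_w_nonneg)
    show "F Y \<le> B * (1 + (norm Y)\<^sup>2)" for Y
    proof -
      have "F Y \<le> (\<integral>\<theta>. (norm Y + norm Z)\<^sup>2 \<partial>\<mu>)"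
        by (intro integral_mono proj_w_integrable proj_w_le integrable_const) simp
      also have "\<dots> \<le> (2 + 2 * (norm Z)\<^sup>2) * (1 + (norm Y)\<^sup>2)"
      proof -
        have "0 \<le> (norm Z)\<^sup>2 * (norm Y)\<^sup>2"
          by simp
        moreover have "(\<integral>\<theta>. (norm Y + norm Z)\<^sup>2 \<partial>\<mu>) = (norm Y + norm Z)\<^sup>2"
          by simp
        ultimately show ?thesis
          using sum_squares_bound[of "norm Y" "norm Z"] zero_le_power2[of "norm Y"] zero_le_power2[of "norm Z"]
          unfolding power2_sum distrib_left distrib_right mult_1_right mult.assoc by linarith
      qed
      also have "\<dots> \<le> B * (1 + (norm Y)\<^sup>2)"
        by (intro mult_right_mono) (auto simp: B_def)
      finally show ?thesis .
    qed
    show "m * (norm Y)\<^sup>2 \<le> F Y + c" for Y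
    proof -
      have "m * (norm Y)\<^sup>2 \<le> l / 2 * (norm Y)\<^sup>2"
        by (intro mult_right_mono) (auto simp: m_def)
      moreover have "(norm Z)\<^sup>2 \<le> c"
        by (simp add: c_def)
      ultimately show ?thesis
        using F_coercive[OF \<kappa>(2), of Y] by (simp add: l_def)
    qed
    show "m * (norm Y)\<^sup>2 \<le> (norm (\<Phi> Y))\<^sup>2 + c" for Y
    proof -
      have "m * (norm Y)\<^sup>2 \<le> l\<^sup>2 * (norm Y)\<^sup>2"
        by (intro mult_right_mono) (auto simp: m_def)
      moreover have "2 * l * (norm Z)\<^sup>2 \<le> c"
        by (simp add: c_def)
      ultimately show ?thesis
        using \<Phi>_coercive[OF \<kappa>, of Y] by (simp add: l_def)
    qed
    show "AE Y in lborel. GDERIV F Y :> \<Phi> Y"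
      using AE_distinct_projections
      by eventually_elim (rule semiconcave_imp_gradient[OF semiconcave zero_le_one isCont_\<Phi>])
  qed auto
  show ?thesis
    by (rule noised_sgd_near_critical[OF assms])
qed

end

theorem theorem4p2:
  fixes Z :: "real ^ 'd ^ 'n::{finite,linorder}"
    and F :: "real ^ 'd ^ 'n::{finite,linorder} \<Rightarrow> real"
    and \<mu> :: "(real ^ 'd) measure"
    and \<nu> :: "(real ^ 'd ^ 'n::{finite,linorder}) measure"
    and p :: nat and \<theta>s :: "nat \<Rightarrow> real ^ 'd"
    and \<tau> :: "real ^ 'd ^ 'n::{finite,linorder} \<Rightarrow> real ^ 'd \<Rightarrow> 'n \<Rightarrow> 'n"
    and \<alpha>\<^sub>0 a \<epsilon> :: real
  assumes F\<mu>: "(F = sw_energy Z \<and> \<mu> = uniform_sphere) \<or>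
      (F = sw_energy_p p \<theta>s Z \<and> \<mu> = discrete_directions p \<theta>s \<and>
        p \<ge> 1 \<and> \<theta>s ` {1..p} \<subseteq> sphere 0 1 \<and> span (\<theta>s ` {1..p}) = UNIV)"
    and \<tau>: "sorting_selection \<tau>"
    and \<alpha>\<^sub>0: "0 < \<alpha>\<^sub>0" "\<alpha>\<^sub>0 < 1"
    and a: "a > 0"
    and \<nu>: "prob_space \<nu>" "sets \<nu> = sets borel" "absolutely_continuous lborel \<nu>"
    and \<epsilon>: "\<epsilon> > 0"
  shows "((\<lambda>\<alpha>. limsup (\<lambda>t. emeasure (sample_measure \<nu> \<mu> gaussian)
            {\<omega> \<in> space (sample_measure \<nu> \<mu> gaussian).
               set_distance (noised_sgd (sw_grad \<tau> Z) a \<alpha> \<omega> t) (clarke_critical F) > ereal \<epsilon>}))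
          \<longlongrightarrow> 0) (at 0 within {0<..\<alpha>\<^sub>0})"
proof -
  have F: "F = (\<lambda>Y. \<integral>\<theta>. proj_w Z \<theta> Y \<partial>\<mu>)"
    using F\<mu> by (auto simp: sw_energy_def[abs_def] sw_energy_p_def[abs_def])
  have "prob_space \<mu>"
    using F\<mu> prob_space_uniform_sphere prob_space_discrete_directions by metis
  moreover have "sets \<mu> = sets sphere_borel"
    using F\<mu> by (auto simp: sets_uniform_sphere discrete_directions_def)
  \<comment> \<open>In the discrete case the spanning condition enters here.\<close>
  moreover have "\<not> (AE \<theta> in \<mu>. \<theta> \<bullet> v = 0)" if "v \<noteq> 0" for v
    using F\<mu> uniform_sphere_nondegenerate[OF that] discrete_directions_nondegenerate[OF _ _ _ that] by metis
  ultimately interpret sliced_wasserstein_sgd \<mu> \<tau> Z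
    by (intro sliced_wasserstein_sgd.intro sliced_wasserstein_sgd_axioms.intro \<tau>)
  show ?thesis
    unfolding F by (rule noised_sgd_near_critical[OF a \<epsilon> \<nu>(1,2)])
qed

end
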